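(* Let $R$ be an exchange ring, let $n\geq 3$ be an integer, and let $H$ be a subgroup of $\operatorname{GL}_n(R)$. Then $H$ is normalised by $\operatorname{E}_n(R)$ if and only if there is an ideal $I$ of $R$ such that \[\operatorname{E}_n(R,I)\subseteq H\subseteq \operatorname{C}_n(R,I).\] Moreover, the ideal $I$ is uniquely determined (i.e. for a given $H$ there is at most one ideal $I$ satisfying these inclusions).
   Context: Rings are associative with $1\neq 0$ (not necessarily commutative); an ideal means a two-sided ideal. A left $R$-module $M$ has the exchange property if for any module $X$ and decompositions $X=M'\oplus Y=\bigoplus_{\lambda\in\Lambda}N_\lambda$ with $M'\cong M$ (arbitrary index set $\Lambda$), there exist submodules $N'_\lambda\subseteq N_\lambda$ for each $\lambda$ such that $X=M'\oplus\bigoplus_{\lambda\in\Lambda}N'_\lambda$. A ring $R$ is an exchange ring if ${}_RR$ has the exchange property; equivalently (Nicholson), for every $x\in R$ there is an idempotent $e\in xR$ such that $1-e\in(1-x)R$. $\operatorname{GL}_n(R)$ is the group of invertible $n\times n$ matrices over $R$. Write $e$ for the identity matrix and $e^{ij}$ for the matrix with $1$ at position $(i,j)$ and zeros elsewhere. For $i\neq j$ in $\{1,\dots,n\}$ and $x\in R$, the elementary transvection is $t_{ij}(x)=e+xe^{ij}$. The elementary subgroup $\operatorname{E}_n(R)$ is the subgroup of $\operatorname{GL}_n(R)$ generated by all elementary transvections. For an ideal $I$ of $R$, $\operatorname{E}_n(I)$ is the subgroup generated by all $t_{ij}(x)$ with $x\in I$, $i\ne j$, and the elementary subgroup $\operatorname{E}_n(R,I)$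 of level $I$ is the normal closure of $\operatorname{E}_n(I)$ in $\operatorname{E}_n(R)$. The full congruence subgroup of level $I$ is $\operatorname{C}_n(R,I)=\phi^{-1}(\operatorname{Center}(\operatorname{GL}_n(R/I)))$, where $\phi:\operatorname{GL}_n(R)\to\operatorname{GL}_n(R/I)$ is induced by the canonical map $R\to R/I$ (for $I=R$ the target is the trivial group, so $\operatorname{C}_n(R,R)=\operatorname{GL}_n(R)$). A subgroup $H$ is normalised by $\operatorname{E}_n(R)$ if $g^{-1}hg\in H$ for all $h\in H$, $g\in\operatorname{E}_n(R)$. *)

theory Defs
  imports
    "Jordan_Normal_Form.Matrix"
    "HOL-Algebra.QuotRing"
    "HOL-Algebra.Generated_Groups"
begin

section \<open>Exchange rings\<close>

text \<open>The library locale for modules requires a commutative ring of scalars; its record type and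
  its notion of submodule do not, and are reused here.\<close>

locale left_module = R?: ring R + M?: abelian_group M
  for R (structure) and M (structure) +
  assumes smult_closed:
      "\<lbrakk>a \<in> carrier R; x \<in> carrier M\<rbrakk> \<Longrightarrow> a \<odot>\<^bsub>M\<^esub> x \<in> carrier M"
    and smult_l_distr:
      "\<lbrakk>a \<in> carrier R; b \<in> carrier R; x \<in> carrier M\<rbrakk> \<Longrightarrow>
        (a \<oplus>\<^bsub>R\<^esub> b) \<odot>\<^bsub>M\<^esub> x = a \<odot>\<^bsub>M\<^esub> x \<oplus>\<^bsub>M\<^esub> b \<odot>\<^bsub>M\<^esub> x"
    and smult_r_distr:
      "\<lbrakk>a \<in> carrier R; x \<in> carrier M; y \<in> carrier M\<rbrakk> \<Longrightarrow>
        a \<odot>\<^bsub>M\<^esub> (x \<oplus>\<^bsub>M\<^esub> y) = a \<odot>\<^bsub>M\<^esub> x \<oplus>\<^bsub>M\<^esub> a \<odot>\<^bsub>M\<^esub> y"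
    and smult_assoc1:
      "\<lbrakk>a \<in> carrier R; b \<in> carrier R; x \<in> carrier M\<rbrakk> \<Longrightarrow>
        (a \<otimes>\<^bsub>R\<^esub> b) \<odot>\<^bsub>M\<^esub> x = a \<odot>\<^bsub>M\<^esub> (b \<odot>\<^bsub>M\<^esub> x)"
    and smult_one:
      "x \<in> carrier M \<Longrightarrow> \<one>\<^bsub>R\<^esub> \<odot>\<^bsub>M\<^esub> x = x"

definition module_isomorphic ::
    "('a, 'r) ring_scheme \<Rightarrow> ('a, 'm, 's) module_scheme \<Rightarrow> ('a, 'x, 't) module_scheme \<Rightarrow> bool" where
  "module_isomorphic R M N \<longleftrightarrow>
    (\<exists>f. bij_betw f (carrier M) (carrier N) \<and>
      (\<forall>x\<in>carrier M. \<forall>y\<in>carrier M. f (x \<oplus>\<^bsub>M\<^esub> y) = f x \<oplus>\<^bsub>N\<^esub> f y) \<and>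
      (\<forall>a\<in>carrier R. \<forall>x\<in>carrier M. f (a \<odot>\<^bsub>M\<^esub> x) = a \<odot>\<^bsub>N\<^esub> f x))"

text \<open>The sum is taken over the support because \<^const>\<open>finsum\<close> over an infinite set is
  zero by convention.\<close>

definition internal_direct_sum ::
    "('a, 'r) ring_scheme \<Rightarrow> ('a, 'm, 's) module_scheme \<Rightarrow> 'i set \<Rightarrow> ('i \<Rightarrow> 'm set) \<Rightarrow> bool" where
  "internal_direct_sum R X L F \<longleftrightarrow>
    (\<forall>l\<in>L. submodule (F l) R X) \<and>
    (\<forall>x\<in>carrier X. \<exists>!f. f \<in> (\<Pi>\<^sub>E l\<in>L. F l) \<and> finite {l\<in>L. f l \<noteq> \<zero>\<^bsub>X\<^esub>} \<and>
      x = (\<Oplus>\<^bsub>X\<^esub>l\<in>{l\<in>L. f l \<noteq> \<zero>\<^bsub>X\<^esub>}. f l))"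

text \<open>The exchange property of \<open>M\<close> with respect to all modules \<open>X\<close> whose elements have type \<open>'x\<close>.
  Index sets are subsets of \<open>'x\<close> as well; this is no restriction, because the nonzero summands of
  a direct decomposition of \<open>X\<close> can be indexed by nonzero elements of \<open>X\<close>, and zero summands are
  irrelevant. The index \<open>None\<close> stands for the additional summand \<open>M'\<close>.\<close>

definition exchange_property ::
    "('a, 'r) ring_scheme \<Rightarrow> ('a, 'm, 's) module_scheme \<Rightarrow> 'x itself \<Rightarrow> bool" where
  "exchange_property R M T \<longleftrightarrow>
    (\<forall>(X :: ('a, 'x) module) M' Y (\<Lambda> :: 'x set) N.
      left_module R X \<and> submodule M' R X \<and> submodule Y R X \<and>
      module_isomorphic R (X\<lparr>carrier := M'\<rparr>) M \<and>
      internal_direct_sum R X UNIV (\<lambda>b. if b then M' else Y) \<and>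
      internal_direct_sum R X \<Lambda> N \<longrightarrow>
      (\<exists>N'. (\<forall>l\<in>\<Lambda>. submodule (N' l) R X \<and> N' l \<subseteq> N l) \<and>
        internal_direct_sum R X (insert None (Some ` \<Lambda>))
          (\<lambda>k. case k of None \<Rightarrow> M' | Some l \<Rightarrow> N' l)))"

definition regular_module :: "('a, 'r) ring_scheme \<Rightarrow> ('a, 'a) module" where
  "regular_module R =
    \<lparr>carrier = carrier R, monoid.mult = monoid.mult R, one = one R,
     zero = zero R, add = add R, module.smult = monoid.mult R\<rparr>"

text \<open>HOL has no quantification over types inside a formula, so the test modules \<open>X\<close> are those with
  elements in the type of sequences over \<open>'a\<close>. This does not change the notion. The universe contains
  a copy of \<open>R \<oplus> R\<close>; the exchange condition for this one module yields, for every \<open>x\<close>, an idempotent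
  \<open>e \<in> xR\<close> with \<open>1 - e \<in> (1 - x)R\<close>, and that implies the exchange property for arbitrary modules \<open>X\<close>
  (Warfield, Nicholson).\<close>

definition exchange_ring :: "('a, 'r) ring_scheme \<Rightarrow> bool" where
  "exchange_ring R \<longleftrightarrow> ring R \<and> \<one>\<^bsub>R\<^esub> \<noteq> \<zero>\<^bsub>R\<^esub> \<and>
    exchange_property R (regular_module R) TYPE(nat \<Rightarrow> 'a)"


section \<open>General linear groups and their subgroups\<close>

text \<open>The matrix operations of the library use the type class operations on the entries. Here only
  the type of matrices is used, and the entries are combined by the operations of \<open>R\<close>, which may
  be a quotient ring. Rows and columns are numbered from \<open>0\<close> to \<open>n - 1\<close>.\<close>

definition matrix_ring :: "nat \<Rightarrow> ('a, 'r) ring_scheme \<Rightarrow> 'a mat ring" where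
  "matrix_ring n R =
    \<lparr>carrier = {A \<in> carrier_mat n n. \<forall>i<n. \<forall>j<n. A $$ (i, j) \<in> carrier R},
     monoid.mult = (\<lambda>A B. mat n n (\<lambda>(i, j). \<Oplus>\<^bsub>R\<^esub>k\<in>{..<n}. A $$ (i, k) \<otimes>\<^bsub>R\<^esub> B $$ (k, j))),
     one = mat n n (\<lambda>(i, j). if i = j then \<one>\<^bsub>R\<^esub> else \<zero>\<^bsub>R\<^esub>),
     zero = mat n n (\<lambda>(i, j). \<zero>\<^bsub>R\<^esub>),
     add = (\<lambda>A B. mat n n (\<lambda>(i, j). A $$ (i, j) \<oplus>\<^bsub>R\<^esub> B $$ (i, j)))\<rparr>"

definition GL :: "nat \<Rightarrow> ('a, 'r) ring_scheme \<Rightarrow> 'a mat monoid" where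
  "GL n R = units_of (matrix_ring n R)"

definition transvection :: "nat \<Rightarrow> ('a, 'r) ring_scheme \<Rightarrow> nat \<Rightarrow> nat \<Rightarrow> 'a \<Rightarrow> 'a mat" where
  "transvection n R i j x =
    \<one>\<^bsub>matrix_ring n R\<^esub> \<oplus>\<^bsub>matrix_ring n R\<^esub> mat n n (\<lambda>(k, l). if k = i \<and> l = j then x else \<zero>\<^bsub>R\<^esub>)"

definition elementary_on :: "nat \<Rightarrow> ('a, 'r) ring_scheme \<Rightarrow> 'a set \<Rightarrow> 'a mat set" where
  "elementary_on n R I =
    generate (GL n R) {transvection n R i j x | i j x. i < n \<and> j < n \<and> i \<noteq> j \<and> x \<in> I}"

definition elementary_subgroup :: "nat \<Rightarrow> ('a, 'r) ring_scheme \<Rightarrow> 'a mat set" where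
  "elementary_subgroup n R = elementary_on n R (carrier R)"

definition normal_closure :: "('g, 'b) monoid_scheme \<Rightarrow> 'g set \<Rightarrow> 'g set" where
  "normal_closure G S = \<Inter>{N. N \<lhd> G \<and> S \<subseteq> N}"

definition relative_elementary :: "nat \<Rightarrow> ('a, 'r) ring_scheme \<Rightarrow> 'a set \<Rightarrow> 'a mat set" where
  "relative_elementary n R I =
    normal_closure ((GL n R)\<lparr>carrier := elementary_subgroup n R\<rparr>) (elementary_on n R I)"

definition group_center :: "('g, 'b) monoid_scheme \<Rightarrow> 'g set" where
  "group_center G = {z \<in> carrier G. \<forall>g\<in>carrier G. z \<otimes>\<^bsub>G\<^esub> g = g \<otimes>\<^bsub>G\<^esub> z}"

definition full_congruence :: "nat \<Rightarrow> ('a, 'r) ring_scheme \<Rightarrow> 'a set \<Rightarrow> 'a mat set" where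
  "full_congruence n R I =
    {A \<in> carrier (GL n R). map_mat (\<lambda>x. I +>\<^bsub>R\<^esub> x) A \<in> group_center (GL n (R Quot I))}"

definition normalised_by :: "('g, 'b) monoid_scheme \<Rightarrow> 'g set \<Rightarrow> 'g set \<Rightarrow> bool" where
  "normalised_by G H K \<longleftrightarrow> (\<forall>h\<in>H. \<forall>g\<in>K. inv\<^bsub>G\<^esub> g \<otimes>\<^bsub>G\<^esub> h \<otimes>\<^bsub>G\<^esub> g \<in> H)"

end

theory Submission
  imports Defs
begin

text \<open>If \<open>\<sigma>\<close> lies in the full congruence subgroup of level \<open>I\<close>, then \<open>[\<sigma>, t\<^sub>i\<^sub>j(x)]\<close> lies in the
  relative elementary subgroup: with \<open>u\<close> the \<open>i\<close>-th column of \<open>\<sigma>\<close> and \<open>v\<close> the \<open>j\<close>-th row of its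
  inverse, \<open>\<sigma> t\<^sub>i\<^sub>j(x) \<sigma>\<^sup>-\<^sup>1 = 1 + u x v\<close>; since \<open>v\<close> is unimodular, the exchange property writes \<open>x\<close> as a
  sum of multiples of idempotents \<open>e \<in> v\<^sub>m R\<close>, and for these elementary column operations reduce
  \<open>e v\<close> to its \<open>m\<close>-th entry.

  Conversely, let \<open>I\<close> consist of the \<open>x\<close> whose transvections lie in \<open>H\<close>. By the first part the
  image of \<open>H\<close> in \<open>GL\<^sub>n(R/I)\<close> contains no transvection, and such a subgroup is central:
  commutators show that an element fixing a row \<open>a \<epsilon>\<^sub>p\<close> fixes all rows \<open>a \<epsilon>\<^sub>m\<close>. Applied to
  \<open>\<sigma> k \<sigma>\<^sup>-\<^sup>1 k\<^sup>-\<^sup>1\<close> with suitable elementary \<open>k\<close>, this kills every idempotent in \<open>\<sigma>\<^sub>p\<^sub>j R\<close> for \<open>j \<noteq> p\<close>,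
  so that \<open>\<sigma>\<^sub>p\<^sub>p\<close> is right invertible by the exchange property, and then \<open>\<sigma>\<^sub>p\<^sub>j = 0\<close>.\<close>

section \<open>Matrices over a ring\<close>

text \<open>Entries neither commute nor need be units, so rows cannot be cleared by pivoting;
  idempotents take the place of pivots. If \<open>e = v r\<close> is an idempotent multiple of an
  entry \<open>v\<close>, then \<open>e\<close> times the row of \<open>v\<close> can be cleared
  against that entry. The price is a diagonal entry \<open>\<one> \<oplus> a\<close>, which no
  transvection has; the computation is arranged so that \<open>a f = a\<close> and
  \<open>f a = \<zero>\<close> for an idempotent \<open>f\<close>, and such a diagonal matrix is
  again a commutator.

  A further obstacle is that an element of \<open>H\<close> whose image is a transvection is only
  congruent to some \<open>t\<^sub>i\<^sub>j(x)\<close>. Its commutator with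
  \<open>t\<^sub>j\<^sub>k(\<one>)\<close>, for a third index \<open>k\<close>, differs from that of
  \<open>t\<^sub>i\<^sub>j(x)\<close> by an element of the relative elementary subgroup, and this
  puts \<open>t\<^sub>i\<^sub>k(x)\<close> into \<open>H\<close>. Over the quotient ring congruences
  become equations; the elementwise form of the exchange property is what makes this passage
  possible.\<close>

lemma (in abelian_monoid) finsum_swap:
  assumes "finite A" "finite B" "\<And>i j. i \<in> A \<Longrightarrow> j \<in> B \<Longrightarrow> f i j \<in> carrier G"
  shows "(\<Oplus>i\<in>A. \<Oplus>j\<in>B. f i j) = (\<Oplus>j\<in>B. \<Oplus>i\<in>A. f i j)"
  using assms(1,3)
proof (induction A rule: finite_induct)
  case empty
  then show ?case by simp
next
  case (insert a A)
  have "(\<Oplus>i\<in>insert a A. \<Oplus>j\<in>B. f i j) = (\<Oplus>j\<in>B. f a j) \<oplus> (\<Oplus>j\<in>B. \<Oplus>i\<in>A. f i j)"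
    using insert by (subst finsum_insert) (auto intro!: finsum_closed)
  also have "\<dots> = (\<Oplus>j\<in>B. f a j \<oplus> (\<Oplus>i\<in>A. f i j))"
    using insert by (subst finsum_addf) (auto intro!: finsum_closed)
  also have "\<dots> = (\<Oplus>j\<in>B. \<Oplus>i\<in>insert a A. f i j)"
    using insert by (intro finsum_cong') (auto intro!: finsum_closed)
  finally show ?case .
qed

lemma (in abelian_monoid) finsum_delta:
  assumes "finite A" "a \<in> A" "f a \<in> carrier G"
  shows "(\<Oplus>i\<in>A. if i = a then f i else \<zero>) = f a"
proof -
  have "(\<Oplus>i\<in>A. if i = a then f i else \<zero>) = (\<Oplus>i\<in>A. if a = i then (\<lambda>_. f a) i else \<zero>)"
    using assms by (intro finsum_cong') auto
  also have "\<dots> = f a"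
    using assms by (subst finsum_singleton) auto
  finally show ?thesis .
qed

lemma matrix_ring_entry:
  assumes "i < n" "j < n"
  shows matrix_ring_entry_mult:
      "(A \<otimes>\<^bsub>matrix_ring n R\<^esub> B) $$ (i, j) = (\<Oplus>\<^bsub>R\<^esub>k\<in>{..<n}. A $$ (i, k) \<otimes>\<^bsub>R\<^esub> B $$ (k, j))"
    and matrix_ring_entry_add: "(A \<oplus>\<^bsub>matrix_ring n R\<^esub> B) $$ (i, j) = A $$ (i, j) \<oplus>\<^bsub>R\<^esub> B $$ (i, j)"
    and matrix_ring_entry_one: "\<one>\<^bsub>matrix_ring n R\<^esub> $$ (i, j) = (if i = j then \<one>\<^bsub>R\<^esub> else \<zero>\<^bsub>R\<^esub>)"
    and matrix_ring_entry_zero: "\<zero>\<^bsub>matrix_ring n R\<^esub> $$ (i, j) = \<zero>\<^bsub>R\<^esub>"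
  using assms by (simp_all add: matrix_ring_def)

lemma matrix_ring_dims [simp]:
  "dim_row (A \<otimes>\<^bsub>matrix_ring n R\<^esub> B) = n" "dim_col (A \<otimes>\<^bsub>matrix_ring n R\<^esub> B) = n"
  "dim_row (A \<oplus>\<^bsub>matrix_ring n R\<^esub> B) = n" "dim_col (A \<oplus>\<^bsub>matrix_ring n R\<^esub> B) = n"
  "dim_row \<one>\<^bsub>matrix_ring n R\<^esub> = n" "dim_col \<one>\<^bsub>matrix_ring n R\<^esub> = n"
  "dim_row \<zero>\<^bsub>matrix_ring n R\<^esub> = n" "dim_col \<zero>\<^bsub>matrix_ring n R\<^esub> = n"
  by (simp_all add: matrix_ring_def)

locale matrix_ring_over = ring R for R (structure) and n :: nat
begin

abbreviation M where "M \<equiv> matrix_ring n R"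

lemma mat_carrier_iff:
  "A \<in> carrier M \<longleftrightarrow> dim_row A = n \<and> dim_col A = n \<and> (\<forall>i<n. \<forall>j<n. A $$ (i, j) \<in> carrier R)"
  by (auto simp: matrix_ring_def)

lemma entry_closed [simp]: "A \<in> carrier M \<Longrightarrow> i < n \<Longrightarrow> j < n \<Longrightarrow> A $$ (i, j) \<in> carrier R"
  by (simp add: mat_carrier_iff)

lemmas entry_mult = matrix_ring_entry_mult
lemmas entry_simps [simp] = matrix_ring_entry_add matrix_ring_entry_one matrix_ring_entry_zero

lemma mat_eqI:
  "A \<in> carrier M \<Longrightarrow> B \<in> carrier M \<Longrightarrow> (\<And>i j. i < n \<Longrightarrow> j < n \<Longrightarrow> A $$ (i, j) = B $$ (i, j)) \<Longrightarrow> A = B"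
  unfolding mat_carrier_iff by (intro eq_matI) simp_all

lemma mat_mult_closed: "A \<in> carrier M \<Longrightarrow> B \<in> carrier M \<Longrightarrow> A \<otimes>\<^bsub>M\<^esub> B \<in> carrier M"
  by (subst mat_carrier_iff) (simp add: entry_mult finsum_closed Pi_def)

lemma mat_add_closed: "A \<in> carrier M \<Longrightarrow> B \<in> carrier M \<Longrightarrow> A \<oplus>\<^bsub>M\<^esub> B \<in> carrier M"
  by (subst mat_carrier_iff) simp

lemma mat_one_closed: "\<one>\<^bsub>M\<^esub> \<in> carrier M"
  by (subst mat_carrier_iff) simp

lemma mat_zero_closed: "\<zero>\<^bsub>M\<^esub> \<in> carrier M"
  by (subst mat_carrier_iff) simp

lemma mat_one_mult: "A \<in> carrier M \<Longrightarrow> \<one>\<^bsub>M\<^esub> \<otimes>\<^bsub>M\<^esub> A = A"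
proof (rule mat_eqI)
  fix i j assume A: "A \<in> carrier M" and ij: "i < n" "j < n"
  have "(\<one>\<^bsub>M\<^esub> \<otimes>\<^bsub>M\<^esub> A) $$ (i, j) = (\<Oplus>k\<in>{..<n}. if k = i then A $$ (k, j) else \<zero>)"
    using A ij unfolding entry_mult[OF ij] by (intro finsum_cong') auto
  also have "\<dots> = A $$ (i, j)"
    using A ij by (subst finsum_delta) auto
  finally show "(\<one>\<^bsub>M\<^esub> \<otimes>\<^bsub>M\<^esub> A) $$ (i, j) = A $$ (i, j)" .
qed (auto intro: mat_mult_closed mat_one_closed)

lemma mat_mult_one: "A \<in> carrier M \<Longrightarrow> A \<otimes>\<^bsub>M\<^esub> \<one>\<^bsub>M\<^esub> = A"
proof (rule mat_eqI)
  fix i j assume A: "A \<in> carrier M" and ij: "i < n" "j < n"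
  have "(A \<otimes>\<^bsub>M\<^esub> \<one>\<^bsub>M\<^esub>) $$ (i, j) = (\<Oplus>k\<in>{..<n}. if k = j then A $$ (i, k) else \<zero>)"
    using A ij unfolding entry_mult[OF ij] by (intro finsum_cong') auto
  also have "\<dots> = A $$ (i, j)"
    using A ij by (subst finsum_delta) auto
  finally show "(A \<otimes>\<^bsub>M\<^esub> \<one>\<^bsub>M\<^esub>) $$ (i, j) = A $$ (i, j)" .
qed (auto intro: mat_mult_closed mat_one_closed)

lemma mat_mult_assoc:
  assumes "A \<in> carrier M" "B \<in> carrier M" "C \<in> carrier M"
  shows "A \<otimes>\<^bsub>M\<^esub> B \<otimes>\<^bsub>M\<^esub> C = A \<otimes>\<^bsub>M\<^esub> (B \<otimes>\<^bsub>M\<^esub> C)"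
proof (rule mat_eqI)
  fix i j assume ij: "i < n" "j < n"
  have "(A \<otimes>\<^bsub>M\<^esub> B \<otimes>\<^bsub>M\<^esub> C) $$ (i, j) =
      (\<Oplus>l\<in>{..<n}. \<Oplus>k\<in>{..<n}. A $$ (i, k) \<otimes> B $$ (k, l) \<otimes> C $$ (l, j))"
    using assms ij unfolding entry_mult[OF ij]
    by (intro finsum_cong') (auto simp: entry_mult finsum_ldistr intro!: finsum_closed)
  also have "\<dots> = (\<Oplus>k\<in>{..<n}. \<Oplus>l\<in>{..<n}. A $$ (i, k) \<otimes> B $$ (k, l) \<otimes> C $$ (l, j))"
    using assms ij by (intro finsum_swap) auto
  also have "\<dots> = (A \<otimes>\<^bsub>M\<^esub> (B \<otimes>\<^bsub>M\<^esub> C)) $$ (i, j)"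
    using assms ij unfolding entry_mult[OF ij]
    by (intro finsum_cong') (auto simp: entry_mult finsum_rdistr m_assoc intro!: finsum_closed finsum_cong')
  finally show "(A \<otimes>\<^bsub>M\<^esub> B \<otimes>\<^bsub>M\<^esub> C) $$ (i, j) = (A \<otimes>\<^bsub>M\<^esub> (B \<otimes>\<^bsub>M\<^esub> C)) $$ (i, j)" .
qed (use assms in \<open>auto intro: mat_mult_closed\<close>)

lemma matrix_ring_is_ring: "ring M"
proof (intro ringI abelian_groupI monoidI)
  fix A assume A: "A \<in> carrier M"
  let ?B = "mat n n (\<lambda>(i, j). \<ominus> A $$ (i, j))"
  have "?B \<in> carrier M"
    using A by (auto simp: mat_carrier_iff)
  moreover from this have "?B \<oplus>\<^bsub>M\<^esub> A = \<zero>\<^bsub>M\<^esub>"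
    using A by (intro mat_eqI) (auto simp: l_neg intro: mat_add_closed mat_zero_closed)
  ultimately show "\<exists>B\<in>carrier M. B \<oplus>\<^bsub>M\<^esub> A = \<zero>\<^bsub>M\<^esub>" by blast
next
  fix A B C assume "A \<in> carrier M" "B \<in> carrier M" "C \<in> carrier M"
  then show "(A \<oplus>\<^bsub>M\<^esub> B) \<otimes>\<^bsub>M\<^esub> C = A \<otimes>\<^bsub>M\<^esub> C \<oplus>\<^bsub>M\<^esub> B \<otimes>\<^bsub>M\<^esub> C"
    by (intro mat_eqI mat_mult_closed mat_add_closed)
      (simp_all add: entry_mult l_distr Pi_def finsum_addf[symmetric] del: finsum_addf,
        intro finsum_cong', simp_all add: l_distr Pi_def)
next
  fix A B C assume "A \<in> carrier M" "B \<in> carrier M" "C \<in> carrier M"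
  then show "C \<otimes>\<^bsub>M\<^esub> (A \<oplus>\<^bsub>M\<^esub> B) = C \<otimes>\<^bsub>M\<^esub> A \<oplus>\<^bsub>M\<^esub> C \<otimes>\<^bsub>M\<^esub> B"
    by (intro mat_eqI mat_mult_closed mat_add_closed)
      (simp_all add: entry_mult r_distr Pi_def finsum_addf[symmetric] del: finsum_addf,
        intro finsum_cong', simp_all add: r_distr Pi_def)
next
  fix A B C assume "A \<in> carrier M" "B \<in> carrier M" "C \<in> carrier M"
  then show "A \<oplus>\<^bsub>M\<^esub> B \<oplus>\<^bsub>M\<^esub> C = A \<oplus>\<^bsub>M\<^esub> (B \<oplus>\<^bsub>M\<^esub> C)"
    by (intro mat_eqI mat_add_closed) (simp_all add: a_assoc)
next
  fix A B assume "A \<in> carrier M" "B \<in> carrier M"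
  then show "A \<oplus>\<^bsub>M\<^esub> B = B \<oplus>\<^bsub>M\<^esub> A"
    by (intro mat_eqI mat_add_closed) (simp_all add: a_comm)
next
  fix A assume "A \<in> carrier M"
  then show "\<zero>\<^bsub>M\<^esub> \<oplus>\<^bsub>M\<^esub> A = A"
    by (intro mat_eqI mat_add_closed mat_zero_closed) simp_all
qed (simp_all add: mat_mult_closed mat_one_closed mat_zero_closed mat_add_closed mat_one_mult mat_mult_one
    mat_mult_assoc)

sublocale M: ring M
  by (rule matrix_ring_is_ring)

definition E :: "nat \<Rightarrow> nat \<Rightarrow> 'a \<Rightarrow> 'a mat" where
  "E i j x = mat n n (\<lambda>(k, l). if k = i \<and> l = j then x else \<zero>)"

lemma transvection_eq: "transvection n R i j x = \<one>\<^bsub>M\<^esub> \<oplus>\<^bsub>M\<^esub> E i j x"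
  by (simp add: transvection_def E_def)

lemma entry_E [simp]: "k < n \<Longrightarrow> l < n \<Longrightarrow> E i j x $$ (k, l) = (if k = i \<and> l = j then x else \<zero>)"
  by (simp add: E_def)

lemma E_closed [simp]: "x \<in> carrier R \<Longrightarrow> E i j x \<in> carrier M"
  unfolding mat_carrier_iff by (simp add: E_def)

lemma E_zero [simp]: "E i j \<zero> = \<zero>\<^bsub>M\<^esub>"
  by (rule mat_eqI) simp_all

lemma E_add: "x \<in> carrier R \<Longrightarrow> y \<in> carrier R \<Longrightarrow> E i j (x \<oplus> y) = E i j x \<oplus>\<^bsub>M\<^esub> E i j y"
  by (rule mat_eqI) simp_all

lemma E_minus: "x \<in> carrier R \<Longrightarrow> E i j (\<ominus> x) = \<ominus>\<^bsub>M\<^esub> E i j x"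
  by (rule M.minus_equality[symmetric]) (simp_all add: E_add[symmetric] l_neg)

lemma entry_minus [simp]:
  assumes "A \<in> carrier M" "i < n" "j < n"
  shows "(\<ominus>\<^bsub>M\<^esub> A) $$ (i, j) = \<ominus> A $$ (i, j)"
proof -
  have "(\<ominus>\<^bsub>M\<^esub> A \<oplus>\<^bsub>M\<^esub> A) $$ (i, j) = \<zero>"
    using assms by (simp add: M.l_neg)
  then show ?thesis
    using assms by (intro minus_equality[symmetric]) simp_all
qed

lemma entry_diff [simp]:
  "A \<in> carrier M \<Longrightarrow> B \<in> carrier M \<Longrightarrow> i < n \<Longrightarrow> j < n \<Longrightarrow>
    (A \<ominus>\<^bsub>M\<^esub> B) $$ (i, j) = A $$ (i, j) \<ominus> B $$ (i, j)"
  by (simp add: M.minus_eq minus_eq)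

lemma entry_E_mult [simp]:
  assumes "A \<in> carrier M" "x \<in> carrier R" "i < n" "j < n" "k < n" "l < n"
  shows "(E i j x \<otimes>\<^bsub>M\<^esub> A) $$ (k, l) = (if k = i then x \<otimes> A $$ (j, l) else \<zero>)"
proof -
  have "(E i j x \<otimes>\<^bsub>M\<^esub> A) $$ (k, l) = (\<Oplus>m\<in>{..<n}. if m = j then (if k = i then x else \<zero>) \<otimes> A $$ (m, l) else \<zero>)"
    unfolding entry_mult[OF assms(5,6)] using assms by (intro finsum_cong') auto
  also have "\<dots> = (if k = i then x \<otimes> A $$ (j, l) else \<zero>)"
    using assms by (subst finsum_delta) auto
  finally show ?thesis .
qed

lemma entry_mult_E [simp]:
  assumes "A \<in> carrier M" "x \<in> carrier R" "i < n" "j < n" "k < n" "l < n"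
  shows "(A \<otimes>\<^bsub>M\<^esub> E i j x) $$ (k, l) = (if l = j then A $$ (k, i) \<otimes> x else \<zero>)"
proof -
  have "(A \<otimes>\<^bsub>M\<^esub> E i j x) $$ (k, l) = (\<Oplus>m\<in>{..<n}. if m = i then A $$ (k, m) \<otimes> (if l = j then x else \<zero>) else \<zero>)"
    unfolding entry_mult[OF assms(5,6)] using assms by (intro finsum_cong') auto
  also have "\<dots> = (if l = j then A $$ (k, i) \<otimes> x else \<zero>)"
    using assms by (subst finsum_delta) auto
  finally show ?thesis .
qed

lemma E_mult_E:
  assumes "x \<in> carrier R" "y \<in> carrier R" "i < n" "j < n" "k < n" "l < n"
  shows "E i j x \<otimes>\<^bsub>M\<^esub> E k l y = (if j = k then E i l (x \<otimes> y) else \<zero>\<^bsub>M\<^esub>)"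
  using assms by (intro mat_eqI) auto

text \<open>The sandwich sees only the entry \<open>A $$ (j, k)\<close>. This is how a commutator
  involving an arbitrary matrix collapses to a transvection with a known coefficient.\<close>

lemma E_mult_mult_E:
  assumes "A \<in> carrier M" "x \<in> carrier R" "y \<in> carrier R" "i < n" "j < n" "k < n" "l < n"
  shows "E i j x \<otimes>\<^bsub>M\<^esub> (A \<otimes>\<^bsub>M\<^esub> E k l y) = E i l (x \<otimes> A $$ (j, k) \<otimes> y)"
  using assms by (intro mat_eqI) (auto simp: m_assoc)

end

section \<open>The exchange property of a ring\<close>

text \<open>Nicholson's elementwise condition, with \<open>x \<otimes> r\<close> as the idempotent.
  Explicit multipliers make it a system of equations, which ring homomorphisms preserve; the zero
  ring is included because it occurs as the quotient by \<open>R\<close> itself.\<close>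

definition right_exchange :: "('a, 'r) ring_scheme \<Rightarrow> bool" where
  "right_exchange R \<longleftrightarrow> (\<forall>x\<in>carrier R. \<exists>r\<in>carrier R. \<exists>s\<in>carrier R.
    (x \<otimes>\<^bsub>R\<^esub> r) \<otimes>\<^bsub>R\<^esub> (x \<otimes>\<^bsub>R\<^esub> r) = x \<otimes>\<^bsub>R\<^esub> r \<and> \<one>\<^bsub>R\<^esub> \<ominus>\<^bsub>R\<^esub> x \<otimes>\<^bsub>R\<^esub> r = (\<one>\<^bsub>R\<^esub> \<ominus>\<^bsub>R\<^esub> x) \<otimes>\<^bsub>R\<^esub> s)"

lemma right_exchangeE:
  assumes "right_exchange R" "x \<in> carrier R"
  obtains r s where "r \<in> carrier R" "s \<in> carrier R"
    "(x \<otimes>\<^bsub>R\<^esub> r) \<otimes>\<^bsub>R\<^esub> (x \<otimes>\<^bsub>R\<^esub> r) = x \<otimes>\<^bsub>R\<^esub> r" "\<one>\<^bsub>R\<^esub> \<ominus>\<^bsub>R\<^esub> x \<otimes>\<^bsub>R\<^esub> r = (\<one>\<^bsub>R\<^esub> \<ominus>\<^bsub>R\<^esub> x) \<otimes>\<^bsub>R\<^esub> s"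
  using assms unfolding right_exchange_def by blast

section \<open>Left modules and finite internal direct sums\<close>

context left_module
begin

lemma smult_zero_left: "x \<in> carrier M \<Longrightarrow> \<zero>\<^bsub>R\<^esub> \<odot>\<^bsub>M\<^esub> x = \<zero>\<^bsub>M\<^esub>"
  using smult_l_distr[of "\<zero>\<^bsub>R\<^esub>" "\<zero>\<^bsub>R\<^esub>" x] smult_closed[of "\<zero>\<^bsub>R\<^esub>" x]
  by (simp add: M.add.l_cancel_one')

lemma smult_minus_one:
  assumes "x \<in> carrier M"
  shows "(\<ominus>\<^bsub>R\<^esub> \<one>\<^bsub>R\<^esub>) \<odot>\<^bsub>M\<^esub> x = \<ominus>\<^bsub>M\<^esub> x"
proof (rule M.minus_equality[symmetric])
  show "(\<ominus>\<^bsub>R\<^esub> \<one>\<^bsub>R\<^esub>) \<odot>\<^bsub>M\<^esub> x \<oplus>\<^bsub>M\<^esub> x = \<zero>\<^bsub>M\<^esub>"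
    using smult_l_distr[of "\<ominus>\<^bsub>R\<^esub> \<one>\<^bsub>R\<^esub>" "\<one>\<^bsub>R\<^esub>" x] assms
    by (simp add: smult_one smult_zero_left R.l_neg)
qed (use assms in \<open>auto intro: smult_closed\<close>)

lemma submoduleI:
  assumes "H \<subseteq> carrier M" "\<zero>\<^bsub>M\<^esub> \<in> H"
    and "\<And>x y. x \<in> H \<Longrightarrow> y \<in> H \<Longrightarrow> x \<oplus>\<^bsub>M\<^esub> y \<in> H"
    and "\<And>a x. a \<in> carrier R \<Longrightarrow> x \<in> H \<Longrightarrow> a \<odot>\<^bsub>M\<^esub> x \<in> H"
  shows "submodule H R M"
proof (intro submodule.intro submodule_axioms.intro subgroup.intro)
  fix x assume x: "x \<in> H"
  then have "\<ominus>\<^bsub>M\<^esub> x \<in> H"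
    using assms(4)[of "\<ominus>\<^bsub>R\<^esub> \<one>\<^bsub>R\<^esub>" x] smult_minus_one[of x] assms(1) by auto
  then show "inv\<^bsub>add_monoid M\<^esub> x \<in> H"
    by (simp add: a_inv_def)
qed (use assms in auto)

end

lemma submodule_subset: "submodule H R X \<Longrightarrow> H \<subseteq> carrier X"
  using subgroup.subset[of H "add_monoid X"] by (auto simp: submodule_def)

lemma submodule_zero: "submodule H R X \<Longrightarrow> \<zero>\<^bsub>X\<^esub> \<in> H"
  using subgroup.one_closed[of H "add_monoid X"] by (auto simp: submodule_def)

lemma (in abelian_group) add_diff_cancel: "x \<in> carrier G \<Longrightarrow> y \<in> carrier G \<Longrightarrow> (x \<oplus> y) \<ominus> x = y"
  by (simp add: minus_eq a_comm[of x y] a_assoc r_neg)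

lemma (in abelian_group) add_left_imp_eq:
  "x \<in> carrier G \<Longrightarrow> y \<in> carrier G \<Longrightarrow> z \<in> carrier G \<Longrightarrow> x \<oplus> y = x \<oplus> z \<Longrightarrow> y = z"
  by (metis add_diff_cancel)

lemma (in abelian_group) eq_if_diff_zero: "x \<in> carrier G \<Longrightarrow> y \<in> carrier G \<Longrightarrow> x \<ominus> y = \<zero> \<Longrightarrow> x = y"
  by (metis add.inv_solve_right' l_zero minus_eq zero_closed)

text \<open>An abelian group whose record type is a module scheme, so that \<open>submodule\<close>
  and \<open>internal_direct_sum\<close> can be stated about it; the facts below are about sums and
  differences.\<close>

locale module_group = abelian_group G for G :: "('a, 'm, 's) module_scheme" (structure)
begin

lemma submodule_minus:
  assumes "submodule H R G" "x \<in> H" "y \<in> H"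
  shows "x \<ominus> y \<in> H"
  using assms subgroup.m_closed[of H "add_monoid G" x "\<ominus> y"] subgroup.m_inv_closed[of H "add_monoid G" y]
  by (auto simp: submodule_def a_inv_def a_minus_def)

text \<open>Terms outside the support are zero, so over a finite index set the sum over the support
  extends to all of \<open>L\<close>. This removes an index set that depends on
  \<open>f\<close>.\<close>

lemma internal_direct_sum_finite:
  assumes "finite L"
  shows "internal_direct_sum R G L F \<longleftrightarrow>
    (\<forall>l\<in>L. submodule (F l) R G) \<and>
    (\<forall>x\<in>carrier G. \<exists>!f. f \<in> (\<Pi>\<^sub>E l\<in>L. F l) \<and> x = (\<Oplus>l\<in>L. f l))"
proof -
  have "(\<Oplus>l\<in>{l\<in>L. f l \<noteq> \<zero>}. f l) = (\<Oplus>l\<in>L. f l)"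
    if "\<forall>l\<in>L. submodule (F l) R G" "f \<in> (\<Pi>\<^sub>E l\<in>L. F l)" for f
    using that assms submodule_subset[of "F _" R G]
    by (intro add.finprod_mono_neutral_cong_left) (auto simp: PiE_def Pi_def subset_iff)
  then have "f \<in> (\<Pi>\<^sub>E l\<in>L. F l) \<and> finite {l\<in>L. f l \<noteq> \<zero>} \<and> x = (\<Oplus>l\<in>{l\<in>L. f l \<noteq> \<zero>}. f l) \<longleftrightarrow>
      f \<in> (\<Pi>\<^sub>E l\<in>L. F l) \<and> x = (\<Oplus>l\<in>L. f l)"
    if "\<forall>l\<in>L. submodule (F l) R G" for f x
    using that assms by auto
  note iff = this
  show ?thesis
    unfolding internal_direct_sum_def by (rule conj_cong[OF refl]) (simp only: iff)
qed

lemma internal_direct_sum_two: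
  assumes "p \<noteq> q" "submodule (F p) R G" "submodule (F q) R G"
    and ex: "\<And>x. x \<in> carrier G \<Longrightarrow> \<exists>a\<in>F p. \<exists>b\<in>F q. x = a \<oplus> b"
    and int: "F p \<inter> F q \<subseteq> {\<zero>}"
  shows "internal_direct_sum R G {p, q} F"
proof -
  have sub: "F p \<subseteq> carrier G" "F q \<subseteq> carrier G"
    using assms(2,3)[THEN submodule_subset] .
  have sum: "(\<Oplus>l\<in>{p, q}. f l) = f p \<oplus> f q" if "f p \<in> F p" "f q \<in> F q" for f
    using that sub assms(1) by (subst finsum_insert) auto
  have "\<exists>!f. f \<in> (\<Pi>\<^sub>E l\<in>{p, q}. F l) \<and> x = (\<Oplus>l\<in>{p, q}. f l)" if x: "x \<in> carrier G" for x
  proof -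
    obtain a b where ab: "a \<in> F p" "b \<in> F q" "x = a \<oplus> b"
      using ex[OF x] by blast
    show ?thesis
    proof (rule ex1I[of _ "\<lambda>l\<in>{p, q}. if l = p then a else b"])
      show "(\<lambda>l\<in>{p, q}. if l = p then a else b) \<in> (\<Pi>\<^sub>E l\<in>{p, q}. F l) \<and>
          x = (\<Oplus>l\<in>{p, q}. (\<lambda>l\<in>{p, q}. if l = p then a else b) l)"
        using ab assms(1) by (auto simp: sum)
    next
      fix f assume f: "f \<in> (\<Pi>\<^sub>E l\<in>{p, q}. F l) \<and> x = (\<Oplus>l\<in>{p, q}. f l)"
      then have fpq: "f p \<in> F p" "f q \<in> F q"
        by auto
      then have eq: "a \<oplus> b = f p \<oplus> f q"
        using f ab(3) by (simp add: sum)
      then have carr: "a \<in> carrier G" "b \<in> carrier G" "f p \<in> carrier G" "f q \<in> carrier G"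
        using ab fpq sub by blast+
      \<comment> \<open>Adding and cancelling \<open>b\<close> brings in \<open>eq\<close>: the
        difference in the first summand equals the difference in the second, hence both lie in the
        intersection.\<close>
      have "a \<ominus> f p = ((b \<oplus> a) \<ominus> b) \<ominus> f p"
        using carr by (simp add: add_diff_cancel)
      also have "\<dots> = (f p \<oplus> (f q \<ominus> b)) \<ominus> f p"
        using carr eq by (simp add: a_comm[of b a] minus_eq a_assoc)
      also have "\<dots> = f q \<ominus> b"
        using carr by (simp add: add_diff_cancel)
      finally have "a \<ominus> f p = f q \<ominus> b" .
      moreover have "a \<ominus> f p \<in> F p" "f q \<ominus> b \<in> F q"
        using ab fpq assms by (auto intro: submodule_minus)
      ultimately have "a \<ominus> f p = \<zero>" "f q \<ominus> b = \<zero>"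
        using int by auto
      then have "f p = a" "f q = b"
        using carr by (metis eq_if_diff_zero)+
      then show "f = (\<lambda>l\<in>{p, q}. if l = p then a else b)"
        using f assms(1) by (auto simp: PiE_def extensional_def fun_eq_iff)
    qed
  qed
  then show ?thesis
    using assms by (simp add: internal_direct_sum_finite)
qed

text \<open>Turns decompositions given as functions on the index set into triples. The three
  summands will be \<open>M'\<close> and the two submodules of the coordinate axes that exchange
  provides.\<close>

lemma internal_direct_sum_three:
  assumes "internal_direct_sum R G {p, q, r} F" "p \<noteq> q" "p \<noteq> r" "q \<noteq> r"
  shows "\<And>x. x \<in> carrier G \<Longrightarrow> \<exists>a\<in>F p. \<exists>b\<in>F q. \<exists>c\<in>F r. x = a \<oplus> (b \<oplus> c)"
    and "\<And>a b c a' b' c'. a \<in> F p \<Longrightarrow> b \<in> F q \<Longrightarrow> c \<in> F r \<Longrightarrow> a' \<in> F p \<Longrightarrow> b' \<in> F q \<Longrightarrow> c' \<in> F r \<Longrightarrow>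
      a \<oplus> (b \<oplus> c) = a' \<oplus> (b' \<oplus> c') \<Longrightarrow> a = a' \<and> b = b' \<and> c = c'"
proof -
  have subm: "submodule (F p) R G" "submodule (F q) R G" "submodule (F r) R G"
    and ex1: "\<And>x. x \<in> carrier G \<Longrightarrow> \<exists>!f. f \<in> (\<Pi>\<^sub>E l\<in>{p, q, r}. F l) \<and> x = (\<Oplus>l\<in>{p, q, r}. f l)"
    using assms(1) by (auto simp: internal_direct_sum_finite)
  have sub: "F p \<subseteq> carrier G" "F q \<subseteq> carrier G" "F r \<subseteq> carrier G"
    using subm[THEN submodule_subset] .
  have sum: "(\<Oplus>l\<in>{p, q, r}. f l) = f p \<oplus> (f q \<oplus> f r)" if "f p \<in> F p" "f q \<in> F q" "f r \<in> F r" for f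
    using that sub assms by (auto simp: finsum_insert subset_iff)
  show "\<exists>a\<in>F p. \<exists>b\<in>F q. \<exists>c\<in>F r. x = a \<oplus> (b \<oplus> c)" if x: "x \<in> carrier G" for x
  proof -
    obtain f where f: "f \<in> (\<Pi>\<^sub>E l\<in>{p, q, r}. F l)" "x = (\<Oplus>l\<in>{p, q, r}. f l)"
      using ex1[OF x] by blast
    then have "f p \<in> F p" "f q \<in> F q" "f r \<in> F r"
      by auto
    then show ?thesis
      using f(2) sum[of f] by blast
  qed
  fix a b c a' b' c'
  assume A: "a \<in> F p" "b \<in> F q" "c \<in> F r" "a' \<in> F p" "b' \<in> F q" "c' \<in> F r"
    "a \<oplus> (b \<oplus> c) = a' \<oplus> (b' \<oplus> c')"
  define f where "f = (\<lambda>l\<in>{p, q, r}. if l = p then a else if l = q then b else c)"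
  define g where "g = (\<lambda>l\<in>{p, q, r}. if l = p then a' else if l = q then b' else c')"
  have f: "f p = a" "f q = b" "f r = c" "f \<in> (\<Pi>\<^sub>E l\<in>{p, q, r}. F l)"
    using A assms by (auto simp: f_def)
  have g: "g p = a'" "g q = b'" "g r = c'" "g \<in> (\<Pi>\<^sub>E l\<in>{p, q, r}. F l)"
    using A assms by (auto simp: g_def)
  have "a \<oplus> (b \<oplus> c) \<in> carrier G"
    using A(1-3) sub by blast
  moreover have "a \<oplus> (b \<oplus> c) = (\<Oplus>l\<in>{p, q, r}. f l)" "a \<oplus> (b \<oplus> c) = (\<Oplus>l\<in>{p, q, r}. g l)"
    using f g A by (auto simp: sum)
  ultimately have "f = g"
    using ex1[of "a \<oplus> (b \<oplus> c)"] f(4) g(4) by blast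
  then show "a = a' \<and> b = b' \<and> c = c'"
    using f g by auto
qed

end


text \<open>The module \<open>R \<oplus> R\<close>, with pairs coded as sequences.\<close>

definition seq_pair :: "('a, 'r) ring_scheme \<Rightarrow> 'a \<Rightarrow> 'a \<Rightarrow> nat \<Rightarrow> 'a" where
  "seq_pair R a b = (\<lambda>k. if k = 0 then a else if k = 1 then b else \<zero>\<^bsub>R\<^esub>)"

definition square_module :: "('a, 'r) ring_scheme \<Rightarrow> ('a, nat \<Rightarrow> 'a) module" where
  "square_module R =
    \<lparr>carrier = {seq_pair R a b | a b. a \<in> carrier R \<and> b \<in> carrier R},
     monoid.mult = (\<lambda>f g. f), one = (\<lambda>_. \<zero>\<^bsub>R\<^esub>), zero = (\<lambda>_. \<zero>\<^bsub>R\<^esub>),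
     add = (\<lambda>f g k. f k \<oplus>\<^bsub>R\<^esub> g k), module.smult = (\<lambda>a f k. a \<otimes>\<^bsub>R\<^esub> f k)\<rparr>"

lemma seq_pair_eq_iff [simp]: "seq_pair R a b = seq_pair R c d \<longleftrightarrow> a = c \<and> b = d"
  by (auto simp: seq_pair_def fun_eq_iff split: if_splits dest: spec[of _ 0] spec[of _ 1])

lemma square_module_carrier:
  "carrier (square_module R) = {seq_pair R a b | a b. a \<in> carrier R \<and> b \<in> carrier R}"
  and square_module_zero: "\<zero>\<^bsub>square_module R\<^esub> = seq_pair R \<zero>\<^bsub>R\<^esub> \<zero>\<^bsub>R\<^esub>"
  and square_module_add0: "f \<oplus>\<^bsub>square_module R\<^esub> g = (\<lambda>k. f k \<oplus>\<^bsub>R\<^esub> g k)"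
  and square_module_smult0: "a \<odot>\<^bsub>square_module R\<^esub> f = (\<lambda>k. a \<otimes>\<^bsub>R\<^esub> f k)"
  by (auto simp: square_module_def seq_pair_def fun_eq_iff)

lemma (in ring) square_module_ops:
  shows square_module_add: "seq_pair R a b \<oplus>\<^bsub>square_module R\<^esub> seq_pair R c d = seq_pair R (a \<oplus> c) (b \<oplus> d)"
    and square_module_smult: "r \<in> carrier R \<Longrightarrow> r \<odot>\<^bsub>square_module R\<^esub> seq_pair R a b = seq_pair R (r \<otimes> a) (r \<otimes> b)"
  by (auto simp: square_module_add0 square_module_smult0 seq_pair_def fun_eq_iff)

lemmas (in ring) square_module_simps =
  square_module_carrier square_module_zero square_module_add square_module_smult

lemma (in ring) square_module_left_module: "left_module R (square_module R)"
proof (intro left_module.intro left_module_axioms.intro abelian_groupI)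
  show "ring R" by (rule ring_axioms)
  fix x assume "x \<in> carrier (square_module R)"
  then obtain a b where ab: "x = seq_pair R a b" "a \<in> carrier R" "b \<in> carrier R"
    by (auto simp: square_module_carrier)
  then show "\<exists>y\<in>carrier (square_module R). y \<oplus>\<^bsub>square_module R\<^esub> x = \<zero>\<^bsub>square_module R\<^esub>"
    by (intro bexI[of _ "seq_pair R (\<ominus> a) (\<ominus> b)"]) (auto simp: square_module_simps l_neg)
qed (auto simp: square_module_simps a_ac l_distr r_distr m_assoc intro: a_closed)

lemma regular_module_simps:
  "carrier (regular_module R) = carrier R"
  "x \<oplus>\<^bsub>regular_module R\<^esub> y = x \<oplus>\<^bsub>R\<^esub> y"
  "a \<odot>\<^bsub>regular_module R\<^esub> y = a \<otimes>\<^bsub>R\<^esub> y"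
  by (simp_all add: regular_module_def)

text \<open>In \<open>R \<oplus> R\<close> exchange \<open>M' = R(x, 1 - x)\<close>, with complement \<open>{(a, -a)}\<close>, against the two
  coordinate axes. The \<open>M'\<close>-components of \<open>(1, 0)\<close> and \<open>(0, 1)\<close> are given by \<open>r\<close> and \<open>s\<close>.\<close>

theorem exchange_ring_right_exchange:
  fixes R :: "('a, 'r) ring_scheme" (structure)
  assumes "exchange_ring R"
  shows "right_exchange R"
  unfolding right_exchange_def
proof
  interpret ring R
    using assms by (simp add: exchange_ring_def)
  fix x assume x: "x \<in> carrier R"
  define y where "y = \<one> \<ominus> x"
  have y: "y \<in> carrier R"
    using x by (simp add: y_def)
  have xy: "x \<oplus> y = \<one>"
    unfolding y_def using x by algebra
  have split: "r \<otimes> x \<oplus> r \<otimes> y = r" if "r \<in> carrier R" for r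
    using that x y xy by (simp add: r_distr[symmetric])
  let ?X = "square_module R"
  let ?P = "seq_pair R"
  interpret X: left_module R ?X
    by (rule square_module_left_module)
  interpret X: module_group ?X ..
  define M' where "M' = {?P (r \<otimes> x) (r \<otimes> y) | r. r \<in> carrier R}"
  define Y where "Y = {?P a (\<ominus> a) | a. a \<in> carrier R}"
  \<comment> \<open>Indices must have the type of the elements of the test module. The constant
    sequences \<open>\<zero>\<close> and \<open>\<one>\<close> serve, and
    \<open>\<one> \<noteq> \<zero>\<close> keeps them apart.\<close>
  define p q :: "nat \<Rightarrow> 'a" where "p = (\<lambda>_. \<zero>)" and "q = (\<lambda>_. \<one>)"
  define N where "N = (\<lambda>l. if l = p then {?P a \<zero> | a. a \<in> carrier R} else {?P \<zero> a | a. a \<in> carrier R})"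
  have pq: "p \<noteq> q"
    using assms by (auto simp: exchange_ring_def p_def q_def fun_eq_iff)
  have M': "submodule M' R ?X"
  proof (rule X.submoduleI)
    show "\<zero>\<^bsub>?X\<^esub> \<in> M'"
      using x y by (auto simp: M'_def square_module_simps intro!: exI[of _ \<zero>])
    show "f \<oplus>\<^bsub>?X\<^esub> g \<in> M'" if fg: "f \<in> M'" "g \<in> M'" for f g
    proof -
      obtain r t where "f = ?P (r \<otimes> x) (r \<otimes> y)" "g = ?P (t \<otimes> x) (t \<otimes> y)" "r \<in> carrier R" "t \<in> carrier R"
        using fg by (auto simp: M'_def)
      then show ?thesis
        using x y by (auto simp: M'_def square_module_simps l_distr intro!: exI[of _ "r \<oplus> t"])
    qed
    show "a \<odot>\<^bsub>?X\<^esub> f \<in> M'" if af: "a \<in> carrier R" "f \<in> M'" for a f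
    proof -
      obtain r where "f = ?P (r \<otimes> x) (r \<otimes> y)" "r \<in> carrier R"
        using af by (auto simp: M'_def)
      then show ?thesis
        using x y af by (auto simp: M'_def square_module_simps m_assoc intro!: exI[of _ "a \<otimes> r"])
    qed
  qed (use x y in \<open>auto simp: M'_def square_module_simps\<close>)
  have Y: "submodule Y R ?X"
    by (rule X.submoduleI)
      (use x y in \<open>force simp: Y_def square_module_simps minus_add r_minus\<close>)+
  have Np: "submodule (N p) R ?X"
    by (rule X.submoduleI) (force simp: N_def square_module_simps)+
  have Nq: "submodule (N q) R ?X"
    using pq by (intro X.submoduleI) (force simp: N_def square_module_simps)+
  \<comment> \<open>Since \<open>x \<oplus> y = \<one>\<close>, the sum of the coordinates inverts
    the map that sends \<open>r\<close> to
    \<open>?P (r \<otimes> x) (r \<otimes> y)\<close>.\<close>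
  have iso: "module_isomorphic R (?X\<lparr>carrier := M'\<rparr>) (regular_module R)"
    unfolding module_isomorphic_def
  proof (intro exI[of _ "\<lambda>f. f 0 \<oplus> f 1"] conjI ballI)
    show "bij_betw (\<lambda>f. f 0 \<oplus> f 1) (carrier (?X\<lparr>carrier := M'\<rparr>)) (carrier (regular_module R))"
      using x y by (intro bij_betw_byWitness[where f' = "\<lambda>r. ?P (r \<otimes> x) (r \<otimes> y)"])
        (auto simp: M'_def regular_module_simps seq_pair_def split)
    show "(f \<oplus>\<^bsub>?X\<lparr>carrier := M'\<rparr>\<^esub> g) 0 \<oplus> (f \<oplus>\<^bsub>?X\<lparr>carrier := M'\<rparr>\<^esub> g) 1 =
        (f 0 \<oplus> f 1) \<oplus>\<^bsub>regular_module R\<^esub> (g 0 \<oplus> g 1)"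
      if "f \<in> carrier (?X\<lparr>carrier := M'\<rparr>)" "g \<in> carrier (?X\<lparr>carrier := M'\<rparr>)" for f g
      using that x y by (auto simp: M'_def regular_module_simps seq_pair_def square_module_add0 a_ac)
    show "(a \<odot>\<^bsub>?X\<lparr>carrier := M'\<rparr>\<^esub> f) 0 \<oplus> (a \<odot>\<^bsub>?X\<lparr>carrier := M'\<rparr>\<^esub> f) 1 =
        a \<odot>\<^bsub>regular_module R\<^esub> (f 0 \<oplus> f 1)"
      if "a \<in> carrier R" "f \<in> carrier (?X\<lparr>carrier := M'\<rparr>)" for a f
      using that x y by (auto simp: M'_def regular_module_simps seq_pair_def square_module_smult0 r_distr)
  qed
  have UNIV: "UNIV = {True, False}"
    by auto
  have dec1: "internal_direct_sum R ?X UNIV (\<lambda>b. if b then M' else Y)"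
    unfolding UNIV
  proof (rule X.internal_direct_sum_two)
    fix f assume "f \<in> carrier ?X"
    then obtain a b where ab: "f = ?P a b" "a \<in> carrier R" "b \<in> carrier R"
      by (auto simp: square_module_carrier)
    \<comment> \<open>Elements of \<open>Y\<close> have coordinate sum zero, so the coordinate sum
      of \<open>f\<close> is the coefficient of its component in \<open>M'\<close>.\<close>
    define r c where "r = a \<oplus> b" and "c = a \<ominus> r \<otimes> x"
    have rc: "r \<in> carrier R" "c \<in> carrier R"
      using ab x by (simp_all add: r_def c_def)
    have "r \<otimes> x \<oplus> c = a"
      unfolding c_def using ab(2) rc(1) x by algebra
    moreover have "r \<otimes> y \<oplus> \<ominus> c = (r \<otimes> x \<oplus> r \<otimes> y) \<ominus> a"
      unfolding c_def using ab(2) rc(1) x y by algebra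
    then have "r \<otimes> y \<oplus> \<ominus> c = r \<ominus> a"
      using split[OF rc(1)] by simp
    then have "r \<otimes> y \<oplus> \<ominus> c = b"
      unfolding r_def using ab(2,3) by algebra
    ultimately have "f = ?P (r \<otimes> x) (r \<otimes> y) \<oplus>\<^bsub>?X\<^esub> ?P c (\<ominus> c)"
      using ab by (simp add: square_module_simps)
    then show "\<exists>u\<in>if True then M' else Y. \<exists>v\<in>if False then M' else Y. f = u \<oplus>\<^bsub>?X\<^esub> v"
      using rc by (auto simp: M'_def Y_def)
  next
    show "(if True then M' else Y) \<inter> (if False then M' else Y) \<subseteq> {\<zero>\<^bsub>?X\<^esub>}"
    proof
      fix f assume "f \<in> (if True then M' else Y) \<inter> (if False then M' else Y)"
      then obtain r c where "r \<in> carrier R" "c \<in> carrier R" "f = ?P (r \<otimes> x) (r \<otimes> y)" "r \<otimes> x = c" "r \<otimes> y = \<ominus> c"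
        by (auto simp: M'_def Y_def)
      moreover from this have "r = \<zero>"
        using split[of r] by (simp add: r_neg)
      ultimately show "f \<in> {\<zero>\<^bsub>?X\<^esub>}"
        using x y by (simp add: square_module_simps)
    qed
  qed (use M' Y in auto)
  have dec2: "internal_direct_sum R ?X {p, q} N"
  proof (rule X.internal_direct_sum_two[where F = N, OF pq Np Nq])
    fix f assume "f \<in> carrier ?X"
    then obtain a b where ab: "f = ?P a b" "a \<in> carrier R" "b \<in> carrier R"
      by (auto simp: square_module_carrier)
    then show "\<exists>u\<in>N p. \<exists>v\<in>N q. f = u \<oplus>\<^bsub>?X\<^esub> v"
      using pq by (intro bexI[of _ "?P a \<zero>"] bexI[of _ "?P \<zero> b"]) (auto simp: N_def square_module_simps)
  qed (use pq in \<open>auto simp: N_def square_module_simps\<close>)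
  have exch: "exchange_property R (regular_module R) TYPE(nat \<Rightarrow> 'a)"
    using assms by (simp add: exchange_ring_def)
  obtain N' where N': "\<forall>l\<in>{p, q}. submodule (N' l) R ?X \<and> N' l \<subseteq> N l"
    and dec3: "internal_direct_sum R ?X (insert None (Some ` {p, q}))
          (\<lambda>k. case k of None \<Rightarrow> M' | Some l \<Rightarrow> N' l)"
  proof -
    have "\<exists>N'. (\<forall>l\<in>{p, q}. submodule (N' l) R ?X \<and> N' l \<subseteq> N l) \<and>
        internal_direct_sum R ?X (insert None (Some ` {p, q})) (\<lambda>k. case k of None \<Rightarrow> M' | Some l \<Rightarrow> N' l)"
      by (rule exch[unfolded exchange_property_def, rule_format, where Y = Y])
        (intro conjI square_module_left_module M' Y iso dec1 dec2)
    with that show thesis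
      by blast
  qed
  have idx: "insert None (Some ` {p, q}) = {None, Some p, Some q}"
    by simp
  note three = X.internal_direct_sum_three[OF dec3[unfolded idx], simplified, OF pq]
  have Np': "f \<in> N' p \<Longrightarrow> \<exists>a\<in>carrier R. f = ?P a \<zero>" and Nq': "f \<in> N' q \<Longrightarrow> \<exists>b\<in>carrier R. f = ?P \<zero> b" for f
    using N' pq by (auto simp: N_def)
  have N'_zero: "?P \<zero> \<zero> \<in> N' p" "?P \<zero> \<zero> \<in> N' q" "?P \<zero> \<zero> \<in> M'"
    using N' M' submodule_zero[of _ R ?X] by (auto simp: square_module_zero)
  have N'_smult: "c \<odot>\<^bsub>?X\<^esub> f \<in> N' l" if "c \<in> carrier R" "f \<in> N' l" "l \<in> {p, q}" for c f l
    using N' that submodule.smult_closed[of "N' l" R ?X c f] by auto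
  have N'_add: "f \<oplus>\<^bsub>?X\<^esub> g \<in> N' l" if "f \<in> N' l" "g \<in> N' l" "l \<in> {p, q}" for f g l
    using N' that subgroup.m_closed[of "N' l" "add_monoid ?X" f g] by (auto simp: submodule_def)
  have decomp: "\<exists>r\<in>carrier R. \<exists>a\<in>carrier R. \<exists>b\<in>carrier R. ?P a \<zero> \<in> N' p \<and> ?P \<zero> b \<in> N' q \<and>
      r \<otimes> x \<oplus> a = u \<and> r \<otimes> y \<oplus> b = v" if "u \<in> carrier R" "v \<in> carrier R" for u v
  proof -
    have "?P u v \<in> carrier ?X"
      using that by (auto simp: square_module_carrier)
    from three(1)[OF this] obtain m f g where "m \<in> M'" "f \<in> N' p" "g \<in> N' q"
      "?P u v = m \<oplus>\<^bsub>?X\<^esub> (f \<oplus>\<^bsub>?X\<^esub> g)"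
      by blast
    note mfg = this
    obtain r where r: "r \<in> carrier R" "m = ?P (r \<otimes> x) (r \<otimes> y)"
      using mfg(1) by (auto simp: M'_def)
    obtain a where a: "a \<in> carrier R" "f = ?P a \<zero>"
      using Np'[OF mfg(2)] by blast
    obtain b where b: "b \<in> carrier R" "g = ?P \<zero> b"
      using Nq'[OF mfg(3)] by blast
    show ?thesis
      using x y mfg r a b by (intro bexI[of _ r] bexI[of _ a] bexI[of _ b]) (simp_all add: square_module_simps)
  qed
  have unique: "r = r' \<and> a = a' \<and> b = b'"
    if "r \<in> carrier R" "r' \<in> carrier R" "?P a \<zero> \<in> N' p" "?P a' \<zero> \<in> N' p" "?P \<zero> b \<in> N' q" "?P \<zero> b' \<in> N' q"
      "r \<otimes> x \<oplus> a = r' \<otimes> x \<oplus> a'" "r \<otimes> y \<oplus> b = r' \<otimes> y \<oplus> b'" for r r' a a' b b'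
  proof -
    have "a \<in> carrier R \<and> a' \<in> carrier R \<and> b \<in> carrier R \<and> b' \<in> carrier R"
      using Np'[OF that(3)] Np'[OF that(4)] Nq'[OF that(5)] Nq'[OF that(6)] by simp
    then have "?P (r \<otimes> x) (r \<otimes> y) = ?P (r' \<otimes> x) (r' \<otimes> y) \<and> ?P a \<zero> = ?P a' \<zero> \<and> ?P \<zero> b = ?P \<zero> b'"
      using that x y by (intro three(2)) (auto simp: M'_def square_module_simps)
    then have "r \<otimes> x = r' \<otimes> x" "r \<otimes> y = r' \<otimes> y" "a = a'" "b = b'"
      by simp_all
    then show ?thesis
      using split[OF that(1)] split[OF that(2)] by metis
  qed
  obtain r a b where r: "r \<in> carrier R" "a \<in> carrier R" "b \<in> carrier R" "?P a \<zero> \<in> N' p" "?P \<zero> b \<in> N' q"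
    "r \<otimes> x \<oplus> a = \<one>" "r \<otimes> y \<oplus> b = \<zero>"
    using decomp[of \<one> \<zero>] by auto
  obtain s c d where s: "s \<in> carrier R" "c \<in> carrier R" "d \<in> carrier R" "?P c \<zero> \<in> N' p" "?P \<zero> d \<in> N' q"
    "s \<otimes> x \<oplus> c = \<zero>" "s \<otimes> y \<oplus> d = \<one>"
    using decomp[of \<zero> \<one>] by auto
  show "\<exists>r\<in>carrier R. \<exists>s\<in>carrier R. (x \<otimes> r) \<otimes> (x \<otimes> r) = x \<otimes> r \<and> \<one> \<ominus> x \<otimes> r = (\<one> \<ominus> x) \<otimes> s"
  proof (rule bexI[of _ r], rule bexI[of _ s], rule conjI)
    \<comment> \<open>The decomposition of \<open>(\<one>, \<zero>)\<close> multiplied by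
      \<open>a\<close> is a decomposition of \<open>(a, \<zero>)\<close>. That element already lies
      in \<open>N' p\<close>, so its component in \<open>M'\<close> is zero.\<close>
    have a_r: "a \<otimes> r = \<zero>"
    proof -
      have "a \<otimes> r = \<zero> \<and> a \<otimes> a = a \<and> a \<otimes> b = \<zero>"
      proof (rule unique)
        show "?P (a \<otimes> a) \<zero> \<in> N' p"
          using N'_smult[OF r(2,4)] r(2) by (simp add: square_module_smult)
        show "?P \<zero> (a \<otimes> b) \<in> N' q"
          using N'_smult[OF r(2,5)] r(2) by (simp add: square_module_smult)
        show "a \<otimes> r \<otimes> x \<oplus> a \<otimes> a = \<zero> \<otimes> x \<oplus> a"
          using arg_cong[OF r(6), of "(\<otimes>) a"] r(1-3) x by (simp add: r_distr m_assoc)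
        show "a \<otimes> r \<otimes> y \<oplus> a \<otimes> b = \<zero> \<otimes> y \<oplus> \<zero>"
          using arg_cong[OF r(7), of "(\<otimes>) a"] r(1-3) y by (simp add: r_distr m_assoc)
      qed (use r N'_zero in auto)
      then show ?thesis
        by blast
    qed
    have rxr: "r \<otimes> x \<otimes> r = r"
    proof -
      have "r = (r \<otimes> x \<oplus> a) \<otimes> r"
        using r(1) by (simp add: r(6))
      also have "\<dots> = r \<otimes> x \<otimes> r"
        using r(1-3) x a_r by (simp add: l_distr)
      finally show ?thesis by simp
    qed
    then show "x \<otimes> r \<otimes> (x \<otimes> r) = x \<otimes> r"
      using r(1) x by (simp add: m_assoc)
    \<comment> \<open>The decomposition of \<open>(\<one>, \<zero>)\<close> times \<open>x\<close>
      plus that of \<open>(\<zero>, \<one>)\<close> times \<open>y\<close> decomposes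
      \<open>(x, y)\<close>, the generator of \<open>M'\<close>, whose coefficient there is
      \<open>\<one>\<close>.\<close>
    have "x \<otimes> r \<oplus> y \<otimes> s = \<one> \<and> x \<otimes> a \<oplus> y \<otimes> c = \<zero> \<and> x \<otimes> b \<oplus> y \<otimes> d = \<zero>"
    proof (rule unique)
      show "?P (x \<otimes> a \<oplus> y \<otimes> c) \<zero> \<in> N' p"
        using N'_add[OF N'_smult[OF x r(4)] N'_smult[OF y s(4)]] x y by (simp add: square_module_simps)
      show "?P \<zero> (x \<otimes> b \<oplus> y \<otimes> d) \<in> N' q"
        using N'_add[OF N'_smult[OF x r(5)] N'_smult[OF y s(5)]] x y by (simp add: square_module_simps)
      have "(x \<otimes> r \<oplus> y \<otimes> s) \<otimes> x \<oplus> (x \<otimes> a \<oplus> y \<otimes> c) = x \<otimes> (r \<otimes> x \<oplus> a) \<oplus> y \<otimes> (s \<otimes> x \<oplus> c)"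
        using r(1-3) s(1-3) x y by algebra
      then show "(x \<otimes> r \<oplus> y \<otimes> s) \<otimes> x \<oplus> (x \<otimes> a \<oplus> y \<otimes> c) = \<one> \<otimes> x \<oplus> \<zero>"
        using x y by (simp add: r(6) s(6))
      have "(x \<otimes> r \<oplus> y \<otimes> s) \<otimes> y \<oplus> (x \<otimes> b \<oplus> y \<otimes> d) = x \<otimes> (r \<otimes> y \<oplus> b) \<oplus> y \<otimes> (s \<otimes> y \<oplus> d)"
        using r(1-3) s(1-3) x y by algebra
      then show "(x \<otimes> r \<oplus> y \<otimes> s) \<otimes> y \<oplus> (x \<otimes> b \<oplus> y \<otimes> d) = \<one> \<otimes> y \<oplus> \<zero>"
        using x y by (simp add: r(7) s(7))
    qed (use r s x y N'_zero in auto)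
    then have one: "x \<otimes> r \<oplus> y \<otimes> s = \<one>"
      by blast
    have "\<one> \<ominus> x \<otimes> r = (x \<otimes> r \<oplus> y \<otimes> s) \<ominus> x \<otimes> r"
      unfolding one ..
    also have "\<dots> = y \<otimes> s"
      using r(1) s(1) x y by (simp add: a_minus_def a_comm[of "x \<otimes> r" "y \<otimes> s"] a_assoc r_neg)
    finally show "\<one> \<ominus> x \<otimes> r = (\<one> \<ominus> x) \<otimes> s"
      unfolding y_def .
  qed (use r s in auto)
qed

section \<open>Transvections\<close>

text \<open>The simplifier's normal form of sums does not move \<open>x\<close> next to \<open>\<ominus> x\<close>.\<close>

lemma (in abelian_group) add_minus_cancel:
  assumes "x \<in> carrier G" "u \<in> carrier G" "v \<in> carrier G" "w \<in> carrier G"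
  shows "x \<oplus> (u \<oplus> \<ominus> x) = u" "x \<oplus> (u \<oplus> (\<ominus> x \<oplus> v)) = u \<oplus> v"
    "x \<oplus> (u \<oplus> (v \<oplus> \<ominus> x)) = u \<oplus> v" "x \<oplus> (u \<oplus> (v \<oplus> (\<ominus> x \<oplus> w))) = u \<oplus> (v \<oplus> w)"
  using assms by (simp_all add: a_lcomm[of x] r_neg r_neg2)

text \<open>Both squares and every product with \<open>Z\<close> directly left of \<open>T\<close>
  vanish, so the expansion leaves \<open>T \<otimes> Z\<close>. Nothing is asked of
  \<open>T \<otimes> Z\<close>; hence the identity covers two transvections as well as a
  transvection against a matrix whose nontrivial part is one row or one column.\<close>

lemma (in ring) unipotent_commutator:
  assumes "T \<in> carrier R" "Z \<in> carrier R" "Z \<otimes> T = \<zero>" "Z \<otimes> Z = \<zero>" "T \<otimes> T = \<zero>"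
  shows "(\<one> \<oplus> T) \<otimes> (\<one> \<oplus> Z) \<otimes> (\<one> \<ominus> T) \<otimes> (\<one> \<ominus> Z) = \<one> \<oplus> T \<otimes> Z"
proof -
  have 0: "Z \<otimes> (T \<otimes> W) = \<zero>" "Z \<otimes> (Z \<otimes> W) = \<zero>" "T \<otimes> (T \<otimes> W) = \<zero>" if "W \<in> carrier R" for W
    using assms that by (simp_all add: m_assoc[symmetric])
  show ?thesis
    using assms(1,2) by (simp add: ring_simprules assms(3-5) 0 add_minus_cancel)
qed

lemma (in ring) one_add_square_zero_inv:
  assumes "Z \<in> carrier R" "Z \<otimes> Z = \<zero>"
  shows "(\<one> \<oplus> Z) \<otimes> (\<one> \<ominus> Z) = \<one>" "(\<one> \<ominus> Z) \<otimes> (\<one> \<oplus> Z) = \<one>"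
  using assms by (simp_all add: ring_simprules add_minus_cancel)

lemma (in ring) Units_one_add:
  assumes "Z \<in> carrier R" "Z \<otimes> Z = \<zero>"
  shows "\<one> \<oplus> Z \<in> Units R" "inv (\<one> \<oplus> Z) = \<one> \<ominus> Z"
proof -
  show "\<one> \<oplus> Z \<in> Units R"
    using assms one_add_square_zero_inv[OF assms] unfolding Units_def by auto
  show "inv (\<one> \<oplus> Z) = \<one> \<ominus> Z"
    using assms one_add_square_zero_inv[OF assms] by (intro inv_char) auto
qed

context matrix_ring_over
begin

lemma E_square_zero: "i \<noteq> j \<Longrightarrow> i < n \<Longrightarrow> j < n \<Longrightarrow> x \<in> carrier R \<Longrightarrow> E i j x \<otimes>\<^bsub>M\<^esub> E i j x = \<zero>\<^bsub>M\<^esub>"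
  by (simp add: E_mult_E)

lemma transvection_minus:
  "x \<in> carrier R \<Longrightarrow> transvection n R i j (\<ominus> x) = \<one>\<^bsub>M\<^esub> \<ominus>\<^bsub>M\<^esub> E i j x"
  by (simp add: transvection_eq E_minus M.minus_eq)

lemma transvection_closed [simp]: "x \<in> carrier R \<Longrightarrow> transvection n R i j x \<in> carrier M"
  by (simp add: transvection_eq)

lemma transvection_Units:
  "i \<noteq> j \<Longrightarrow> i < n \<Longrightarrow> j < n \<Longrightarrow> x \<in> carrier R \<Longrightarrow> transvection n R i j x \<in> Units M"
  unfolding transvection_eq by (intro M.Units_one_add E_square_zero) simp_all

lemma transvection_inv:
  "i \<noteq> j \<Longrightarrow> i < n \<Longrightarrow> j < n \<Longrightarrow> x \<in> carrier R \<Longrightarrow>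
    inv\<^bsub>M\<^esub> transvection n R i j x = transvection n R i j (\<ominus> x)"
  unfolding transvection_minus unfolding transvection_eq
  by (intro M.Units_one_add E_square_zero) simp_all

lemma transvection_add:
  "i \<noteq> j \<Longrightarrow> i < n \<Longrightarrow> j < n \<Longrightarrow> x \<in> carrier R \<Longrightarrow> y \<in> carrier R \<Longrightarrow>
    transvection n R i j x \<otimes>\<^bsub>M\<^esub> transvection n R i j y = transvection n R i j (x \<oplus> y)"
  unfolding transvection_eq
  by (simp add: E_add M.l_distr M.r_distr E_mult_E M.a_assoc M.a_comm[of "E i j y"])

lemma transvection_zero [simp]: "transvection n R i j \<zero> = \<one>\<^bsub>M\<^esub>"
  by (simp add: transvection_eq)

lemma transvection_commutator:
  assumes "i < n" "j < n" "k < n" "i \<noteq> j" "j \<noteq> k" "i \<noteq> k" "x \<in> carrier R" "y \<in> carrier R"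
  shows "transvection n R i j x \<otimes>\<^bsub>M\<^esub> transvection n R j k y \<otimes>\<^bsub>M\<^esub> transvection n R i j (\<ominus> x) \<otimes>\<^bsub>M\<^esub>
    transvection n R j k (\<ominus> y) = transvection n R i k (x \<otimes> y)"
  using M.unipotent_commutator[of "E i j x" "E j k y"] assms
  by (simp add: transvection_minus E_mult_E) (simp add: transvection_eq)

end

section \<open>Normalised subgroups without transvections\<close>

text \<open>The point where \<open>n \<ge> 3\<close> enters. The case \<open>p = q\<close> is
  included, because the arguments below avoid two indices that may coincide.\<close>

lemma ex_third_index:
  assumes "n \<ge> 3"
  shows "\<exists>k<n. k \<noteq> p \<and> k \<noteq> (q :: nat)"
proof -
  have "\<not> {0, 1, 2} \<subseteq> {p, q}"
  proof
    assume "{0, 1, 2} \<subseteq> {p, q}"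
    then have "card {0, 1, 2 :: nat} \<le> card {p, q}"
      by (intro card_mono) auto
    also have "\<dots> \<le> 2"
      by (simp add: card_insert_if)
    finally show False
      by simp
  qed
  then obtain k where "k \<in> {0, 1, 2}" "k \<notin> {p, q}"
    by blast
  then show ?thesis
    using assms by (intro exI[of _ k]) auto
qed

text \<open>The intended instance is the image of \<open>H\<close> over the quotient by its level.
  Conjugation is demanded for single transvections, which lift to \<open>R\<close>.\<close>

locale transvection_free_subgroup = matrix_ring_over R n for R (structure) and n +
  fixes K
  assumes n3: "n \<ge> 3"
    and exch: "right_exchange R"
    and K_Units: "K \<subseteq> Units M"
    and K_mult: "g \<in> K \<Longrightarrow> h \<in> K \<Longrightarrow> g \<otimes>\<^bsub>M\<^esub> h \<in> K"
    and K_inv: "g \<in> K \<Longrightarrow> inv\<^bsub>M\<^esub> g \<in> K"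
    and K_conj: "g \<in> K \<Longrightarrow> i < n \<Longrightarrow> j < n \<Longrightarrow> i \<noteq> j \<Longrightarrow> x \<in> carrier R \<Longrightarrow>
      transvection n R i j x \<otimes>\<^bsub>M\<^esub> g \<otimes>\<^bsub>M\<^esub> transvection n R i j (\<ominus> x) \<in> K"
    and K_free: "i < n \<Longrightarrow> j < n \<Longrightarrow> i \<noteq> j \<Longrightarrow> x \<in> carrier R \<Longrightarrow> transvection n R i j x \<in> K \<Longrightarrow> x = \<zero>"
begin

lemma K_closed: "g \<in> K \<Longrightarrow> g \<in> carrier M"
  using K_Units M.Units_closed by blast

lemma commutator_mem:
  assumes "g \<in> K" "i < n" "j < n" "i \<noteq> j" "x \<in> carrier R"
  shows "g \<otimes>\<^bsub>M\<^esub> transvection n R i j x \<otimes>\<^bsub>M\<^esub> inv\<^bsub>M\<^esub> g \<otimes>\<^bsub>M\<^esub> transvection n R i j (\<ominus> x) \<in> K"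
  using K_mult[OF assms(1) K_conj[OF K_inv[OF assms(1)] assms(2-5)]] assms K_closed[OF K_inv[OF assms(1)]]
  by (simp add: K_closed M.m_assoc)

text \<open>The hypothesis says that \<open>a\<close> times row \<open>p\<close> of \<open>h\<close>
  is \<open>a\<close> times the unit row. It makes the commutator of \<open>h\<close> with
  \<open>transvection n R j p a\<close> collapse to \<open>1 + (h - 1) E j p a\<close>, which is
  nontrivial only in column \<open>p\<close>. A second commutator, with
  \<open>transvection n R k l \<one>\<close>, moves the entry of that column in row \<open>l\<close>
  into a transvection, which must be trivial.\<close>

lemma fixes_column_if_fixes_row:
  assumes "h \<in> K" "p < n" "j < n" "j \<noteq> p" "a \<in> carrier R" "E p p a \<otimes>\<^bsub>M\<^esub> h = E p p a"
  shows "h \<otimes>\<^bsub>M\<^esub> E j j a = E j j a"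
proof -
  have h: "h \<in> carrier M" "h \<in> Units M"
    using assms K_closed K_Units by auto
  have hi: "inv\<^bsub>M\<^esub> h \<in> carrier M"
    using h by simp
  let ?E = "E j p a" and ?q = "h \<ominus>\<^bsub>M\<^esub> \<one>\<^bsub>M\<^esub>"
  have "E j p \<one> \<otimes>\<^bsub>M\<^esub> E p p a \<otimes>\<^bsub>M\<^esub> h = E j p \<one> \<otimes>\<^bsub>M\<^esub> E p p a"
    using assms h by (simp add: M.m_assoc)
  then have Eh: "?E \<otimes>\<^bsub>M\<^esub> h = ?E"
    using assms(2-5) by (simp add: E_mult_E)
  then have "?E \<otimes>\<^bsub>M\<^esub> h \<otimes>\<^bsub>M\<^esub> inv\<^bsub>M\<^esub> h = ?E \<otimes>\<^bsub>M\<^esub> inv\<^bsub>M\<^esub> h"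
    by simp
  then have Ehi: "?E \<otimes>\<^bsub>M\<^esub> inv\<^bsub>M\<^esub> h = ?E"
    using assms h by (simp add: M.m_assoc)
  have EE: "?E \<otimes>\<^bsub>M\<^esub> ?E = \<zero>\<^bsub>M\<^esub>"
    using assms by (simp add: E_mult_E)
  let ?Z = "?q \<otimes>\<^bsub>M\<^esub> ?E"
  have Z: "?Z \<in> carrier M"
    using assms h by simp
  have Eq: "?E \<otimes>\<^bsub>M\<^esub> ?q = \<zero>\<^bsub>M\<^esub>"
    using assms h by (simp add: M.minus_eq M.r_distr M.r_minus Eh M.r_neg)
  have ZZ: "?Z \<otimes>\<^bsub>M\<^esub> ?Z = \<zero>\<^bsub>M\<^esub>"
    using assms h Eq by (simp add: M.m_assoc M.m_assoc[of ?E ?q ?E, symmetric])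
  have "h \<otimes>\<^bsub>M\<^esub> transvection n R j p a \<otimes>\<^bsub>M\<^esub> inv\<^bsub>M\<^esub> h \<otimes>\<^bsub>M\<^esub> transvection n R j p (\<ominus> a) = \<one>\<^bsub>M\<^esub> \<oplus>\<^bsub>M\<^esub> ?Z"
    unfolding transvection_minus[OF assms(5)] unfolding transvection_eq using assms(2-5) h hi
    by (simp add: M.ring_simprules EE Ehi M.add_minus_cancel)
  then have ZK: "\<one>\<^bsub>M\<^esub> \<oplus>\<^bsub>M\<^esub> ?Z \<in> K"
    using commutator_mem[OF assms(1,3,2,4,5)] by simp
  have "?q $$ (l, j) \<otimes> a = \<zero>" if l: "l < n" for l
  proof -
    \<comment> \<open>\<open>k \<noteq> p\<close> makes \<open>?Z\<close> times \<open>?T\<close>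
      vanish, and \<open>k \<noteq> l\<close> makes \<open>?T\<close> square to zero;
      \<open>l = p\<close> is possible.\<close>
    obtain k where k: "k < n" "k \<noteq> p" "k \<noteq> l"
      using ex_third_index[OF n3] by blast
    let ?T = "E k l \<one>"
    have ZT: "?Z \<otimes>\<^bsub>M\<^esub> ?T = \<zero>\<^bsub>M\<^esub>"
      using assms h k l by (simp add: M.m_assoc E_mult_E)
    have "transvection n R k l \<one> \<otimes>\<^bsub>M\<^esub> (\<one>\<^bsub>M\<^esub> \<oplus>\<^bsub>M\<^esub> ?Z) \<otimes>\<^bsub>M\<^esub> transvection n R k l (\<ominus> \<one>) \<otimes>\<^bsub>M\<^esub> inv\<^bsub>M\<^esub> (\<one>\<^bsub>M\<^esub> \<oplus>\<^bsub>M\<^esub> ?Z) \<in> K"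
      using K_mult[OF K_conj[OF ZK] K_inv[OF ZK]] k l by simp
    also have "transvection n R k l \<one> \<otimes>\<^bsub>M\<^esub> (\<one>\<^bsub>M\<^esub> \<oplus>\<^bsub>M\<^esub> ?Z) \<otimes>\<^bsub>M\<^esub> transvection n R k l (\<ominus> \<one>) \<otimes>\<^bsub>M\<^esub> inv\<^bsub>M\<^esub> (\<one>\<^bsub>M\<^esub> \<oplus>\<^bsub>M\<^esub> ?Z)
        = \<one>\<^bsub>M\<^esub> \<oplus>\<^bsub>M\<^esub> ?T \<otimes>\<^bsub>M\<^esub> ?Z"
      using M.unipotent_commutator[OF _ Z ZT ZZ] k l
      by (simp add: transvection_minus M.Units_one_add[OF Z ZZ] E_mult_E) (simp add: transvection_eq)
    also have "?T \<otimes>\<^bsub>M\<^esub> ?Z = E k p (?q $$ (l, j) \<otimes> a)"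
      using assms h k l by (subst E_mult_mult_E) simp_all
    finally have "transvection n R k p (?q $$ (l, j) \<otimes> a) \<in> K"
      by (simp add: transvection_eq)
    then show ?thesis
      using K_free k assms h l by simp
  qed
  then have "?q \<otimes>\<^bsub>M\<^esub> E j j a = \<zero>\<^bsub>M\<^esub>"
    using assms h by (intro mat_eqI) auto
  then have "h \<otimes>\<^bsub>M\<^esub> E j j a \<ominus>\<^bsub>M\<^esub> E j j a = \<zero>\<^bsub>M\<^esub>"
    using assms h by (simp add: M.minus_eq M.l_distr M.l_minus)
  then show ?thesis
    using assms h by - (rule M.eq_if_diff_zero, simp_all)
qed

text \<open>Mirror image of the preceding argument: the commutator is now
  \<open>1 + E j m a (h\<^sup>-\<^sup>1 - 1)\<close>, so the result first concerns the inverse and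
  is carried to \<open>h\<close> by a final multiplication. Passing from row \<open>p\<close> to a
  column \<open>j\<close> and back to a row \<open>m\<close> links different rows of
  \<open>h\<close>.\<close>

lemma fixes_row_if_fixes_column:
  assumes "h \<in> K" "j < n" "m < n" "m \<noteq> j" "a \<in> carrier R" "h \<otimes>\<^bsub>M\<^esub> E j j a = E j j a"
  shows "E m m a \<otimes>\<^bsub>M\<^esub> h = E m m a"
proof -
  have h: "h \<in> carrier M" "h \<in> Units M"
    using assms K_closed K_Units by auto
  have hi: "inv\<^bsub>M\<^esub> h \<in> carrier M"
    using h by simp
  let ?E = "E j m a" and ?w = "inv\<^bsub>M\<^esub> h \<ominus>\<^bsub>M\<^esub> \<one>\<^bsub>M\<^esub>"
  have "h \<otimes>\<^bsub>M\<^esub> E j j a \<otimes>\<^bsub>M\<^esub> E j m \<one> = E j j a \<otimes>\<^bsub>M\<^esub> E j m \<one>"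
    using assms by simp
  then have hE: "h \<otimes>\<^bsub>M\<^esub> ?E = ?E"
    using assms(2-5) h by (simp add: E_mult_E M.m_assoc)
  then have "inv\<^bsub>M\<^esub> h \<otimes>\<^bsub>M\<^esub> (h \<otimes>\<^bsub>M\<^esub> ?E) = inv\<^bsub>M\<^esub> h \<otimes>\<^bsub>M\<^esub> ?E"
    by simp
  then have hiE: "inv\<^bsub>M\<^esub> h \<otimes>\<^bsub>M\<^esub> ?E = ?E"
    using assms h by (simp add: M.m_assoc[symmetric])
  have EE: "?E \<otimes>\<^bsub>M\<^esub> ?E = \<zero>\<^bsub>M\<^esub>"
    using assms by (simp add: E_mult_E)
  let ?Z = "?E \<otimes>\<^bsub>M\<^esub> ?w"
  have Z: "?Z \<in> carrier M"
    using assms h by simp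
  have wE: "?w \<otimes>\<^bsub>M\<^esub> ?E = \<zero>\<^bsub>M\<^esub>"
    using assms h by (simp add: M.minus_eq M.l_distr M.l_minus hiE M.r_neg)
  have ZZ: "?Z \<otimes>\<^bsub>M\<^esub> ?Z = \<zero>\<^bsub>M\<^esub>"
    using assms h wE by (simp add: M.m_assoc M.m_assoc[of ?w ?E ?w, symmetric])
  have "h \<otimes>\<^bsub>M\<^esub> transvection n R j m a \<otimes>\<^bsub>M\<^esub> inv\<^bsub>M\<^esub> h \<otimes>\<^bsub>M\<^esub> transvection n R j m (\<ominus> a) = \<one>\<^bsub>M\<^esub> \<oplus>\<^bsub>M\<^esub> ?Z"
    unfolding transvection_minus[OF assms(5)] unfolding transvection_eq using assms(2-5) h hi
    by (simp add: M.ring_simprules EE hiE hE M.add_minus_cancel M.m_assoc[of h ?E, symmetric])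
  then have ZK: "\<one>\<^bsub>M\<^esub> \<oplus>\<^bsub>M\<^esub> ?Z \<in> K"
    using commutator_mem[OF assms(1), of j m a] assms by simp
  have "a \<otimes> ?w $$ (m, k) = \<zero>" if k: "k < n" for k
  proof -
    obtain l where l: "l < n" "l \<noteq> j" "l \<noteq> k"
      using ex_third_index[OF n3] by blast
    let ?T = "E k l \<one>"
    have TZ: "?T \<otimes>\<^bsub>M\<^esub> ?Z = \<zero>\<^bsub>M\<^esub>"
      using assms h k l by (simp add: M.m_assoc[symmetric] E_mult_E)
    have "(\<one>\<^bsub>M\<^esub> \<oplus>\<^bsub>M\<^esub> ?Z) \<otimes>\<^bsub>M\<^esub> transvection n R k l \<one> \<otimes>\<^bsub>M\<^esub> inv\<^bsub>M\<^esub> (\<one>\<^bsub>M\<^esub> \<oplus>\<^bsub>M\<^esub> ?Z) \<otimes>\<^bsub>M\<^esub> transvection n R k l (\<ominus> \<one>) \<in> K"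
      using commutator_mem[OF ZK] k l by simp
    also have "(\<one>\<^bsub>M\<^esub> \<oplus>\<^bsub>M\<^esub> ?Z) \<otimes>\<^bsub>M\<^esub> transvection n R k l \<one> \<otimes>\<^bsub>M\<^esub> inv\<^bsub>M\<^esub> (\<one>\<^bsub>M\<^esub> \<oplus>\<^bsub>M\<^esub> ?Z) \<otimes>\<^bsub>M\<^esub> transvection n R k l (\<ominus> \<one>)
        = \<one>\<^bsub>M\<^esub> \<oplus>\<^bsub>M\<^esub> ?Z \<otimes>\<^bsub>M\<^esub> ?T"
      using M.unipotent_commutator[OF Z _ TZ _ ZZ] k l
      by (simp add: transvection_minus M.Units_one_add[OF Z ZZ] E_mult_E) (simp add: transvection_eq)
    also have "?Z \<otimes>\<^bsub>M\<^esub> ?T = E j l (a \<otimes> ?w $$ (m, k))"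
      using assms h k l by (simp add: M.m_assoc E_mult_mult_E)
    finally have "transvection n R j l (a \<otimes> ?w $$ (m, k)) \<in> K"
      by (simp add: transvection_eq)
    then show ?thesis
      using K_free k assms h l by simp
  qed
  then have "E m m a \<otimes>\<^bsub>M\<^esub> ?w = \<zero>\<^bsub>M\<^esub>"
    using assms h by (intro mat_eqI) auto
  then have "E m m a \<otimes>\<^bsub>M\<^esub> inv\<^bsub>M\<^esub> h \<ominus>\<^bsub>M\<^esub> E m m a = \<zero>\<^bsub>M\<^esub>"
    using assms h by (simp add: M.minus_eq M.r_distr M.r_minus)
  then have "E m m a \<otimes>\<^bsub>M\<^esub> inv\<^bsub>M\<^esub> h = E m m a"
    using assms h by - (rule M.eq_if_diff_zero, simp_all)
  then have "E m m a \<otimes>\<^bsub>M\<^esub> inv\<^bsub>M\<^esub> h \<otimes>\<^bsub>M\<^esub> h = E m m a \<otimes>\<^bsub>M\<^esub> h"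
    by simp
  then show ?thesis
    using assms h by (simp add: M.m_assoc)
qed

text \<open>The two transvections share column \<open>i\<close>, so their product is
  \<open>1 + Y\<close>. The \<open>p\<close>-th row of \<open>\<sigma> Y\<close> has the single
  entry \<open>\<sigma> $$ (p, m) \<ominus> \<sigma> $$ (p, j) \<otimes> c\<close>; the parameter
  \<open>c\<close> is there to make it vanish, possibly only after multiplication by some
  \<open>a\<close> on the left.\<close>

lemma conj_two_transvections:
  assumes "\<sigma> \<in> K" "i < n" "j < n" "m < n" "m \<noteq> i" "j \<noteq> i" "c \<in> carrier R"
    and Y_def: "Y = E m i \<one> \<ominus>\<^bsub>M\<^esub> E j i c"
  shows "Y \<in> carrier M" "Y \<otimes>\<^bsub>M\<^esub> Y = \<zero>\<^bsub>M\<^esub>"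
    "\<sigma> \<otimes>\<^bsub>M\<^esub> (\<one>\<^bsub>M\<^esub> \<oplus>\<^bsub>M\<^esub> Y) \<otimes>\<^bsub>M\<^esub> inv\<^bsub>M\<^esub> \<sigma> \<otimes>\<^bsub>M\<^esub> (\<one>\<^bsub>M\<^esub> \<ominus>\<^bsub>M\<^esub> Y) \<in> K"
proof -
  show Y: "Y \<in> carrier M" and YY: "Y \<otimes>\<^bsub>M\<^esub> Y = \<zero>\<^bsub>M\<^esub>"
    using assms by (simp_all add: M.ring_simprules E_mult_E)
  have \<sigma>: "\<sigma> \<in> carrier M" "inv\<^bsub>M\<^esub> \<sigma> \<in> K" "inv\<^bsub>M\<^esub> \<sigma> \<in> carrier M"
    using assms K_closed K_inv by auto
  have eq: "\<one>\<^bsub>M\<^esub> \<oplus>\<^bsub>M\<^esub> Y = transvection n R m i \<one> \<otimes>\<^bsub>M\<^esub> transvection n R j i (\<ominus> c)"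
    "\<one>\<^bsub>M\<^esub> \<ominus>\<^bsub>M\<^esub> Y = transvection n R j i c \<otimes>\<^bsub>M\<^esub> transvection n R m i (\<ominus> \<one>)"
    unfolding Y_def transvection_eq using assms(2-7)
    by (simp_all add: M.ring_simprules E_mult_E E_minus)
  have "transvection n R j i (\<ominus> c) \<otimes>\<^bsub>M\<^esub> inv\<^bsub>M\<^esub> \<sigma> \<otimes>\<^bsub>M\<^esub> transvection n R j i (\<ominus> (\<ominus> c)) \<in> K"
    using assms \<sigma> by (intro K_conj) auto
  then have "transvection n R m i \<one> \<otimes>\<^bsub>M\<^esub> (transvection n R j i (\<ominus> c) \<otimes>\<^bsub>M\<^esub> inv\<^bsub>M\<^esub> \<sigma> \<otimes>\<^bsub>M\<^esub> transvection n R j i c) \<otimes>\<^bsub>M\<^esub>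
      transvection n R m i (\<ominus> \<one>) \<in> K"
    using assms by (intro K_conj) auto
  from K_mult[OF assms(1) this]
  show "\<sigma> \<otimes>\<^bsub>M\<^esub> (\<one>\<^bsub>M\<^esub> \<oplus>\<^bsub>M\<^esub> Y) \<otimes>\<^bsub>M\<^esub> inv\<^bsub>M\<^esub> \<sigma> \<otimes>\<^bsub>M\<^esub> (\<one>\<^bsub>M\<^esub> \<ominus>\<^bsub>M\<^esub> Y) \<in> K"
    unfolding eq using assms \<sigma> by (simp add: M.m_assoc)
qed

text \<open>The matrix \<open>1 + Y\<close> fixes both \<open>a \<epsilon>\<^sub>p\<close> and \<open>a \<epsilon>\<^sub>p \<sigma>\<close>, so its commutator with \<open>\<sigma>\<close> fixes \<open>a \<epsilon>\<^sub>p\<close>.\<close>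

lemma row_annihilator:
  assumes "\<sigma> \<in> K" "p < n" "j < n" "m < n" "l < n" "m \<noteq> p" "j \<noteq> p" "m \<noteq> j" "l \<noteq> p" "a \<in> carrier R" "c \<in> carrier R"
    and eq: "a \<otimes> \<sigma> $$ (p, m) = a \<otimes> \<sigma> $$ (p, j) \<otimes> c"
  shows "a \<otimes> \<sigma> $$ (p, l) = \<zero>"
proof -
  define Y where "Y = E m p \<one> \<ominus>\<^bsub>M\<^esub> E j p c"
  note Y = conj_two_transvections[OF assms(1,2,3,4,6,7,11) Y_def]
  have \<sigma>: "\<sigma> \<in> carrier M" "\<sigma> \<in> Units M" "inv\<^bsub>M\<^esub> \<sigma> \<in> carrier M"
    using assms K_closed K_inv K_Units by auto
  let ?\<tau> = "inv\<^bsub>M\<^esub> \<sigma>"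
  let ?h = "\<sigma> \<otimes>\<^bsub>M\<^esub> (\<one>\<^bsub>M\<^esub> \<oplus>\<^bsub>M\<^esub> Y) \<otimes>\<^bsub>M\<^esub> ?\<tau> \<otimes>\<^bsub>M\<^esub> (\<one>\<^bsub>M\<^esub> \<ominus>\<^bsub>M\<^esub> Y)"
  have EY: "E p p a \<otimes>\<^bsub>M\<^esub> Y = \<zero>\<^bsub>M\<^esub>"
    using assms by (simp add: Y_def M.ring_simprules E_mult_E)
  have E\<sigma>Y: "E p p a \<otimes>\<^bsub>M\<^esub> (\<sigma> \<otimes>\<^bsub>M\<^esub> Y) = \<zero>\<^bsub>M\<^esub>"
    using assms \<sigma> by (simp add: Y_def M.minus_eq M.r_distr M.r_minus E_mult_mult_E m_assoc M.r_neg)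
  have "E p p a \<otimes>\<^bsub>M\<^esub> ?h = (E p p a \<otimes>\<^bsub>M\<^esub> \<sigma> \<oplus>\<^bsub>M\<^esub> E p p a \<otimes>\<^bsub>M\<^esub> (\<sigma> \<otimes>\<^bsub>M\<^esub> Y)) \<otimes>\<^bsub>M\<^esub> ?\<tau> \<otimes>\<^bsub>M\<^esub> (\<one>\<^bsub>M\<^esub> \<ominus>\<^bsub>M\<^esub> Y)"
    using assms \<sigma> Y(1) by (simp add: M.m_assoc M.r_distr M.l_distr)
  also have "\<dots> = E p p a"
    unfolding E\<sigma>Y using assms \<sigma> Y(1) by (simp add: M.m_assoc M.minus_eq M.r_distr M.r_minus EY)
  finally have "E p p a \<otimes>\<^bsub>M\<^esub> ?h = E p p a" .
  then have "?h \<otimes>\<^bsub>M\<^esub> E j j a = E j j a"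
    using fixes_column_if_fixes_row[OF Y(3)] assms by blast
  then have "E m m a \<otimes>\<^bsub>M\<^esub> ?h = E m m a"
    using fixes_row_if_fixes_column[OF Y(3)] assms by blast
  \<comment> \<open>Multiplication by \<open>(1 + Y) \<sigma>\<close> clears both inverses, so that
    the fixed row becomes a comparison of \<open>\<sigma> Y\<close> with
    \<open>Y \<sigma>\<close>.\<close>
  then have "E m m a \<otimes>\<^bsub>M\<^esub> ?h \<otimes>\<^bsub>M\<^esub> ((\<one>\<^bsub>M\<^esub> \<oplus>\<^bsub>M\<^esub> Y) \<otimes>\<^bsub>M\<^esub> \<sigma>) = E m m a \<otimes>\<^bsub>M\<^esub> ((\<one>\<^bsub>M\<^esub> \<oplus>\<^bsub>M\<^esub> Y) \<otimes>\<^bsub>M\<^esub> \<sigma>)"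
    by simp
  moreover have "E m m a \<otimes>\<^bsub>M\<^esub> ?h \<otimes>\<^bsub>M\<^esub> ((\<one>\<^bsub>M\<^esub> \<oplus>\<^bsub>M\<^esub> Y) \<otimes>\<^bsub>M\<^esub> \<sigma>) =
      E m m a \<otimes>\<^bsub>M\<^esub> \<sigma> \<otimes>\<^bsub>M\<^esub> (\<one>\<^bsub>M\<^esub> \<oplus>\<^bsub>M\<^esub> Y) \<otimes>\<^bsub>M\<^esub> ?\<tau> \<otimes>\<^bsub>M\<^esub> ((\<one>\<^bsub>M\<^esub> \<ominus>\<^bsub>M\<^esub> Y) \<otimes>\<^bsub>M\<^esub> (\<one>\<^bsub>M\<^esub> \<oplus>\<^bsub>M\<^esub> Y)) \<otimes>\<^bsub>M\<^esub> \<sigma>"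
    using assms \<sigma> Y(1) by (simp add: M.m_assoc)
  then have "E m m a \<otimes>\<^bsub>M\<^esub> ?h \<otimes>\<^bsub>M\<^esub> ((\<one>\<^bsub>M\<^esub> \<oplus>\<^bsub>M\<^esub> Y) \<otimes>\<^bsub>M\<^esub> \<sigma>) = E m m a \<otimes>\<^bsub>M\<^esub> \<sigma> \<otimes>\<^bsub>M\<^esub> (\<one>\<^bsub>M\<^esub> \<oplus>\<^bsub>M\<^esub> Y)"
    using assms \<sigma> Y(1) by (simp add: M.one_add_square_zero_inv[OF Y(1,2)] M.m_assoc)
  ultimately have "E m m a \<otimes>\<^bsub>M\<^esub> \<sigma> \<otimes>\<^bsub>M\<^esub> (\<one>\<^bsub>M\<^esub> \<oplus>\<^bsub>M\<^esub> Y) = E m m a \<otimes>\<^bsub>M\<^esub> ((\<one>\<^bsub>M\<^esub> \<oplus>\<^bsub>M\<^esub> Y) \<otimes>\<^bsub>M\<^esub> \<sigma>)"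
    by simp
  then have "E m m a \<otimes>\<^bsub>M\<^esub> \<sigma> \<oplus>\<^bsub>M\<^esub> E m m a \<otimes>\<^bsub>M\<^esub> \<sigma> \<otimes>\<^bsub>M\<^esub> Y = E m m a \<otimes>\<^bsub>M\<^esub> \<sigma> \<oplus>\<^bsub>M\<^esub> E m m a \<otimes>\<^bsub>M\<^esub> Y \<otimes>\<^bsub>M\<^esub> \<sigma>"
    using assms \<sigma> Y(1) by (simp add: M.r_distr M.l_distr M.m_assoc)
  then have "E m m a \<otimes>\<^bsub>M\<^esub> \<sigma> \<otimes>\<^bsub>M\<^esub> Y = E m m a \<otimes>\<^bsub>M\<^esub> Y \<otimes>\<^bsub>M\<^esub> \<sigma>"
    using assms \<sigma> Y(1) by - (rule M.add_left_imp_eq[of "E m m a \<otimes>\<^bsub>M\<^esub> \<sigma>"], simp_all)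
  \<comment> \<open>As \<open>m \<noteq> j\<close>, row \<open>m\<close> of \<open>Y\<close> is the
    \<open>p\<close>-th unit row, and the right side becomes \<open>a\<close> times row
    \<open>p\<close> of \<open>\<sigma>\<close>. The left side lives in column \<open>p\<close>,
    like \<open>Y\<close>, so all other entries vanish.\<close>
  also have "E m m a \<otimes>\<^bsub>M\<^esub> Y = E m p a"
    using assms by (simp add: Y_def M.minus_eq M.r_distr M.r_minus E_mult_E)
  finally have "(E m m a \<otimes>\<^bsub>M\<^esub> \<sigma> \<otimes>\<^bsub>M\<^esub> Y) $$ (m, l) = (E m p a \<otimes>\<^bsub>M\<^esub> \<sigma>) $$ (m, l)"
    by simp
  moreover have "(E m m a \<otimes>\<^bsub>M\<^esub> \<sigma> \<otimes>\<^bsub>M\<^esub> Y) $$ (m, l) = \<zero>"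
    using assms \<sigma> by (simp add: Y_def M.minus_eq M.r_distr M.r_minus minus_eq)
  ultimately show ?thesis
    using assms \<sigma> by simp
qed

text \<open>For \<open>e = \<sigma> $$ (p, j) \<otimes> r\<close>, idempotency gives the hypothesis
  of \<open>row_annihilator\<close> with \<open>a = e\<close> and
  \<open>c = r \<otimes> \<sigma> $$ (p, m)\<close>. Its conclusion at \<open>l = j\<close> kills
  \<open>e \<otimes> \<sigma> $$ (p, j)\<close>, and therefore
  \<open>e = e \<otimes> e\<close>.\<close>

lemma off_diagonal_idempotent:
  assumes "\<sigma> \<in> K" "p < n" "j < n" "j \<noteq> p" "r \<in> carrier R"
    and "(\<sigma> $$ (p, j) \<otimes> r) \<otimes> (\<sigma> $$ (p, j) \<otimes> r) = \<sigma> $$ (p, j) \<otimes> r"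
  shows "\<sigma> $$ (p, j) \<otimes> r = \<zero>"
proof -
  obtain m where m: "m < n" "m \<noteq> p" "m \<noteq> j"
    using ex_third_index[OF n3] by blast
  let ?e = "\<sigma> $$ (p, j) \<otimes> r"
  have \<sigma>: "\<sigma> \<in> carrier M"
    using assms K_closed by auto
  have "?e \<otimes> \<sigma> $$ (p, m) = ?e \<otimes> ?e \<otimes> \<sigma> $$ (p, m)"
    using assms(6) by simp
  also have "\<dots> = ?e \<otimes> \<sigma> $$ (p, j) \<otimes> (r \<otimes> \<sigma> $$ (p, m))"
    using \<sigma> m assms(2-5) by (simp add: m_assoc)
  finally have "?e \<otimes> \<sigma> $$ (p, j) = \<zero>"
    using \<sigma> m assms(1-5) by (intro row_annihilator[of \<sigma> p j m]) auto
  then have "?e \<otimes> \<sigma> $$ (p, j) \<otimes> r = \<zero>"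
    using assms by simp
  then show ?thesis
    using assms \<sigma> by (simp add: m_assoc)
qed

text \<open>Row \<open>p\<close> of \<open>\<sigma>\<close> times column \<open>p\<close> of its
  inverse is \<open>\<one>\<close>, and the off-diagonal summands are removed one by one. The
  exchange idempotent of such a summand \<open>x\<close> is a right multiple of an off-diagonal
  entry, hence zero; so \<open>\<one> \<ominus> x\<close>, the sum of the remaining terms, is right
  invertible.\<close>

lemma diagonal_right_invertible:
  assumes "\<sigma> \<in> K" "p < n"
  shows "\<exists>r\<in>carrier R. \<sigma> $$ (p, p) \<otimes> r = \<one>"
proof -
  have \<sigma>: "\<sigma> \<in> carrier M" "\<sigma> \<in> Units M" "inv\<^bsub>M\<^esub> \<sigma> \<in> carrier M"
    using assms K_closed K_inv K_Units by auto
  \<comment> \<open>The coefficients \<open>u\<close> and \<open>w\<close> are arbitrary because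
    every removal multiplies them on the right by the new right inverse \<open>s\<close>.\<close>
  have *: "\<exists>r\<in>carrier R. \<sigma> $$ (p, p) \<otimes> r = \<one>"
    if "finite F" "F \<subseteq> {..<n} - {p}" "u \<in> carrier R" "w \<in> F \<rightarrow> carrier R"
      "\<sigma> $$ (p, p) \<otimes> u \<oplus> (\<Oplus>k\<in>F. \<sigma> $$ (p, k) \<otimes> w k) = \<one>" for F u w
    using that
  proof (induction F arbitrary: u w rule: finite_induct)
    case empty
    then show ?case
      using \<sigma> assms by auto
  next
    case (insert j F)
    let ?x = "\<sigma> $$ (p, j) \<otimes> w j" and ?S = "\<Oplus>k\<in>F. \<sigma> $$ (p, k) \<otimes> w k"
    have j: "j < n" "j \<noteq> p" "w j \<in> carrier R" and F: "\<And>k. k \<in> F \<Longrightarrow> k < n \<and> w k \<in> carrier R"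
      using insert.prems by auto
    have S: "?S \<in> carrier R" and x: "?x \<in> carrier R"
      using F j \<sigma> assms by (auto intro!: finsum_closed)
    obtain r s where rs: "r \<in> carrier R" "s \<in> carrier R" "(?x \<otimes> r) \<otimes> (?x \<otimes> r) = ?x \<otimes> r"
      "\<one> \<ominus> ?x \<otimes> r = (\<one> \<ominus> ?x) \<otimes> s"
      by (rule right_exchangeE[OF exch x])
    have "?x \<otimes> r = \<zero>"
      using off_diagonal_idempotent[of \<sigma> p j "w j \<otimes> r"] rs(1,3) assms j \<sigma> by (simp add: m_assoc)
    then have 1: "(\<one> \<ominus> ?x) \<otimes> s = \<one>"
      using rs(4) by (simp add: minus_eq)
    have "(\<Oplus>k\<in>insert j F. \<sigma> $$ (p, k) \<otimes> w k) = ?x \<oplus> ?S"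
      using insert.hyps F j \<sigma> assms by (subst finsum_insert) auto
    then have "?x \<oplus> (\<sigma> $$ (p, p) \<otimes> u \<oplus> ?S) = \<one>"
      using insert.prems S x \<sigma> assms by (simp add: a_lcomm)
    then have "\<one> \<ominus> ?x = \<sigma> $$ (p, p) \<otimes> u \<oplus> ?S"
      using add_diff_cancel[of ?x "\<sigma> $$ (p, p) \<otimes> u \<oplus> ?S"] insert.prems S x \<sigma> assms by simp
    then have "(\<sigma> $$ (p, p) \<otimes> u \<oplus> ?S) \<otimes> s = \<one>"
      using 1 by simp
    then have "\<sigma> $$ (p, p) \<otimes> (u \<otimes> s) \<oplus> ?S \<otimes> s = \<one>"
      using insert.prems S rs \<sigma> assms by (simp add: l_distr m_assoc)
    also have "?S \<otimes> s = (\<Oplus>k\<in>F. \<sigma> $$ (p, k) \<otimes> w k \<otimes> s)"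
      using insert.hyps rs F \<sigma> assms by (subst finsum_ldistr) auto
    also have "\<dots> = (\<Oplus>k\<in>F. \<sigma> $$ (p, k) \<otimes> (w k \<otimes> s))"
      using rs F \<sigma> assms by (intro finsum_cong') (auto simp: m_assoc)
    finally show ?case
      using insert.prems rs by (intro insert.IH[of "u \<otimes> s" "\<lambda>k. w k \<otimes> s"]) auto
  qed
  have "(\<sigma> \<otimes>\<^bsub>M\<^esub> inv\<^bsub>M\<^esub> \<sigma>) $$ (p, p) = \<one>"
    using \<sigma> assms by simp
  also have "(\<sigma> \<otimes>\<^bsub>M\<^esub> inv\<^bsub>M\<^esub> \<sigma>) $$ (p, p) = (\<Oplus>k\<in>insert p ({..<n} - {p}). \<sigma> $$ (p, k) \<otimes> (inv\<^bsub>M\<^esub> \<sigma>) $$ (k, p))"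
    using assms by (simp add: entry_mult insert_absorb)
  also have "\<dots> = \<sigma> $$ (p, p) \<otimes> (inv\<^bsub>M\<^esub> \<sigma>) $$ (p, p) \<oplus> (\<Oplus>k\<in>{..<n} - {p}. \<sigma> $$ (p, k) \<otimes> (inv\<^bsub>M\<^esub> \<sigma>) $$ (k, p))"
    using \<sigma> assms by (intro finsum_insert) auto
  finally show ?thesis
    using \<sigma> assms by (intro *[of "{..<n} - {p}" "(inv\<^bsub>M\<^esub> \<sigma>) $$ (p, p)" "\<lambda>k. (inv\<^bsub>M\<^esub> \<sigma>) $$ (k, p)"]) auto
qed

text \<open>The right inverse of the diagonal entry solves
  \<open>\<sigma> $$ (p, p) \<otimes> c = \<sigma> $$ (p, m)\<close>, so row \<open>p\<close> of
  \<open>\<sigma>\<close> annihilates \<open>Y\<close>. Row \<open>p\<close> of \<open>Y\<close>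
  itself is not zero but has the entry \<open>\<ominus> c\<close> in column \<open>i\<close>; the
  commutator \<open>h\<close> thus displays \<open>c\<close> in its row \<open>p\<close>, next to a
  zero in column \<open>m\<close>.\<close>

lemma off_diagonal_zero:
  assumes "\<sigma> \<in> K" "p < n" "m < n" "m \<noteq> p"
  shows "\<sigma> $$ (p, m) = \<zero>"
proof -
  obtain i where i: "i < n" "i \<noteq> p" "i \<noteq> m"
    using ex_third_index[OF n3] by blast
  obtain r where r: "r \<in> carrier R" "\<sigma> $$ (p, p) \<otimes> r = \<one>"
    using diagonal_right_invertible assms by blast
  have \<sigma>: "\<sigma> \<in> carrier M" "\<sigma> \<in> Units M" "inv\<^bsub>M\<^esub> \<sigma> \<in> carrier M"
    using assms K_closed K_inv K_Units by auto
  define c where "c = r \<otimes> \<sigma> $$ (p, m)"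
  have c: "c \<in> carrier R" "\<sigma> $$ (p, p) \<otimes> c = \<sigma> $$ (p, m)"
    using r \<sigma> assms by (simp_all add: c_def m_assoc[symmetric])
  define Y where "Y = E m i \<one> \<ominus>\<^bsub>M\<^esub> E p i c"
  have "m \<noteq> i" "p \<noteq> i"
    using i by auto
  note Y = conj_two_transvections[OF assms(1) i(1) assms(2,3) this c(1) Y_def]
  let ?\<tau> = "inv\<^bsub>M\<^esub> \<sigma>"
  define h where "h = \<sigma> \<otimes>\<^bsub>M\<^esub> (\<one>\<^bsub>M\<^esub> \<oplus>\<^bsub>M\<^esub> Y) \<otimes>\<^bsub>M\<^esub> ?\<tau> \<otimes>\<^bsub>M\<^esub> (\<one>\<^bsub>M\<^esub> \<ominus>\<^bsub>M\<^esub> Y)"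
  have hK: "h \<in> K"
    unfolding h_def by (rule Y(3))
  then have h: "h \<in> carrier M"
    by (rule K_closed)
  have EY: "E p p \<one> \<otimes>\<^bsub>M\<^esub> Y = \<ominus>\<^bsub>M\<^esub> E p i c"
    using assms i c by (simp add: Y_def M.minus_eq M.r_distr M.r_minus E_mult_E)
  have E\<sigma>Y: "E p p \<one> \<otimes>\<^bsub>M\<^esub> (\<sigma> \<otimes>\<^bsub>M\<^esub> Y) = \<zero>\<^bsub>M\<^esub>"
    using assms i \<sigma> c by (simp add: Y_def M.minus_eq M.r_distr M.r_minus E_mult_mult_E M.r_neg)
  have "E p p \<one> \<otimes>\<^bsub>M\<^esub> h = (E p p \<one> \<otimes>\<^bsub>M\<^esub> \<sigma> \<oplus>\<^bsub>M\<^esub> E p p \<one> \<otimes>\<^bsub>M\<^esub> (\<sigma> \<otimes>\<^bsub>M\<^esub> Y)) \<otimes>\<^bsub>M\<^esub> ?\<tau> \<otimes>\<^bsub>M\<^esub> (\<one>\<^bsub>M\<^esub> \<ominus>\<^bsub>M\<^esub> Y)"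
    unfolding h_def using assms \<sigma> Y(1) by (simp add: M.m_assoc M.r_distr M.l_distr)
  also have "\<dots> = E p p \<one> \<oplus>\<^bsub>M\<^esub> E p i c"
    unfolding E\<sigma>Y using assms \<sigma> Y(1) c by (simp add: M.m_assoc M.minus_eq M.r_distr M.r_minus EY)
  finally have Eh: "E p p \<one> \<otimes>\<^bsub>M\<^esub> h = E p p \<one> \<oplus>\<^bsub>M\<^esub> E p i c" .
  have hp: "h $$ (p, l) = (if l = p then \<one> else \<zero>) \<oplus> (if l = i then c else \<zero>)" if "l < n" for l
    using arg_cong[OF Eh, of "\<lambda>A. A $$ (p, l)"] that assms(2,3) i(1) h c(1) by simp
  \<comment> \<open>The annihilator lemma is applied to \<open>h\<close> instead of
    \<open>\<sigma>\<close>: because \<open>h $$ (p, m)\<close> is zero, the multipliers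
    \<open>\<one>\<close> and \<open>\<zero>\<close> satisfy its hypothesis.\<close>
  have "\<one> \<otimes> h $$ (p, i) = \<zero>"
  proof (rule row_annihilator[OF hK, where m = m and c = \<zero>])
    show "\<one> \<otimes> h $$ (p, m) = \<one> \<otimes> h $$ (p, i) \<otimes> \<zero>"
      using assms(2-4) i c(1) h by (simp add: hp)
  qed (use assms(2-4) i in simp_all)
  then have "c = \<zero>"
    using i c(1) h by (simp add: hp)
  then show ?thesis
    using c \<sigma> assms by simp
qed

text \<open>Conjugates of \<open>\<sigma>\<close> by transvections are again in \<open>K\<close> and
  hence diagonal. Their \<open>(i, j)\<close> entry compares
  \<open>x \<otimes> \<sigma> $$ (j, j)\<close> with \<open>\<sigma> $$ (i, i) \<otimes> x\<close>,
  which makes \<open>\<sigma>\<close> a scalar matrix with central entry.\<close>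

theorem subset_center: "K \<subseteq> group_center (GL n R)"
proof
  fix \<sigma> assume K: "\<sigma> \<in> K"
  have \<sigma>: "\<sigma> \<in> carrier M" "\<sigma> \<in> Units M"
    using K K_closed K_Units by auto
  have comm: "\<sigma> $$ (i, i) \<otimes> x = x \<otimes> \<sigma> $$ (j, j)" if "i < n" "j < n" "i \<noteq> j" "x \<in> carrier R" for i j x
  proof -
    let ?g = "transvection n R i j x \<otimes>\<^bsub>M\<^esub> \<sigma> \<otimes>\<^bsub>M\<^esub> transvection n R i j (\<ominus> x)"
    have "?g $$ (i, j) = \<zero>"
      using K_conj[OF K that] that by (intro off_diagonal_zero) auto
    moreover have "?g = \<sigma> \<oplus>\<^bsub>M\<^esub> E i j x \<otimes>\<^bsub>M\<^esub> \<sigma> \<ominus>\<^bsub>M\<^esub> \<sigma> \<otimes>\<^bsub>M\<^esub> E i j x \<ominus>\<^bsub>M\<^esub> E i j x \<otimes>\<^bsub>M\<^esub> (\<sigma> \<otimes>\<^bsub>M\<^esub> E i j x)"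
      unfolding transvection_minus[OF that(4)] unfolding transvection_eq using \<sigma> that
      by (simp add: M.ring_simprules)
    ultimately have "x \<otimes> \<sigma> $$ (j, j) \<ominus> \<sigma> $$ (i, i) \<otimes> x = \<zero>"
      using \<sigma> that off_diagonal_zero[OF K, of i j] off_diagonal_zero[OF K, of j i]
      by (simp add: minus_eq)
    then show ?thesis
      using \<sigma> that by - (rule eq_if_diff_zero[symmetric], simp_all)
  qed
  have diag: "\<sigma> $$ (i, i) \<otimes> x = x \<otimes> \<sigma> $$ (j, j)" if ij: "i < n" "j < n" "x \<in> carrier R" for i j x
  proof (cases "i = j")
    case True
    \<comment> \<open>The conjugation argument needs two distinct indices, so centrality of a single
      diagonal entry goes through another one that is equal to it.\<close>
    obtain k where k: "k < n" "k \<noteq> i"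
      using ex_third_index[OF n3] by blast
    have "\<sigma> $$ (k, k) = \<sigma> $$ (i, i)"
      using comm[of k i \<one>] k ij \<sigma> by simp
    then show ?thesis
      using comm[of i k x] k ij True by simp
  next
    case False
    then show ?thesis
      using comm ij by blast
  qed
  have "\<sigma> \<otimes>\<^bsub>M\<^esub> g = g \<otimes>\<^bsub>M\<^esub> \<sigma>" if g: "g \<in> carrier M" for g
  proof (rule mat_eqI)
    fix i j assume ij: "i < n" "j < n"
    have "(\<sigma> \<otimes>\<^bsub>M\<^esub> g) $$ (i, j) = (\<Oplus>k\<in>{..<n}. if k = i then \<sigma> $$ (i, i) \<otimes> g $$ (k, j) else \<zero>)"
      unfolding entry_mult[OF ij] using off_diagonal_zero[OF K, of i] \<sigma> g ij by (intro finsum_cong') auto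
    also have "\<dots> = \<sigma> $$ (i, i) \<otimes> g $$ (i, j)"
      using \<sigma> g ij by (subst finsum_delta) auto
    also have "\<dots> = g $$ (i, j) \<otimes> \<sigma> $$ (j, j)"
      using diag[of i j "g $$ (i, j)"] ij g by simp
    also have "\<dots> = (\<Oplus>k\<in>{..<n}. if k = j then g $$ (i, k) \<otimes> \<sigma> $$ (j, j) else \<zero>)"
      using \<sigma> g ij by (subst finsum_delta) auto
    also have "\<dots> = (g \<otimes>\<^bsub>M\<^esub> \<sigma>) $$ (i, j)"
      unfolding entry_mult[OF ij] using off_diagonal_zero[OF K, of _ j] \<sigma> g ij by (intro finsum_cong') auto
    finally show "(\<sigma> \<otimes>\<^bsub>M\<^esub> g) $$ (i, j) = (g \<otimes>\<^bsub>M\<^esub> \<sigma>) $$ (i, j)" .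
  qed (use \<sigma> g in auto)
  then show "\<sigma> \<in> group_center (GL n R)"
    using \<sigma> by (simp add: group_center_def GL_def units_of_carrier units_of_mult M.Units_closed)
qed

end

section \<open>Commutators with the full congruence subgroup\<close>

text \<open>The idempotents in \<open>v\<^sub>k R\<close> need not be orthogonal here: a left ideal containing all of
  them absorbs the exchange decomposition of \<open>c\<close> one summand at a time.\<close>

lemma (in ring) exchange_left_ideal:
  assumes exch: "right_exchange R"
    and T: "T \<subseteq> carrier R" "\<zero> \<in> T" "\<And>x y. x \<in> T \<Longrightarrow> y \<in> T \<Longrightarrow> x \<oplus> y \<in> T"
      "\<And>r x. r \<in> carrier R \<Longrightarrow> x \<in> T \<Longrightarrow> r \<otimes> x \<in> T"
    and "finite S" "v \<in> S \<rightarrow> carrier R"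
    and idem: "\<And>k r. k \<in> S \<Longrightarrow> r \<in> carrier R \<Longrightarrow> (v k \<otimes> r) \<otimes> (v k \<otimes> r) = v k \<otimes> r \<Longrightarrow> v k \<otimes> r \<in> T"
    and "c \<in> carrier R" "c \<otimes> c = c" "w \<in> S \<rightarrow> carrier R" "c = (\<Oplus>k\<in>S. c \<otimes> v k \<otimes> w k)"
  shows "c \<in> T"
  using assms(6-)
proof (induction S arbitrary: c w rule: finite_induct)
  case empty
  then show ?case
    using T by simp
next
  case (insert j F)
  have j: "v j \<in> carrier R" "w j \<in> carrier R" and F: "\<And>k. k \<in> F \<Longrightarrow> v k \<in> carrier R \<and> w k \<in> carrier R"
    and c: "c \<in> carrier R" "c \<otimes> c = c"
    using insert.prems by auto
  have cl: "c \<otimes> (c \<otimes> u) = c \<otimes> u" if "u \<in> carrier R" for u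
    using that c by (simp add: m_assoc[symmetric])
  \<comment> \<open>The \<open>j\<close>-th summand is compressed to the corner ring
    \<open>c R c\<close>, whose unit is \<open>c\<close>. The exchange idempotent
    \<open>p \<otimes> r\<close> is then brought into the corner as
    \<open>e = p \<otimes> r \<otimes> c\<close>.\<close>
  define p where "p = c \<otimes> v j \<otimes> w j \<otimes> c"
  have p: "p \<in> carrier R" "c \<otimes> p = p"
    using j c by (simp_all add: p_def m_assoc cl)
  have cp: "c \<otimes> (p \<otimes> u) = p \<otimes> u" if "u \<in> carrier R" for u
    using that c p by (simp add: m_assoc[symmetric])
  obtain r s where rs: "r \<in> carrier R" "s \<in> carrier R" "(p \<otimes> r) \<otimes> (p \<otimes> r) = p \<otimes> r" "\<one> \<ominus> p \<otimes> r = (\<one> \<ominus> p) \<otimes> s"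
    by (rule right_exchangeE[OF exch p(1)])
  define e where "e = p \<otimes> r \<otimes> c"
  have e: "e \<in> carrier R" "c \<otimes> e = e" "e \<otimes> c = e"
    using rs c p by (simp_all add: e_def m_assoc cp)
  have "e \<otimes> e = (p \<otimes> r) \<otimes> (p \<otimes> r) \<otimes> c"
    using rs(1) c p by (simp add: e_def m_assoc cp)
  then have ee: "e \<otimes> e = e"
    by (simp add: rs(3) e_def)
  have el: "e \<otimes> (e \<otimes> u) = e \<otimes> u" "c \<otimes> (e \<otimes> u) = e \<otimes> u" if "u \<in> carrier R" for u
    using that c e ee by (simp_all add: m_assoc[symmetric])
  \<comment> \<open>The choice gives \<open>c \<otimes> v j \<otimes> z = e\<close> and
    \<open>z \<otimes> c = z \<otimes> e = z\<close>. Thus \<open>v j \<otimes> z\<close> is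
    idempotent and lies in \<open>T\<close> by \<open>idem\<close>, and left multiplication by
    \<open>c\<close> turns it into \<open>e\<close>.\<close>
  define z where "z = w j \<otimes> c \<otimes> r \<otimes> c \<otimes> e"
  have z: "z \<in> carrier R" "z \<otimes> c = z" "z \<otimes> e = z"
    using j rs c e ee by (simp_all add: z_def m_assoc)
  have cvz: "c \<otimes> v j \<otimes> z = e"
  proof -
    have "c \<otimes> v j \<otimes> z = p \<otimes> r \<otimes> c \<otimes> e"
      using j rs(1,2) c e by (simp add: z_def p_def m_assoc)
    then show ?thesis
      using ee by (simp add: e_def)
  qed
  have "(v j \<otimes> z) \<otimes> (v j \<otimes> z) = v j \<otimes> (z \<otimes> c) \<otimes> (v j \<otimes> z)"
    by (simp add: z(2))
  also have "\<dots> = v j \<otimes> z \<otimes> (c \<otimes> v j \<otimes> z)"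
    using j z(1) c(1) by (simp add: m_assoc)
  also have "\<dots> = v j \<otimes> z"
    using j z e by (simp add: cvz m_assoc)
  finally have "v j \<otimes> z \<in> T"
    using insert.prems(2) z by simp
  then have "c \<otimes> (v j \<otimes> z) \<in> T"
    using T(4) c by simp
  then have eT: "e \<in> T"
    using j z c cvz by (simp add: m_assoc)
  \<comment> \<open>The complementary idempotent is \<open>c (\<one> - p r) c = (c - p) s c\<close>,
    and \<open>c - p\<close> equals the sum over \<open>F\<close> times \<open>c\<close>. So it is
    covered by the induction hypothesis, with \<open>w k\<close> replaced by
    \<open>w k \<otimes> (c \<otimes> s \<otimes> c)\<close>.\<close>
  let ?c' = "c \<ominus> e"
  have c': "?c' \<in> carrier R" "?c' \<otimes> ?c' = ?c'" "?c' \<otimes> c = ?c'" "c \<otimes> ?c' = ?c'"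
    using c e ee by (simp_all add: ring_simprules)
  have sum: "c = c \<otimes> v j \<otimes> w j \<oplus> (\<Oplus>k\<in>F. c \<otimes> v k \<otimes> w k)"
  proof -
    have "c = (\<Oplus>k\<in>insert j F. c \<otimes> v k \<otimes> w k)"
      using insert.prems by simp
    also have "\<dots> = c \<otimes> v j \<otimes> w j \<oplus> (\<Oplus>k\<in>F. c \<otimes> v k \<otimes> w k)"
      using insert.hyps c j F by (intro finsum_insert) auto
    finally show ?thesis .
  qed
  let ?S = "\<Oplus>k\<in>F. c \<otimes> v k \<otimes> w k"
  have S: "?S \<in> carrier R"
    using c F by (auto intro!: finsum_closed)
  have "c \<ominus> p = ?S \<otimes> c"
  proof -
    have "c = (c \<otimes> v j \<otimes> w j \<oplus> ?S) \<otimes> c"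
      using sum c by simp
    also have "\<dots> = p \<oplus> ?S \<otimes> c"
      unfolding p_def using c j S by (simp add: l_distr)
    finally have "c = p \<oplus> ?S \<otimes> c" .
    then show ?thesis
      using add_diff_cancel[of p "?S \<otimes> c"] p S c by simp
  qed
  moreover have "?c' = c \<otimes> (\<one> \<ominus> p \<otimes> r) \<otimes> c"
    using c p rs(1) by (simp add: e_def ring_simprules cp)
  moreover have "c \<otimes> ((\<one> \<ominus> p) \<otimes> s) \<otimes> c = (c \<ominus> p) \<otimes> s \<otimes> c"
    using c p rs(1,2) by (simp add: ring_simprules cp)
  ultimately have "?c' = ?S \<otimes> c \<otimes> s \<otimes> c"
    using rs(4) by simp
  then have "?c' = ?c' \<otimes> (?S \<otimes> c \<otimes> s \<otimes> c)"
    using c'(2) by simp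
  also have "\<dots> = (?c' \<otimes> ?S) \<otimes> (c \<otimes> s \<otimes> c)"
    using c' c S rs by (simp add: m_assoc)
  also have "?c' \<otimes> ?S = (\<Oplus>k\<in>F. ?c' \<otimes> (c \<otimes> v k \<otimes> w k))"
    using insert.hyps c' c F by (intro finsum_rdistr) auto
  also have "\<dots> \<otimes> (c \<otimes> s \<otimes> c) = (\<Oplus>k\<in>F. ?c' \<otimes> (c \<otimes> v k \<otimes> w k) \<otimes> (c \<otimes> s \<otimes> c))"
    using insert.hyps c' c rs F by (intro finsum_ldistr) auto
  also have "\<dots> = (\<Oplus>k\<in>F. ?c' \<otimes> v k \<otimes> (w k \<otimes> (c \<otimes> s \<otimes> c)))"
  proof (intro finsum_cong' refl)
    fix k assume k: "k \<in> F"
    have "?c' \<otimes> (c \<otimes> v k \<otimes> w k) \<otimes> (c \<otimes> s \<otimes> c) = (?c' \<otimes> c) \<otimes> v k \<otimes> (w k \<otimes> (c \<otimes> s \<otimes> c))"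
      using k F c'(1) c(1) rs(2) by (simp add: m_assoc)
    then show "?c' \<otimes> (c \<otimes> v k \<otimes> w k) \<otimes> (c \<otimes> s \<otimes> c) = ?c' \<otimes> v k \<otimes> (w k \<otimes> (c \<otimes> s \<otimes> c))"
      by (simp only: c'(3))
  qed (use F c' c rs in auto)
  finally have "?c' \<in> T"
    using insert.prems c' c rs F by (intro insert.IH[of ?c' "\<lambda>k. w k \<otimes> (c \<otimes> s \<otimes> c)"]) auto
  then have "?c' \<oplus> e \<in> T"
    using T(3) eT by blast
  then show ?case
    using c e by (simp add: minus_eq a_assoc l_neg)
qed

section \<open>Matrices that differ from the identity in one column or one row\<close>

context matrix_ring_over
begin

text \<open>Such a matrix is a product of transvections into column \<open>m\<close>. In the
  induction, \<open>F\<close> contains the rows whose entry in that column has not yet been cleared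
  by the diagonal entry \<open>\<one>\<close>.\<close>

lemma column_matrix_mem:
  assumes mult: "\<And>g h. g \<in> N \<Longrightarrow> h \<in> N \<Longrightarrow> g \<otimes>\<^bsub>M\<^esub> h \<in> N" and one: "\<one>\<^bsub>M\<^esub> \<in> N"
    and trans: "\<And>i j x. i < n \<Longrightarrow> j < n \<Longrightarrow> i \<noteq> j \<Longrightarrow> x \<in> I \<Longrightarrow> transvection n R i j x \<in> N"
    and "m < n" "A \<in> carrier M" "A $$ (m, m) = \<one>"
    and "\<And>k l. k < n \<Longrightarrow> l < n \<Longrightarrow> l \<noteq> m \<Longrightarrow> A $$ (k, l) = (if k = l then \<one> else \<zero>)"
    and "\<And>k. k < n \<Longrightarrow> k \<noteq> m \<Longrightarrow> A $$ (k, m) \<in> I"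
  shows "A \<in> N"
proof -
  have "A \<in> N"
    if "finite F" "F \<subseteq> {..<n} - {m}" "A \<in> carrier M" "A $$ (m, m) = \<one>"
      "\<And>k l. k < n \<Longrightarrow> l < n \<Longrightarrow> l \<noteq> m \<Longrightarrow> A $$ (k, l) = (if k = l then \<one> else \<zero>)"
      "\<And>k. k \<in> F \<Longrightarrow> A $$ (k, m) \<in> I" "\<And>k. k < n \<Longrightarrow> k \<noteq> m \<Longrightarrow> k \<notin> F \<Longrightarrow> A $$ (k, m) = \<zero>" for F A
    using that
  proof (induction F arbitrary: A rule: finite_induct)
    case empty
    then have "A = \<one>\<^bsub>M\<^esub>"
    proof (intro mat_eqI)
      show "A $$ (k, l) = \<one>\<^bsub>M\<^esub> $$ (k, l)" if "k < n" "l < n" for k l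
        using that empty(3) empty(4)[OF that] empty(6)[of k] by (cases "l = m") auto
    qed (use empty(2) in auto)
    then show ?case
      using one by simp
  next
    case (insert j F)
    let ?x = "A $$ (j, m)"
    have j: "j < n" "j \<noteq> m" "?x \<in> carrier R" "?x \<in> I"
      using insert.prems assms(4) by auto
    let ?A = "transvection n R j m (\<ominus> ?x) \<otimes>\<^bsub>M\<^esub> A"
    have A: "?A \<in> carrier M" "?A = A \<ominus>\<^bsub>M\<^esub> E j m ?x \<otimes>\<^bsub>M\<^esub> A"
      using j insert.prems by (simp_all add: transvection_minus[OF j(3)] M.minus_eq M.l_distr M.l_minus)
    have entry: "?A $$ (k, l) = A $$ (k, l) \<ominus> (if k = j then ?x \<otimes> A $$ (m, l) else \<zero>)" if "k < n" "l < n" for k l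
      unfolding A(2) using that j insert.prems(2) assms(4) by simp
    have "?A \<in> N"
    proof (rule insert.IH)
      show "?A $$ (m, m) = \<one>"
        using entry[of m m] insert.prems(3) j assms(4) by (simp add: minus_eq)
      show "?A $$ (k, l) = (if k = l then \<one> else \<zero>)" if "k < n" "l < n" "l \<noteq> m" for k l
        using entry[of k l] insert.prems(4) j assms(4) that by (simp add: minus_eq)
      show "?A $$ (k, m) \<in> I" if "k \<in> F" for k
      proof -
        have "k < n" "k \<noteq> j"
          using that insert.prems(1) insert.hyps by auto
        then show ?thesis
          using entry[of k m] insert.prems(2) insert.prems(5)[of k] that assms(4) by (simp add: minus_eq)
      qed
      show "?A $$ (k, m) = \<zero>" if "k < n" "k \<noteq> m" "k \<notin> F" for k
        using entry[OF that(1) assms(4)] insert.prems(3) insert.prems(6)[of k] j that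
        by (cases "k = j") (simp_all add: minus_eq r_neg)
    qed (use insert.prems A(1) in auto)
    then have "transvection n R j m ?x \<otimes>\<^bsub>M\<^esub> ?A \<in> N"
      using mult trans[OF j(1) assms(4) j(2,4)] by blast
    also have "transvection n R j m ?x \<otimes>\<^bsub>M\<^esub> ?A = A"
      using j assms(4) insert.prems(2) by (simp add: M.m_assoc[symmetric] transvection_add r_neg)
    finally show ?case .
  qed
  from this[of "{..<n} - {m}" A] show ?thesis
    using assms by auto
qed

text \<open>The transposed statement. The set \<open>N\<close> is kept general because two cases
  occur below: a subgroup of level \<open>I\<close>, and the whole elementary subgroup with
  \<open>carrier R\<close> in the place of \<open>I\<close>.\<close>

lemma row_matrix_mem:
  assumes mult: "\<And>g h. g \<in> N \<Longrightarrow> h \<in> N \<Longrightarrow> g \<otimes>\<^bsub>M\<^esub> h \<in> N" and one: "\<one>\<^bsub>M\<^esub> \<in> N"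
    and trans: "\<And>i j x. i < n \<Longrightarrow> j < n \<Longrightarrow> i \<noteq> j \<Longrightarrow> x \<in> I \<Longrightarrow> transvection n R i j x \<in> N"
    and "m < n" "A \<in> carrier M" "A $$ (m, m) = \<one>"
    and "\<And>k l. k < n \<Longrightarrow> l < n \<Longrightarrow> k \<noteq> m \<Longrightarrow> A $$ (k, l) = (if k = l then \<one> else \<zero>)"
    and "\<And>l. l < n \<Longrightarrow> l \<noteq> m \<Longrightarrow> A $$ (m, l) \<in> I"
  shows "A \<in> N"
proof -
  have "A \<in> N"
    if "finite F" "F \<subseteq> {..<n} - {m}" "A \<in> carrier M" "A $$ (m, m) = \<one>"
      "\<And>k l. k < n \<Longrightarrow> l < n \<Longrightarrow> k \<noteq> m \<Longrightarrow> A $$ (k, l) = (if k = l then \<one> else \<zero>)"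
      "\<And>l. l \<in> F \<Longrightarrow> A $$ (m, l) \<in> I" "\<And>l. l < n \<Longrightarrow> l \<noteq> m \<Longrightarrow> l \<notin> F \<Longrightarrow> A $$ (m, l) = \<zero>" for F A
    using that
  proof (induction F arbitrary: A rule: finite_induct)
    case empty
    then have "A = \<one>\<^bsub>M\<^esub>"
    proof (intro mat_eqI)
      show "A $$ (k, l) = \<one>\<^bsub>M\<^esub> $$ (k, l)" if "k < n" "l < n" for k l
        using that empty(3) empty(4)[OF that] empty(6)[of l] by (cases "k = m") auto
    qed (use empty(2) in auto)
    then show ?case
      using one by simp
  next
    case (insert j F)
    let ?x = "A $$ (m, j)"
    have j: "j < n" "j \<noteq> m" "?x \<in> carrier R" "?x \<in> I"
      using insert.prems assms(4) by auto
    let ?A = "A \<otimes>\<^bsub>M\<^esub> transvection n R m j (\<ominus> ?x)"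
    have A: "?A \<in> carrier M" "?A = A \<ominus>\<^bsub>M\<^esub> A \<otimes>\<^bsub>M\<^esub> E m j ?x"
      using j insert.prems by (simp_all add: transvection_minus[OF j(3)] M.minus_eq M.r_distr M.r_minus)
    have entry: "?A $$ (k, l) = A $$ (k, l) \<ominus> (if l = j then A $$ (k, m) \<otimes> ?x else \<zero>)" if "k < n" "l < n" for k l
      unfolding A(2) using that j insert.prems(2) assms(4) by simp
    have "?A \<in> N"
    proof (rule insert.IH)
      show "?A $$ (m, m) = \<one>"
        using entry[of m m] insert.prems(3) j assms(4) by (simp add: minus_eq)
      show "?A $$ (k, l) = (if k = l then \<one> else \<zero>)" if "k < n" "l < n" "k \<noteq> m" for k l
        using entry[of k l] insert.prems(4) j assms(4) that by (simp add: minus_eq)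
      show "?A $$ (m, l) \<in> I" if "l \<in> F" for l
      proof -
        have "l < n" "l \<noteq> j"
          using that insert.prems(1) insert.hyps by auto
        then show ?thesis
          using entry[of m l] insert.prems(2) insert.prems(5)[of l] that assms(4) by (simp add: minus_eq)
      qed
      show "?A $$ (m, l) = \<zero>" if "l < n" "l \<noteq> m" "l \<notin> F" for l
        using entry[OF assms(4) that(1)] insert.prems(3) insert.prems(6)[of l] j that
        by (cases "l = j") (simp_all add: minus_eq r_neg)
    qed (use insert.prems A(1) in auto)
    then have "?A \<otimes>\<^bsub>M\<^esub> transvection n R m j ?x \<in> N"
      using mult trans[OF assms(4) j(1) j(2)[symmetric] j(4)] by blast
    also have "?A \<otimes>\<^bsub>M\<^esub> transvection n R m j ?x = A"
      using j assms(4) insert.prems(2) by (simp add: M.m_assoc transvection_add l_neg)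
    finally show ?case .
  qed
  from this[of "{..<n} - {m}" A] show ?thesis
    using assms by auto
qed

end

section \<open>The general linear group and its elementary subgroup\<close>

context matrix_ring_over
begin

lemma GL_group: "group (GL n R)"
  unfolding GL_def by (rule M.units_group)

lemma GL_simps [simp]:
  "carrier (GL n R) = Units M" "x \<otimes>\<^bsub>GL n R\<^esub> y = x \<otimes>\<^bsub>M\<^esub> y" "\<one>\<^bsub>GL n R\<^esub> = \<one>\<^bsub>M\<^esub>"
  unfolding GL_def by (simp_all add: units_of_carrier units_of_mult units_of_one)

lemma GL_inv [simp]: "x \<in> Units M \<Longrightarrow> inv\<^bsub>GL n R\<^esub> x = inv\<^bsub>M\<^esub> x"
  unfolding GL_def by (rule M.units_of_inv)

lemma elementary_subgroup_subgroup: "subgroup (elementary_subgroup n R) (GL n R)"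
  unfolding elementary_subgroup_def elementary_on_def
  by (rule group.generate_is_subgroup[OF GL_group]) (auto intro: transvection_Units)

lemma elementary_subgroup_closed:
  shows elementary_Units: "g \<in> elementary_subgroup n R \<Longrightarrow> g \<in> Units M"
    and elementary_mult: "g \<in> elementary_subgroup n R \<Longrightarrow> h \<in> elementary_subgroup n R \<Longrightarrow>
      g \<otimes>\<^bsub>M\<^esub> h \<in> elementary_subgroup n R"
    and elementary_inv: "g \<in> elementary_subgroup n R \<Longrightarrow> inv\<^bsub>M\<^esub> g \<in> elementary_subgroup n R"
    and elementary_one: "\<one>\<^bsub>M\<^esub> \<in> elementary_subgroup n R"
proof -
  interpret S: subgroup "elementary_subgroup n R" "GL n R"
    by (rule elementary_subgroup_subgroup)
  show *: "g \<in> elementary_subgroup n R \<Longrightarrow> g \<in> Units M"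
    using S.mem_carrier by simp
  show "g \<in> elementary_subgroup n R \<Longrightarrow> h \<in> elementary_subgroup n R \<Longrightarrow>
      g \<otimes>\<^bsub>M\<^esub> h \<in> elementary_subgroup n R"
    using S.m_closed by simp
  show "g \<in> elementary_subgroup n R \<Longrightarrow> inv\<^bsub>M\<^esub> g \<in> elementary_subgroup n R"
    using S.m_inv_closed[of g] * by simp
  show "\<one>\<^bsub>M\<^esub> \<in> elementary_subgroup n R"
    using S.one_closed by simp
qed

lemma transvection_elementary:
  "i < n \<Longrightarrow> j < n \<Longrightarrow> i \<noteq> j \<Longrightarrow> x \<in> carrier R \<Longrightarrow> transvection n R i j x \<in> elementary_subgroup n R"
  unfolding elementary_subgroup_def elementary_on_def by (intro generate.incl) auto

end

text \<open>The intended instance of \<open>N\<close> is \<open>relative_elementary n R I\<close>;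
  the assumptions isolate what the computations use of this intersection of normal
  subgroups.\<close>

locale level_subgroup = matrix_ring_over R n + ideal I R for R (structure) and n and I +
  fixes N
  assumes n3: "n \<ge> 3"
    and N_Units: "N \<subseteq> Units M"
    and N_mult: "g \<in> N \<Longrightarrow> h \<in> N \<Longrightarrow> g \<otimes>\<^bsub>M\<^esub> h \<in> N"
    and N_trans: "i < n \<Longrightarrow> j < n \<Longrightarrow> i \<noteq> j \<Longrightarrow> x \<in> I \<Longrightarrow> transvection n R i j x \<in> N"
    and N_conj: "g \<in> elementary_subgroup n R \<Longrightarrow> h \<in> N \<Longrightarrow> g \<otimes>\<^bsub>M\<^esub> h \<otimes>\<^bsub>M\<^esub> inv\<^bsub>M\<^esub> g \<in> N"
begin

lemma N_one: "\<one>\<^bsub>M\<^esub> \<in> N"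
  using N_trans[of 0 1 \<zero>] n3 by simp

lemma N_conj_transvection:
  "h \<in> N \<Longrightarrow> i < n \<Longrightarrow> j < n \<Longrightarrow> i \<noteq> j \<Longrightarrow> x \<in> carrier R \<Longrightarrow>
    transvection n R i j x \<otimes>\<^bsub>M\<^esub> h \<otimes>\<^bsub>M\<^esub> transvection n R i j (\<ominus> x) \<in> N"
  using N_conj[OF transvection_elementary, of i j x h] by (simp add: transvection_inv)

text \<open>The matrix is the commutator of \<open>transvection n R m p a\<close> with
  \<open>transvection n R p m f\<close>: the product of the matrix units in one order is
  \<open>E m m (a \<otimes> f) = E m m a\<close>, in the other order
  \<open>E p p (f \<otimes> a)\<close>, which is zero.\<close>

lemma diagonal_matrix_mem:
  assumes "m < n" "a \<in> I" "f \<in> carrier R" "f \<otimes> a = \<zero>" "a \<otimes> f = a"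
  shows "\<one>\<^bsub>M\<^esub> \<oplus>\<^bsub>M\<^esub> E m m a \<in> N"
proof -
  obtain p where p: "p < n" "p \<noteq> m"
    using ex_third_index[OF n3] by blast
  have a: "a \<in> carrier R"
    using assms(2) a_subset by blast
  have "transvection n R p m f \<otimes>\<^bsub>M\<^esub> transvection n R m p (\<ominus> a) \<otimes>\<^bsub>M\<^esub> transvection n R p m (\<ominus> f) \<in> N"
    using assms p by (intro N_conj_transvection N_trans) auto
  from N_mult[OF N_trans[of m p a] this] assms(1,2) p
  have "transvection n R m p a \<otimes>\<^bsub>M\<^esub> (transvection n R p m f \<otimes>\<^bsub>M\<^esub> transvection n R m p (\<ominus> a) \<otimes>\<^bsub>M\<^esub>
      transvection n R p m (\<ominus> f)) \<in> N"
    by simp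
  also have "transvection n R m p a \<otimes>\<^bsub>M\<^esub> (transvection n R p m f \<otimes>\<^bsub>M\<^esub> transvection n R m p (\<ominus> a) \<otimes>\<^bsub>M\<^esub>
      transvection n R p m (\<ominus> f)) = \<one>\<^bsub>M\<^esub> \<oplus>\<^bsub>M\<^esub> E m p a \<otimes>\<^bsub>M\<^esub> E p m f"
    using M.unipotent_commutator[of "E m p a" "E p m f"] assms(1,3,4) p a
    by (simp add: transvection_minus E_mult_E M.m_assoc) (simp add: transvection_eq)
  also have "E m p a \<otimes>\<^bsub>M\<^esub> E p m f = E m m a"
    using assms p a by (simp add: E_mult_E)
  finally show ?thesis .
qed

text \<open>From \<open>a = a f\<close> and \<open>f a = \<zero>\<close> follows
  \<open>a a = \<zero>\<close>. Hence \<open>1 - E m m a\<close> turns the diagonal entry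
  \<open>\<one> \<oplus> a\<close> into \<open>\<one>\<close> and is undone by
  \<open>1 + E m m a\<close>, which lies in \<open>N\<close>.\<close>

lemma column_matrix_mem_level:
  assumes "m < n" "A \<in> carrier M" "a \<in> I" "f \<in> carrier R" "f \<otimes> a = \<zero>" "a \<otimes> f = a" "A $$ (m, m) = \<one> \<oplus> a"
    and "\<And>k l. k < n \<Longrightarrow> l < n \<Longrightarrow> l \<noteq> m \<Longrightarrow> A $$ (k, l) = (if k = l then \<one> else \<zero>)"
    and "\<And>k. k < n \<Longrightarrow> k \<noteq> m \<Longrightarrow> A $$ (k, m) \<in> I"
  shows "A \<in> N"
proof -
  have a: "a \<in> carrier R"
    using assms(3) a_subset by blast
  have "a \<otimes> a = (a \<otimes> f) \<otimes> a"
    using assms(6) by simp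
  then have aa: "a \<otimes> a = \<zero>"
    using assms(4,5) a by (simp add: m_assoc)
  let ?Z = "E m m a"
  have Z: "?Z \<in> carrier M" "?Z \<otimes>\<^bsub>M\<^esub> ?Z = \<zero>\<^bsub>M\<^esub>"
    using a assms(1) aa by (simp_all add: E_mult_E)
  let ?C = "A \<ominus>\<^bsub>M\<^esub> ?Z \<otimes>\<^bsub>M\<^esub> A"
  have C: "?C \<in> carrier M"
    using assms Z by simp
  have entry: "?C $$ (k, l) = A $$ (k, l) \<ominus> (if k = m then a \<otimes> A $$ (m, l) else \<zero>)" if "k < n" "l < n" for k l
    using that assms(1,2) a by simp
  have "?C \<in> N"
  proof (rule column_matrix_mem[where N = N and I = I and m = m])
    show "?C $$ (m, m) = \<one>"
      using assms(1) a by (simp add: entry assms(7) r_distr aa minus_eq a_assoc r_neg)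
    show "?C $$ (k, l) = (if k = l then \<one> else \<zero>)" if "k < n" "l < n" "l \<noteq> m" for k l
      using that assms(1) a by (simp add: entry assms(8) minus_eq)
    show "?C $$ (k, m) \<in> I" if "k < n" "k \<noteq> m" for k
      using that assms(1,2,9) by (simp add: entry minus_eq)
  qed (use assms(1) C N_mult N_one N_trans in auto)
  then have "(\<one>\<^bsub>M\<^esub> \<oplus>\<^bsub>M\<^esub> ?Z) \<otimes>\<^bsub>M\<^esub> ?C \<in> N"
    using diagonal_matrix_mem[OF assms(1,3-6)] N_mult by blast
  also have "?C = (\<one>\<^bsub>M\<^esub> \<ominus>\<^bsub>M\<^esub> ?Z) \<otimes>\<^bsub>M\<^esub> A"
    using Z assms(2) by (simp add: M.minus_eq M.l_distr M.l_minus)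
  also have "(\<one>\<^bsub>M\<^esub> \<oplus>\<^bsub>M\<^esub> ?Z) \<otimes>\<^bsub>M\<^esub> ((\<one>\<^bsub>M\<^esub> \<ominus>\<^bsub>M\<^esub> ?Z) \<otimes>\<^bsub>M\<^esub> A) = A"
    using Z assms(2) M.one_add_square_zero_inv[OF Z] by (simp add: M.m_assoc[symmetric])
  finally show ?thesis .
qed


text \<open>The column operation \<open>1 - Q\<close> reduces the row \<open>c \<tau>\<^sub>j\<close> to the single entry
  \<open>c \<tau>\<^sub>j\<^sub>m\<close>.\<close>

lemma conj_column_form:
  assumes "\<sigma> \<in> Units M" "i < n" "j < n" "m < n" "i \<noteq> j" "c \<in> carrier R" "r \<in> carrier R"
    and \<tau>_def: "\<tau> = inv\<^bsub>M\<^esub> \<sigma>"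
    and cr: "c \<otimes> \<tau> $$ (j, m) \<otimes> r = c" "r \<otimes> \<tau> $$ (j, m) \<otimes> r = r"
    and f_def: "f = r \<otimes> \<tau> $$ (j, m)"
    and d_def: "d = c \<otimes> \<tau> $$ (j, m)"
    and Q_def: "Q = E m j r \<otimes>\<^bsub>M\<^esub> \<tau> \<ominus>\<^bsub>M\<^esub> E m m f"
  shows "Q \<in> carrier M" "Q \<otimes>\<^bsub>M\<^esub> Q = \<zero>\<^bsub>M\<^esub>"
    "(\<one>\<^bsub>M\<^esub> \<oplus>\<^bsub>M\<^esub> Q) \<otimes>\<^bsub>M\<^esub> (\<sigma> \<otimes>\<^bsub>M\<^esub> transvection n R i j c \<otimes>\<^bsub>M\<^esub> \<tau>) \<otimes>\<^bsub>M\<^esub> (\<one>\<^bsub>M\<^esub> \<ominus>\<^bsub>M\<^esub> Q) =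
      \<one>\<^bsub>M\<^esub> \<oplus>\<^bsub>M\<^esub> \<sigma> \<otimes>\<^bsub>M\<^esub> E i m d \<ominus>\<^bsub>M\<^esub> E m m (f \<otimes> \<sigma> $$ (m, i) \<otimes> d)"
proof -
  have \<sigma>: "\<sigma> \<in> carrier M" "\<tau> \<in> carrier M" "\<sigma> \<otimes>\<^bsub>M\<^esub> \<tau> = \<one>\<^bsub>M\<^esub>" "\<tau> \<otimes>\<^bsub>M\<^esub> \<sigma> = \<one>\<^bsub>M\<^esub>"
    using assms(1) M.Units_closed by (simp_all add: \<tau>_def)
  have f: "f \<in> carrier R" and d: "d \<in> carrier R"
    using assms(2-7) \<sigma> by (simp_all add: f_def d_def)
  show Q: "Q \<in> carrier M"
    using assms(2-7) \<sigma> f by (simp add: Q_def)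
  have \<tau>\<sigma>E: "\<tau> \<otimes>\<^bsub>M\<^esub> (\<sigma> \<otimes>\<^bsub>M\<^esub> W) = W" if "W \<in> carrier M" for W
    using that \<sigma> by (simp add: M.m_assoc[symmetric])
  have \<tau>E: "E k j x \<otimes>\<^bsub>M\<^esub> (\<tau> \<otimes>\<^bsub>M\<^esub> (E m l y \<otimes>\<^bsub>M\<^esub> W)) = E k l (x \<otimes> \<tau> $$ (j, m) \<otimes> y) \<otimes>\<^bsub>M\<^esub> W"
    if "k < n" "l < n" "x \<in> carrier R" "y \<in> carrier R" "W \<in> carrier M" for k l x y W
    using that assms(3,4) \<sigma> E_mult_mult_E[of \<tau> x y k j m l] by (simp add: M.m_assoc[symmetric])
  have EE: "E k l x \<otimes>\<^bsub>M\<^esub> (E k' l' y \<otimes>\<^bsub>M\<^esub> W) = (if l = k' then E k l' (x \<otimes> y) else \<zero>\<^bsub>M\<^esub>) \<otimes>\<^bsub>M\<^esub> W"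
    if "k < n" "l < n" "k' < n" "l' < n" "x \<in> carrier R" "y \<in> carrier R" "W \<in> carrier M" for k l x y W k' l'
    using that by (simp add: M.m_assoc[symmetric] E_mult_E)
  \<comment> \<open>The relation \<open>r \<otimes> \<tau> $$ (j, m) \<otimes> r = r\<close> makes
    \<open>f\<close> idempotent, and \<open>c \<otimes> \<tau> $$ (j, m) \<otimes> r = c\<close>
    will give \<open>d \<otimes> f = d\<close>.\<close>
  have ff: "f \<otimes> f = f" and fr: "f \<otimes> r = r"
    using cr(2) assms(3,4,7) \<sigma> by (simp_all add: f_def m_assoc[symmetric])
  have df: "d \<otimes> f = d"
  proof -
    have "d \<otimes> f = (c \<otimes> \<tau> $$ (j, m) \<otimes> r) \<otimes> \<tau> $$ (j, m)"
      using assms(3,4,6,7) \<sigma> by (simp add: d_def f_def m_assoc)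
    then show ?thesis
      by (simp only: cr(1) d_def)
  qed
  show "Q \<otimes>\<^bsub>M\<^esub> Q = \<zero>\<^bsub>M\<^esub>"
    unfolding Q_def using assms(2-7) \<sigma> f
    by (simp add: M.ring_simprules \<tau>E E_mult_mult_E EE E_mult_E cr(2) fr ff f_def[symmetric] M.add_minus_cancel)
  have dr: "d \<otimes> r = c"
    using cr(1) by (simp add: d_def)
  \<comment> \<open>Subtracting \<open>d r\<close> times row \<open>j\<close> of
    \<open>\<tau>\<close> removes the row altogether, as \<open>d \<otimes> r = c\<close>; the
    correction by \<open>f\<close> in \<open>Q\<close> then contributes
    \<open>d \<otimes> f = d\<close> in column \<open>m\<close>.\<close>
  have 1: "E i j c \<otimes>\<^bsub>M\<^esub> \<tau> \<otimes>\<^bsub>M\<^esub> (\<one>\<^bsub>M\<^esub> \<ominus>\<^bsub>M\<^esub> Q) = E i m d"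
    unfolding Q_def using assms(2-7) \<sigma> f d
    by (simp add: M.ring_simprules \<tau>E E_mult_mult_E d_def[symmetric] dr df M.add_minus_cancel)
  \<comment> \<open>The inverses cancel in the first term of \<open>Q\<close>, and
    \<open>i \<noteq> j\<close> annihilates what is left. Only the term with \<open>f\<close>
    survives, so \<open>1 + Q\<close> changes nothing but the \<open>(m, m)\<close> entry.\<close>
  have 2: "Q \<otimes>\<^bsub>M\<^esub> (\<sigma> \<otimes>\<^bsub>M\<^esub> E i m d) = \<ominus>\<^bsub>M\<^esub> E m m (f \<otimes> \<sigma> $$ (m, i) \<otimes> d)"
    unfolding Q_def using assms(2-7) \<sigma> f d
    by (simp add: M.minus_eq M.l_distr M.l_minus M.m_assoc \<tau>\<sigma>E E_mult_mult_E E_mult_E)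
  have "\<sigma> \<otimes>\<^bsub>M\<^esub> transvection n R i j c \<otimes>\<^bsub>M\<^esub> \<tau> = \<one>\<^bsub>M\<^esub> \<oplus>\<^bsub>M\<^esub> \<sigma> \<otimes>\<^bsub>M\<^esub> (E i j c \<otimes>\<^bsub>M\<^esub> \<tau>)"
    unfolding transvection_eq using assms(2-7) \<sigma> by (simp add: M.r_distr M.l_distr M.m_assoc)
  then have "\<sigma> \<otimes>\<^bsub>M\<^esub> transvection n R i j c \<otimes>\<^bsub>M\<^esub> \<tau> \<otimes>\<^bsub>M\<^esub> (\<one>\<^bsub>M\<^esub> \<ominus>\<^bsub>M\<^esub> Q) =
      (\<one>\<^bsub>M\<^esub> \<ominus>\<^bsub>M\<^esub> Q) \<oplus>\<^bsub>M\<^esub> \<sigma> \<otimes>\<^bsub>M\<^esub> (E i j c \<otimes>\<^bsub>M\<^esub> \<tau> \<otimes>\<^bsub>M\<^esub> (\<one>\<^bsub>M\<^esub> \<ominus>\<^bsub>M\<^esub> Q))"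
    using assms(2-7) \<sigma> Q by (simp add: M.l_distr M.m_assoc)
  also have "\<dots> = (\<one>\<^bsub>M\<^esub> \<ominus>\<^bsub>M\<^esub> Q) \<oplus>\<^bsub>M\<^esub> \<sigma> \<otimes>\<^bsub>M\<^esub> E i m d"
    by (simp only: 1)
  finally have 3: "\<sigma> \<otimes>\<^bsub>M\<^esub> transvection n R i j c \<otimes>\<^bsub>M\<^esub> \<tau> \<otimes>\<^bsub>M\<^esub> (\<one>\<^bsub>M\<^esub> \<ominus>\<^bsub>M\<^esub> Q) = (\<one>\<^bsub>M\<^esub> \<ominus>\<^bsub>M\<^esub> Q) \<oplus>\<^bsub>M\<^esub> \<sigma> \<otimes>\<^bsub>M\<^esub> E i m d" .
  have "(\<one>\<^bsub>M\<^esub> \<oplus>\<^bsub>M\<^esub> Q) \<otimes>\<^bsub>M\<^esub> (\<sigma> \<otimes>\<^bsub>M\<^esub> transvection n R i j c \<otimes>\<^bsub>M\<^esub> \<tau>) \<otimes>\<^bsub>M\<^esub> (\<one>\<^bsub>M\<^esub> \<ominus>\<^bsub>M\<^esub> Q) =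
      (\<one>\<^bsub>M\<^esub> \<oplus>\<^bsub>M\<^esub> Q) \<otimes>\<^bsub>M\<^esub> ((\<one>\<^bsub>M\<^esub> \<ominus>\<^bsub>M\<^esub> Q) \<oplus>\<^bsub>M\<^esub> \<sigma> \<otimes>\<^bsub>M\<^esub> E i m d)"
    unfolding 3[symmetric] using assms(2-7) \<sigma> Q by (simp add: M.m_assoc)
  also have "\<dots> = \<one>\<^bsub>M\<^esub> \<oplus>\<^bsub>M\<^esub> (\<sigma> \<otimes>\<^bsub>M\<^esub> E i m d \<oplus>\<^bsub>M\<^esub> Q \<otimes>\<^bsub>M\<^esub> (\<sigma> \<otimes>\<^bsub>M\<^esub> E i m d))"
    using assms(2-7) \<sigma> d Q M.one_add_square_zero_inv[OF Q \<open>Q \<otimes>\<^bsub>M\<^esub> Q = \<zero>\<^bsub>M\<^esub>\<close>]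
    by (subst M.r_distr) (simp_all add: M.l_distr)
  also have "\<dots> = \<one>\<^bsub>M\<^esub> \<oplus>\<^bsub>M\<^esub> \<sigma> \<otimes>\<^bsub>M\<^esub> E i m d \<ominus>\<^bsub>M\<^esub> E m m (f \<otimes> \<sigma> $$ (m, i) \<otimes> d)"
    unfolding 2 using assms(2-7) \<sigma> d f by (simp add: M.minus_eq M.a_assoc)
  finally show "(\<one>\<^bsub>M\<^esub> \<oplus>\<^bsub>M\<^esub> Q) \<otimes>\<^bsub>M\<^esub> (\<sigma> \<otimes>\<^bsub>M\<^esub> transvection n R i j c \<otimes>\<^bsub>M\<^esub> \<tau>) \<otimes>\<^bsub>M\<^esub> (\<one>\<^bsub>M\<^esub> \<ominus>\<^bsub>M\<^esub> Q) =
      \<one>\<^bsub>M\<^esub> \<oplus>\<^bsub>M\<^esub> \<sigma> \<otimes>\<^bsub>M\<^esub> E i m d \<ominus>\<^bsub>M\<^esub> E m m (f \<otimes> \<sigma> $$ (m, i) \<otimes> d)" .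
qed

text \<open>The relations for \<open>c\<close> and \<open>r\<close> say that
  \<open>\<tau> $$ (j, m) \<otimes> r\<close> is an idempotent which fixes \<open>c\<close> from the
  right. The conjugate \<open>W\<close> differs from the identity in column \<open>m\<close> alone,
  and its diagonal excess \<open>a = (\<one> - f) \<sigma> $$ (m, i) d\<close> satisfies
  \<open>f a = \<zero>\<close> and \<open>a f = a\<close>. The cases \<open>m \<noteq> j\<close> and
  \<open>m = j\<close> differ in which factors are congruent to the identity.\<close>

lemma conj_idempotent_mem:
  assumes "\<sigma> \<in> Units M" "i < n" "j < n" "m < n" "i \<noteq> j"
    and \<tau>_def: "\<tau> = inv\<^bsub>M\<^esub> \<sigma>"
    and \<sigma>_off: "\<And>k l. k < n \<Longrightarrow> l < n \<Longrightarrow> k \<noteq> l \<Longrightarrow> \<sigma> $$ (k, l) \<in> I"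
    and \<tau>_off: "\<And>k l. k < n \<Longrightarrow> l < n \<Longrightarrow> k \<noteq> l \<Longrightarrow> \<tau> $$ (k, l) \<in> I"
    and diag: "\<And>y. y \<in> carrier R \<Longrightarrow> \<sigma> $$ (i, i) \<otimes> y \<otimes> \<tau> $$ (j, j) \<ominus> y \<in> I"
    and "c \<in> carrier R" "r \<in> carrier R"
    and cr: "c \<otimes> \<tau> $$ (j, m) \<otimes> r = c" "r \<otimes> \<tau> $$ (j, m) \<otimes> r = r"
  shows "\<sigma> \<otimes>\<^bsub>M\<^esub> transvection n R i j c \<otimes>\<^bsub>M\<^esub> \<tau> \<otimes>\<^bsub>M\<^esub> transvection n R i j (\<ominus> c) \<in> N"
proof -
  have \<sigma>: "\<sigma> \<in> carrier M" "\<tau> \<in> carrier M"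
    using assms(1) M.Units_closed by (simp_all add: \<tau>_def)
  define f where "f = r \<otimes> \<tau> $$ (j, m)"
  define d where "d = c \<otimes> \<tau> $$ (j, m)"
  define Q where "Q = E m j r \<otimes>\<^bsub>M\<^esub> \<tau> \<ominus>\<^bsub>M\<^esub> E m m f"
  define W where "W = \<one>\<^bsub>M\<^esub> \<oplus>\<^bsub>M\<^esub> \<sigma> \<otimes>\<^bsub>M\<^esub> E i m d \<ominus>\<^bsub>M\<^esub> E m m (f \<otimes> \<sigma> $$ (m, i) \<otimes> d)"
  define a where "a = \<sigma> $$ (m, i) \<otimes> d \<ominus> f \<otimes> \<sigma> $$ (m, i) \<otimes> d"
  define B where "B = \<sigma> \<otimes>\<^bsub>M\<^esub> transvection n R i j c \<otimes>\<^bsub>M\<^esub> \<tau>"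
  note form = conj_column_form[OF assms(1-5,10,11) \<tau>_def cr f_def d_def Q_def]
  have f: "f \<in> carrier R" and d: "d \<in> carrier R"
    using assms(2-4,10,11) \<sigma> by (simp_all add: f_def d_def)
  have ff: "f \<otimes> f = f"
    using cr(2) assms(3,4,11) \<sigma> by (simp add: f_def m_assoc[symmetric])
  have ffl: "f \<otimes> (f \<otimes> z) = f \<otimes> z" if "z \<in> carrier R" for z
    using that f ff by (simp add: m_assoc[symmetric])
  have df: "d \<otimes> f = d"
  proof -
    have "d \<otimes> f = (c \<otimes> \<tau> $$ (j, m) \<otimes> r) \<otimes> \<tau> $$ (j, m)"
      using assms(3,4,10,11) \<sigma> by (simp add: d_def f_def m_assoc)
    then show ?thesis
      by (simp only: cr(1) d_def)
  qed
  have Q: "Q \<in> carrier M" and QQ: "Q \<otimes>\<^bsub>M\<^esub> Q = \<zero>\<^bsub>M\<^esub>" and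
    BW: "(\<one>\<^bsub>M\<^esub> \<oplus>\<^bsub>M\<^esub> Q) \<otimes>\<^bsub>M\<^esub> B \<otimes>\<^bsub>M\<^esub> (\<one>\<^bsub>M\<^esub> \<ominus>\<^bsub>M\<^esub> Q) = W"
    using form by (simp_all add: B_def W_def)
  have B: "B \<in> carrier M" and W: "W \<in> carrier M"
    using assms(2-4,10) \<sigma> f d by (simp_all add: B_def W_def)
  have a: "a \<in> carrier R" "f \<otimes> a = \<zero>" "a \<otimes> f = a"
    using assms(2-4) \<sigma> f d ff df
    by (simp_all add: a_def minus_eq r_distr l_distr r_minus l_minus m_assoc r_neg ffl)
  let ?t = "transvection n R i j c" and ?t' = "transvection n R i j (\<ominus> c)"
  have tt: "?t' \<otimes>\<^bsub>M\<^esub> ?t = \<one>\<^bsub>M\<^esub>"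
    using assms(2-5,10) by (simp add: transvection_add l_neg)
  have BW': "B = (\<one>\<^bsub>M\<^esub> \<ominus>\<^bsub>M\<^esub> Q) \<otimes>\<^bsub>M\<^esub> W \<otimes>\<^bsub>M\<^esub> (\<one>\<^bsub>M\<^esub> \<oplus>\<^bsub>M\<^esub> Q)"
  proof -
    have "(\<one>\<^bsub>M\<^esub> \<ominus>\<^bsub>M\<^esub> Q) \<otimes>\<^bsub>M\<^esub> W \<otimes>\<^bsub>M\<^esub> (\<one>\<^bsub>M\<^esub> \<oplus>\<^bsub>M\<^esub> Q) =
        ((\<one>\<^bsub>M\<^esub> \<ominus>\<^bsub>M\<^esub> Q) \<otimes>\<^bsub>M\<^esub> (\<one>\<^bsub>M\<^esub> \<oplus>\<^bsub>M\<^esub> Q)) \<otimes>\<^bsub>M\<^esub> B \<otimes>\<^bsub>M\<^esub> ((\<one>\<^bsub>M\<^esub> \<ominus>\<^bsub>M\<^esub> Q) \<otimes>\<^bsub>M\<^esub> (\<one>\<^bsub>M\<^esub> \<oplus>\<^bsub>M\<^esub> Q))"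
      unfolding BW[symmetric] using Q B by (simp add: M.m_assoc)
    then show ?thesis
      using B by (simp add: M.one_add_square_zero_inv[OF Q QQ])
  qed
  have W_entry: "W $$ (k, l) = (if k = l then \<one> else \<zero>) \<oplus> (if l = m then \<sigma> $$ (k, i) \<otimes> d else \<zero>) \<ominus>
      (if k = m \<and> l = m then f \<otimes> \<sigma> $$ (m, i) \<otimes> d else \<zero>)" if "k < n" "l < n" for k l
    using that assms(2-4) \<sigma> f d by (simp add: W_def)
  have Q_entry: "Q $$ (k, l) = (if k = m then r \<otimes> \<tau> $$ (j, l) else \<zero>) \<ominus> (if k = m \<and> l = m then f else \<zero>)"
    if "k < n" "l < n" for k l
    using that assms(3,4,11) \<sigma> f by (simp add: Q_def)
  \<comment> \<open>Row \<open>m\<close> of \<open>Q\<close> is \<open>r\<close> times row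
    \<open>j\<close> of \<open>\<tau>\<close> with the \<open>m\<close>-th entry removed. The
    parameters \<open>S\<close> and \<open>J\<close> are \<open>N\<close> and \<open>I\<close> if
    \<open>m = j\<close>, and the elementary subgroup and \<open>carrier R\<close>
    otherwise.\<close>
  have row: "\<one>\<^bsub>M\<^esub> \<oplus>\<^bsub>M\<^esub> Q \<in> S \<and> \<one>\<^bsub>M\<^esub> \<ominus>\<^bsub>M\<^esub> Q \<in> S"
    if S: "\<And>g h. g \<in> S \<Longrightarrow> h \<in> S \<Longrightarrow> g \<otimes>\<^bsub>M\<^esub> h \<in> S" "\<one>\<^bsub>M\<^esub> \<in> S"
      "\<And>i j x. i < n \<Longrightarrow> j < n \<Longrightarrow> i \<noteq> j \<Longrightarrow> x \<in> J \<Longrightarrow> transvection n R i j x \<in> S"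
      and J: "ideal J R" "\<And>l. l < n \<Longrightarrow> l \<noteq> m \<Longrightarrow> \<tau> $$ (j, l) \<in> J" for S J
  proof -
    interpret J: ideal J R
      by (rule J(1))
    have QJ: "r \<otimes> \<tau> $$ (j, l) \<in> J" if "l < n" "l \<noteq> m" for l
      using J(2)[OF that] assms(11) by (rule J.I_l_closed)
    have Qm: "Q $$ (m, m) = \<zero>" and Qz: "\<And>k l. k < n \<Longrightarrow> l < n \<Longrightarrow> k \<noteq> m \<Longrightarrow> Q $$ (k, l) = \<zero>"
      and QI: "\<And>l. l < n \<Longrightarrow> l \<noteq> m \<Longrightarrow> Q $$ (m, l) \<in> J"
      using assms(4) f QJ J.a_subset by (simp_all add: Q_entry f_def[symmetric] minus_eq r_neg subset_iff)
    have "\<one>\<^bsub>M\<^esub> \<oplus>\<^bsub>M\<^esub> Q \<in> S"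
    proof (rule row_matrix_mem[where N = S and I = J and m = m, OF S])
      show "(\<one>\<^bsub>M\<^esub> \<oplus>\<^bsub>M\<^esub> Q) $$ (k, l) = (if k = l then \<one> else \<zero>)" if "k < n" "l < n" "k \<noteq> m" for k l
        using that Q by (simp add: Qz)
      show "(\<one>\<^bsub>M\<^esub> \<oplus>\<^bsub>M\<^esub> Q) $$ (m, l) \<in> J" if "l < n" "l \<noteq> m" for l
        using that QI[OF that] Q assms(4) by simp
    qed (use Q Qm assms(4) in simp_all)
    moreover have "\<one>\<^bsub>M\<^esub> \<ominus>\<^bsub>M\<^esub> Q \<in> S"
    proof (rule row_matrix_mem[where N = S and I = J and m = m, OF S])
      show "(\<one>\<^bsub>M\<^esub> \<ominus>\<^bsub>M\<^esub> Q) $$ (k, l) = (if k = l then \<one> else \<zero>)" if "k < n" "l < n" "k \<noteq> m" for k l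
        using that Q by (simp add: Qz minus_eq)
      show "(\<one>\<^bsub>M\<^esub> \<ominus>\<^bsub>M\<^esub> Q) $$ (m, l) \<in> J" if "l < n" "l \<noteq> m" for l
        using that QI[OF that] Q assms(4) by (simp add: minus_eq)
    qed (use Q Qm assms(4) in \<open>simp_all add: minus_eq\<close>)
    ultimately show ?thesis ..
  qed
  show ?thesis
  proof (cases "m = j")
    case False
    \<comment> \<open>Here \<open>c\<close> is a multiple of an off-diagonal entry of
      \<open>\<tau>\<close>, so both \<open>W\<close> and \<open>?t'\<close> have level
      \<open>I\<close>. The conjugating matrix \<open>\<one> \<oplus> Q\<close> is merely
      elementary, which is enough because \<open>N\<close> is stable under such conjugation.\<close>
    have "\<tau> $$ (j, m) \<in> I"
      using \<tau>_off[of j m] False assms(3,4) by auto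
    then have cI: "c \<in> I" and dI: "d \<in> I"
      using assms(10,11) cr(1) I_l_closed[of "\<tau> $$ (j, m)" c] I_r_closed[of "c \<otimes> \<tau> $$ (j, m)" r]
      by (simp_all add: d_def)
    have aI: "a \<in> I"
      using dI assms(2,4) f \<sigma> by (simp add: a_def minus_eq I_l_closed)
    have "W \<in> N"
    proof (rule column_matrix_mem_level[OF assms(4) W aI f a(2,3)])
      show "W $$ (m, m) = \<one> \<oplus> a"
        using assms(2,4) \<sigma> f d by (simp add: W_entry a_def minus_eq a_assoc)
      show "W $$ (k, m) \<in> I" if "k < n" "k \<noteq> m" for k
        using that assms(2,4) \<sigma> d dI by (simp add: W_entry minus_eq I_l_closed)
    qed (use assms(4) in \<open>simp add: W_entry minus_eq\<close>)
    moreover have "\<one>\<^bsub>M\<^esub> \<oplus>\<^bsub>M\<^esub> Q \<in> elementary_subgroup n R \<and> \<one>\<^bsub>M\<^esub> \<ominus>\<^bsub>M\<^esub> Q \<in> elementary_subgroup n R"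
      using assms(3) \<sigma> by (intro row[where J = "carrier R"] elementary_mult elementary_one transvection_elementary oneideal) auto
    moreover have "\<one>\<^bsub>M\<^esub> \<oplus>\<^bsub>M\<^esub> Q = inv\<^bsub>M\<^esub> (\<one>\<^bsub>M\<^esub> \<ominus>\<^bsub>M\<^esub> Q)"
      using M.one_add_square_zero_inv[OF Q QQ] Q by (intro M.inv_char[symmetric]) auto
    ultimately have "B \<in> N"
      unfolding BW' using N_conj[of "\<one>\<^bsub>M\<^esub> \<ominus>\<^bsub>M\<^esub> Q" W] by simp
    moreover have "?t' \<in> N"
      using cI assms(2,3,5) by (intro N_trans) auto
    ultimately show ?thesis
      using N_mult unfolding B_def by blast
  next
    case True
    \<comment> \<open>Now \<open>c\<close> need not lie in \<open>I\<close>, but the entries of row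
      \<open>j\<close> of \<open>\<tau>\<close> outside column \<open>m = j\<close> do, and the
      conjugating matrices themselves belong to \<open>N\<close>.\<close>
    have g: "\<one>\<^bsub>M\<^esub> \<oplus>\<^bsub>M\<^esub> Q \<in> N" "\<one>\<^bsub>M\<^esub> \<ominus>\<^bsub>M\<^esub> Q \<in> N"
      using row[where S = N and J = I] N_mult N_one N_trans \<tau>_off[OF assms(3)] True ideal_axioms by auto
    have aI: "a \<in> I"
    proof -
      have "\<sigma> $$ (m, i) \<in> I"
        using \<sigma>_off[of m i] True assms(2,3,5) by auto
      then show ?thesis
        using f d by (simp add: a_def minus_eq I_l_closed I_r_closed)
    qed
    \<comment> \<open>The \<open>(i, m)\<close> entry of \<open>W\<close> is
      \<open>\<sigma> $$ (i, i) \<otimes> d\<close> and need not lie in \<open>I\<close>. The factor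
      \<open>?t'\<close> subtracts \<open>c\<close> there; as
      \<open>d = c \<otimes> \<tau> $$ (j, j)\<close>, the difference is the one controlled by
      \<open>diag\<close>.\<close>
    let ?V = "W \<otimes>\<^bsub>M\<^esub> ?t'"
    have V: "?V = W \<ominus>\<^bsub>M\<^esub> W \<otimes>\<^bsub>M\<^esub> E i j c"
      unfolding transvection_minus[OF assms(10)] using W assms(10) by (simp add: M.minus_eq M.r_distr M.r_minus)
    have V_entry: "?V $$ (k, l) = W $$ (k, l) \<ominus> (if l = m then W $$ (k, i) \<otimes> c else \<zero>)" if "k < n" "l < n" for k l
      unfolding V using that W assms(2,3,10) True by simp
    have W_i: "W $$ (k, i) = (if k = i then \<one> else \<zero>)" if "k < n" for k
      using that assms(2,5) True by (simp add: W_entry minus_eq)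
    have "?V \<in> N"
    proof (rule column_matrix_mem_level[OF assms(4) _ aI f a(2,3)])
      show "?V $$ (m, m) = \<one> \<oplus> a"
        using assms(2,4,5,10) True \<sigma> f d by (simp add: V_entry W_i) (simp add: W_entry a_def minus_eq a_assoc)
      show "?V $$ (k, l) = (if k = l then \<one> else \<zero>)" if "k < n" "l < n" "l \<noteq> m" for k l
        using that by (simp add: V_entry) (simp add: W_entry minus_eq)
      show "?V $$ (k, m) \<in> I" if "k < n" "k \<noteq> m" for k
      proof (cases "k = i")
        case True': True
        have "?V $$ (k, m) = \<sigma> $$ (i, i) \<otimes> c \<otimes> \<tau> $$ (j, j) \<ominus> c"
          using that True True' assms(2,3,4,10) \<sigma> d
          by (simp add: V_entry W_i) (simp add: W_entry minus_eq d_def m_assoc)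
        then show ?thesis
          using diag[OF assms(10)] by simp
      next
        case False
        then have "\<sigma> $$ (k, i) \<in> I"
          using \<sigma>_off that assms(2) by auto
        then show ?thesis
          using that False assms(2,4,10) \<sigma> d
          by (simp add: V_entry W_i) (simp add: W_entry minus_eq I_r_closed)
      qed
    qed (use W assms(10) in simp)
    \<comment> \<open>Moving \<open>?t'\<close> to the left across \<open>\<one> \<oplus> Q\<close>,
      so that it meets \<open>W\<close>, replaces \<open>\<one> \<oplus> Q\<close> by its conjugate
      under \<open>?t\<close>, which stays in \<open>N\<close>.\<close>
    moreover have "?t \<otimes>\<^bsub>M\<^esub> (\<one>\<^bsub>M\<^esub> \<oplus>\<^bsub>M\<^esub> Q) \<otimes>\<^bsub>M\<^esub> ?t' \<in> N"
      using g(1) assms(2,3,5,10) by (intro N_conj_transvection) auto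
    ultimately have "(\<one>\<^bsub>M\<^esub> \<ominus>\<^bsub>M\<^esub> Q) \<otimes>\<^bsub>M\<^esub> (?V \<otimes>\<^bsub>M\<^esub> (?t \<otimes>\<^bsub>M\<^esub> (\<one>\<^bsub>M\<^esub> \<oplus>\<^bsub>M\<^esub> Q) \<otimes>\<^bsub>M\<^esub> ?t')) \<in> N"
      using g(2) N_mult by blast
    also have "(\<one>\<^bsub>M\<^esub> \<ominus>\<^bsub>M\<^esub> Q) \<otimes>\<^bsub>M\<^esub> (?V \<otimes>\<^bsub>M\<^esub> (?t \<otimes>\<^bsub>M\<^esub> (\<one>\<^bsub>M\<^esub> \<oplus>\<^bsub>M\<^esub> Q) \<otimes>\<^bsub>M\<^esub> ?t')) =
        (\<one>\<^bsub>M\<^esub> \<ominus>\<^bsub>M\<^esub> Q) \<otimes>\<^bsub>M\<^esub> W \<otimes>\<^bsub>M\<^esub> (?t' \<otimes>\<^bsub>M\<^esub> ?t) \<otimes>\<^bsub>M\<^esub> (\<one>\<^bsub>M\<^esub> \<oplus>\<^bsub>M\<^esub> Q) \<otimes>\<^bsub>M\<^esub> ?t'"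
      using Q W assms(10) by (simp add: M.m_assoc)
    also have "\<dots> = B \<otimes>\<^bsub>M\<^esub> ?t'"
      unfolding tt BW' using Q W by simp
    finally show ?thesis
      unfolding B_def .
  qed
qed

text \<open>The commutator of \<open>\<sigma>\<close> with a product \<open>t(z) t(z')\<close> is
  that with \<open>t(z)\<close> times the \<open>t(z)\<close>-conjugate of that with
  \<open>t(z')\<close>; hence the admissible coefficients are closed under addition. Row
  \<open>j\<close> of \<open>\<tau>\<close> times column \<open>j\<close> of \<open>\<sigma>\<close>
  is \<open>\<one>\<close>, so idempotents from the entries of that row suffice.\<close>

theorem congruence_commutator_mem:
  assumes exch: "right_exchange R" and "\<sigma> \<in> Units M" "i < n" "j < n" "i \<noteq> j"
    and \<tau>_def: "\<tau> = inv\<^bsub>M\<^esub> \<sigma>"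
    and \<sigma>_off: "\<And>k l. k < n \<Longrightarrow> l < n \<Longrightarrow> k \<noteq> l \<Longrightarrow> \<sigma> $$ (k, l) \<in> I"
    and \<tau>_off: "\<And>k l. k < n \<Longrightarrow> l < n \<Longrightarrow> k \<noteq> l \<Longrightarrow> \<tau> $$ (k, l) \<in> I"
    and diag: "\<And>y. y \<in> carrier R \<Longrightarrow> \<sigma> $$ (i, i) \<otimes> y \<otimes> \<tau> $$ (j, j) \<ominus> y \<in> I"
    and x: "x \<in> carrier R"
  shows "\<sigma> \<otimes>\<^bsub>M\<^esub> transvection n R i j x \<otimes>\<^bsub>M\<^esub> \<tau> \<otimes>\<^bsub>M\<^esub> transvection n R i j (\<ominus> x) \<in> N"
proof -
  have \<sigma>: "\<sigma> \<in> carrier M" "\<tau> \<in> carrier M" "\<sigma> \<otimes>\<^bsub>M\<^esub> \<tau> = \<one>\<^bsub>M\<^esub>" "\<tau> \<otimes>\<^bsub>M\<^esub> \<sigma> = \<one>\<^bsub>M\<^esub>"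
    using assms(2) M.Units_closed by (simp_all add: \<tau>_def)
  define B where "B z = \<sigma> \<otimes>\<^bsub>M\<^esub> transvection n R i j z \<otimes>\<^bsub>M\<^esub> \<tau>" for z
  define P where "P z \<longleftrightarrow> B z \<otimes>\<^bsub>M\<^esub> transvection n R i j (\<ominus> z) \<in> N" for z
  \<comment> \<open>Quantifying over all left multiples makes \<open>T\<close> a left ideal, as
    \<open>exchange_left_ideal\<close> requires; additivity of \<open>P\<close> does not give
    this.\<close>
  define T where "T = {z \<in> carrier R. \<forall>y\<in>carrier R. P (y \<otimes> z)}"
  have B: "B z \<in> carrier M" if "z \<in> carrier R" for z
    using that \<sigma> by (simp add: B_def)
  have B_add: "B (z \<oplus> z') = B z \<otimes>\<^bsub>M\<^esub> B z'" if "z \<in> carrier R" "z' \<in> carrier R" for z z'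
  proof -
    have "B z \<otimes>\<^bsub>M\<^esub> B z' = \<sigma> \<otimes>\<^bsub>M\<^esub> transvection n R i j z \<otimes>\<^bsub>M\<^esub> (\<tau> \<otimes>\<^bsub>M\<^esub> \<sigma>) \<otimes>\<^bsub>M\<^esub> transvection n R i j z' \<otimes>\<^bsub>M\<^esub> \<tau>"
      using that \<sigma>(1,2) by (simp add: B_def M.m_assoc)
    also have "\<dots> = \<sigma> \<otimes>\<^bsub>M\<^esub> (transvection n R i j z \<otimes>\<^bsub>M\<^esub> transvection n R i j z') \<otimes>\<^bsub>M\<^esub> \<tau>"
      unfolding \<sigma>(4) using that \<sigma>(1,2) by (simp add: M.m_assoc)
    finally show ?thesis
      using that assms(3-5) by (simp add: B_def transvection_add)
  qed
  have P_add: "P (z \<oplus> z')" if z: "z \<in> carrier R" "z' \<in> carrier R" "P z" "P z'" for z z'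
  proof -
    let ?t = "transvection n R i j"
    have "?t z \<otimes>\<^bsub>M\<^esub> (B z' \<otimes>\<^bsub>M\<^esub> ?t (\<ominus> z')) \<otimes>\<^bsub>M\<^esub> ?t (\<ominus> z) \<in> N"
      using z assms(3-5) by (intro N_conj_transvection) (auto simp: P_def)
    then have "(B z \<otimes>\<^bsub>M\<^esub> ?t (\<ominus> z)) \<otimes>\<^bsub>M\<^esub> (?t z \<otimes>\<^bsub>M\<^esub> (B z' \<otimes>\<^bsub>M\<^esub> ?t (\<ominus> z')) \<otimes>\<^bsub>M\<^esub> ?t (\<ominus> z)) \<in> N"
      using z(3) N_mult by (simp add: P_def)
    also have "(B z \<otimes>\<^bsub>M\<^esub> ?t (\<ominus> z)) \<otimes>\<^bsub>M\<^esub> (?t z \<otimes>\<^bsub>M\<^esub> (B z' \<otimes>\<^bsub>M\<^esub> ?t (\<ominus> z')) \<otimes>\<^bsub>M\<^esub> ?t (\<ominus> z)) =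
        B z \<otimes>\<^bsub>M\<^esub> (?t (\<ominus> z) \<otimes>\<^bsub>M\<^esub> ?t z) \<otimes>\<^bsub>M\<^esub> B z' \<otimes>\<^bsub>M\<^esub> (?t (\<ominus> z') \<otimes>\<^bsub>M\<^esub> ?t (\<ominus> z))"
      using z B by (simp add: M.m_assoc)
    also have "\<dots> = B (z \<oplus> z') \<otimes>\<^bsub>M\<^esub> ?t (\<ominus> (z \<oplus> z'))"
    proof -
      have "?t (\<ominus> z') \<otimes>\<^bsub>M\<^esub> ?t (\<ominus> z) = ?t (\<ominus> (z \<oplus> z'))"
        using z assms(3-5) by (simp add: transvection_add minus_add a_comm[of "\<ominus> z'"])
      then show ?thesis
        using z B assms(3-5) by (simp add: transvection_add l_neg B_add)
    qed
    finally show ?thesis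
      by (simp add: P_def)
  qed
  have "\<one> \<in> T"
  proof (rule exchange_left_ideal[OF exch, where S = "{..<n}" and v = "\<lambda>k. \<tau> $$ (j, k)" and w = "\<lambda>k. \<sigma> $$ (k, j)"])
    show "\<zero> \<in> T"
      using \<sigma> N_one by (auto simp: T_def P_def B_def)
    show "u \<oplus> v \<in> T" if "u \<in> T" "v \<in> T" for u v
      using that P_add by (auto simp: T_def r_distr)
    show "r \<otimes> u \<in> T" if "r \<in> carrier R" "u \<in> T" for r u
      using that by (auto simp: T_def m_assoc[symmetric])
    show "\<tau> $$ (j, k) \<otimes> r \<in> T"
      if k: "k \<in> {..<n}" "r \<in> carrier R" "(\<tau> $$ (j, k) \<otimes> r) \<otimes> (\<tau> $$ (j, k) \<otimes> r) = \<tau> $$ (j, k) \<otimes> r" for k r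
    proof -
      let ?v = "\<tau> $$ (j, k)"
      have v: "?v \<in> carrier R"
        using k assms(4) \<sigma> by simp
      \<comment> \<open>Replacing \<open>r\<close> by \<open>s = r \<otimes> e\<close> keeps the
        idempotent, \<open>?v \<otimes> s = e\<close>, and adds the relation
        \<open>s \<otimes> ?v \<otimes> s = s\<close>.\<close>
      define e s where "e = ?v \<otimes> r" and "s = r \<otimes> e"
      have e: "e \<in> carrier R" "e \<otimes> e = e" and s: "s \<in> carrier R"
        using k v by (simp_all add: e_def s_def)
      have vs: "?v \<otimes> s = e"
        using v k(2) e by (simp add: s_def m_assoc[symmetric]) (simp add: e_def[symmetric] e(2))
      have "P (y \<otimes> e)" if y: "y \<in> carrier R" for y
        unfolding P_def B_def
      proof (rule conj_idempotent_mem[OF assms(2-4) _ assms(5) \<tau>_def \<sigma>_off \<tau>_off diag])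
        show "y \<otimes> e \<otimes> ?v \<otimes> s = y \<otimes> e"
          using y e v s by (simp add: m_assoc vs)
        show "s \<otimes> ?v \<otimes> s = s"
          using v s e k(2) by (simp add: m_assoc vs) (simp add: s_def m_assoc e(2))
      qed (use k(1) y e(1) s in simp_all)
      then show ?thesis
        using e(1) by (simp add: T_def e_def)
    qed
    have "\<one> = (\<tau> \<otimes>\<^bsub>M\<^esub> \<sigma>) $$ (j, j)"
      using assms(4) by (simp add: \<sigma>(4))
    also have "\<dots> = (\<Oplus>k\<in>{..<n}. \<one> \<otimes> \<tau> $$ (j, k) \<otimes> \<sigma> $$ (k, j))"
      unfolding entry_mult[OF assms(4,4)] using assms(4) \<sigma>(1,2) by (intro finsum_cong') auto
    finally show "\<one> = (\<Oplus>k\<in>{..<n}. \<one> \<otimes> \<tau> $$ (j, k) \<otimes> \<sigma> $$ (k, j))" .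
    show "T \<subseteq> carrier R"
      by (simp add: T_def)
    show "(\<lambda>k. \<tau> $$ (j, k)) \<in> {..<n} \<rightarrow> carrier R" "(\<lambda>k. \<sigma> $$ (k, j)) \<in> {..<n} \<rightarrow> carrier R"
      using assms(4) \<sigma>(1,2) by simp_all
  qed simp_all
  then have "P (x \<otimes> \<one>)"
    using x by (simp add: T_def)
  then show ?thesis
    using x by (simp add: P_def B_def)
qed

end

section \<open>Reduction modulo an ideal\<close>

lemma quotient_zero: "\<zero>\<^bsub>R Quot I\<^esub> = I"
  by (simp add: FactRing_def)

lemma quotient_carrierE:
  assumes "X \<in> carrier (R Quot I)"
  obtains x where "x \<in> carrier R" "X = I +>\<^bsub>R\<^esub> x"
  using assms by (auto simp: FactRing_def A_RCOSETS_def')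

lemma right_exchange_quotient:
  fixes R (structure)
  assumes "ideal I R" "right_exchange R"
  shows "right_exchange (R Quot I)"
  unfolding right_exchange_def
proof
  interpret ideal I R by fact
  interpret h: ring_hom_ring R "R Quot I" "(+>) I"
    by (rule rcos_ring_hom_ring)
  fix X assume "X \<in> carrier (R Quot I)"
  then obtain x where x: "x \<in> carrier R" "X = I +> x"
    by (rule quotient_carrierE)
  obtain r s where rs: "r \<in> carrier R" "s \<in> carrier R" "(x \<otimes> r) \<otimes> (x \<otimes> r) = x \<otimes> r"
    "\<one> \<ominus> x \<otimes> r = (\<one> \<ominus> x) \<otimes> s"
    by (rule right_exchangeE[OF assms(2) x(1)])
  have "(X \<otimes>\<^bsub>R Quot I\<^esub> (I +> r)) \<otimes>\<^bsub>R Quot I\<^esub> (X \<otimes>\<^bsub>R Quot I\<^esub> (I +> r)) = X \<otimes>\<^bsub>R Quot I\<^esub> (I +> r)"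
    using arg_cong[OF rs(3), of "(+>) I"] x rs(1) by simp
  moreover have "\<one>\<^bsub>R Quot I\<^esub> \<ominus>\<^bsub>R Quot I\<^esub> X \<otimes>\<^bsub>R Quot I\<^esub> (I +> r) = (\<one>\<^bsub>R Quot I\<^esub> \<ominus>\<^bsub>R Quot I\<^esub> X) \<otimes>\<^bsub>R Quot I\<^esub> (I +> s)"
    using arg_cong[OF rs(4), of "(+>) I"] x rs(1,2) by (simp add: a_minus_def)
  ultimately show "\<exists>r\<in>carrier (R Quot I). \<exists>s\<in>carrier (R Quot I).
      X \<otimes>\<^bsub>R Quot I\<^esub> r \<otimes>\<^bsub>R Quot I\<^esub> (X \<otimes>\<^bsub>R Quot I\<^esub> r) = X \<otimes>\<^bsub>R Quot I\<^esub> r \<and>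
      \<one>\<^bsub>R Quot I\<^esub> \<ominus>\<^bsub>R Quot I\<^esub> X \<otimes>\<^bsub>R Quot I\<^esub> r = (\<one>\<^bsub>R Quot I\<^esub> \<ominus>\<^bsub>R Quot I\<^esub> X) \<otimes>\<^bsub>R Quot I\<^esub> s"
    using rs(1,2) h.hom_closed by blast
qed

section \<open>Ring homomorphisms applied entrywise\<close>

locale matrix_hom = ring_hom_ring R S h for R (structure) and S (structure) and h + fixes n :: nat
begin

sublocale D: matrix_ring_over R n ..
sublocale C: matrix_ring_over S n ..

lemma hom_sum: "finite A \<Longrightarrow> f \<in> A \<rightarrow> carrier R \<Longrightarrow> h (finsum R f A) = (\<Oplus>\<^bsub>S\<^esub>k\<in>A. h (f k))"
  by (induction A rule: finite_induct) (auto simp: Pi_def)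

lemma map_mat_closed: "A \<in> carrier D.M \<Longrightarrow> map_mat h A \<in> carrier C.M"
  by (simp add: D.mat_carrier_iff C.mat_carrier_iff)

lemma map_mat_entry: "A \<in> carrier D.M \<Longrightarrow> i < n \<Longrightarrow> j < n \<Longrightarrow> map_mat h A $$ (i, j) = h (A $$ (i, j))"
  by (simp add: D.mat_carrier_iff)

lemma map_mat_mult:
  assumes "A \<in> carrier D.M" "B \<in> carrier D.M"
  shows "map_mat h (A \<otimes>\<^bsub>D.M\<^esub> B) = map_mat h A \<otimes>\<^bsub>C.M\<^esub> map_mat h B"
proof (rule C.mat_eqI)
  fix i j assume ij: "i < n" "j < n"
  have "map_mat h (A \<otimes>\<^bsub>D.M\<^esub> B) $$ (i, j) = h (\<Oplus>k\<in>{..<n}. A $$ (i, k) \<otimes> B $$ (k, j))"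
    using ij by (simp add: map_mat_entry assms D.entry_mult)
  also have "\<dots> = (\<Oplus>\<^bsub>S\<^esub>k\<in>{..<n}. h (A $$ (i, k) \<otimes> B $$ (k, j)))"
    using ij assms by (intro hom_sum) auto
  also have "\<dots> = (map_mat h A \<otimes>\<^bsub>C.M\<^esub> map_mat h B) $$ (i, j)"
    unfolding C.entry_mult[OF ij] using ij assms by (intro S.finsum_cong') (auto simp: map_mat_entry)
  finally show "map_mat h (A \<otimes>\<^bsub>D.M\<^esub> B) $$ (i, j) = (map_mat h A \<otimes>\<^bsub>C.M\<^esub> map_mat h B) $$ (i, j)" .
qed (use assms map_mat_closed in auto)

lemma map_mat_one: "map_mat h \<one>\<^bsub>D.M\<^esub> = \<one>\<^bsub>C.M\<^esub>"
  by (rule C.mat_eqI) (auto simp: map_mat_entry map_mat_closed)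

lemma map_mat_transvection:
  assumes "x \<in> carrier R"
  shows "map_mat h (transvection n R i j x) = transvection n S i j (h x)"
  using assms D.transvection_closed[OF assms, of i j] map_mat_closed[OF D.transvection_closed[OF assms, of i j]]
    C.transvection_closed[OF hom_closed[OF assms], of i j]
  by (intro C.mat_eqI) (auto simp: map_mat_entry, auto simp: D.transvection_eq C.transvection_eq)

lemma map_mat_Units:
  assumes "A \<in> Units D.M"
  shows "map_mat h A \<in> Units C.M" "map_mat h (inv\<^bsub>D.M\<^esub> A) = inv\<^bsub>C.M\<^esub> (map_mat h A)"
proof -
  have A: "A \<in> carrier D.M" "inv\<^bsub>D.M\<^esub> A \<in> carrier D.M"
    using assms D.M.Units_closed by auto
  have eq: "map_mat h A \<otimes>\<^bsub>C.M\<^esub> map_mat h (inv\<^bsub>D.M\<^esub> A) = \<one>\<^bsub>C.M\<^esub>"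
    "map_mat h (inv\<^bsub>D.M\<^esub> A) \<otimes>\<^bsub>C.M\<^esub> map_mat h A = \<one>\<^bsub>C.M\<^esub>"
    using A assms by (simp_all add: map_mat_mult[symmetric] map_mat_one)
  show "map_mat h A \<in> Units C.M"
    using A eq map_mat_closed unfolding Units_def by blast
  show "map_mat h (inv\<^bsub>D.M\<^esub> A) = inv\<^bsub>C.M\<^esub> (map_mat h A)"
    using A eq map_mat_closed by (intro C.M.inv_char[symmetric]) auto
qed

end

section \<open>Centre, full congruence subgroup and relative elementary subgroup in terms of entries
  and generators\<close>

context matrix_ring_over
begin

lemma Units_cancel: "X \<in> Units M \<Longrightarrow> Z \<in> carrier M \<Longrightarrow> inv\<^bsub>M\<^esub> X \<otimes>\<^bsub>M\<^esub> (X \<otimes>\<^bsub>M\<^esub> Z) = Z"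
  by (simp add: M.m_assoc[symmetric] M.Units_closed)

text \<open>Commuting with a transvection is commuting with its matrix unit. Comparing the
  \<open>(k, k)\<close> entries gives the zeros off the diagonal, comparing the
  \<open>(i, j)\<close> entries the relation on the diagonal.\<close>

lemma center_entries:
  assumes "z \<in> group_center (GL n R)"
  shows "z \<in> Units M"
    and "\<And>k l. k < n \<Longrightarrow> l < n \<Longrightarrow> k \<noteq> l \<Longrightarrow> z $$ (k, l) = \<zero>"
    and "\<And>i j x. i < n \<Longrightarrow> j < n \<Longrightarrow> i \<noteq> j \<Longrightarrow> x \<in> carrier R \<Longrightarrow> z $$ (i, i) \<otimes> x = x \<otimes> z $$ (j, j)"
proof -
  show zU: "z \<in> Units M"
    using assms by (simp add: group_center_def)
  have z: "z \<in> carrier M"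
    using zU by (rule M.Units_closed)
  have comm: "z \<otimes>\<^bsub>M\<^esub> E i j x = E i j x \<otimes>\<^bsub>M\<^esub> z" if "i < n" "j < n" "i \<noteq> j" "x \<in> carrier R" for i j x
  proof -
    have "z \<otimes>\<^bsub>M\<^esub> transvection n R i j x = transvection n R i j x \<otimes>\<^bsub>M\<^esub> z"
      using assms transvection_Units[of i j x] that by (simp add: group_center_def)
    then have "z \<oplus>\<^bsub>M\<^esub> z \<otimes>\<^bsub>M\<^esub> E i j x = z \<oplus>\<^bsub>M\<^esub> E i j x \<otimes>\<^bsub>M\<^esub> z"
      using z that by (simp add: transvection_eq M.l_distr M.r_distr)
    then show ?thesis
      using z that by - (rule M.add_left_imp_eq[of z], simp_all)
  qed
  show "z $$ (k, l) = \<zero>" if "k < n" "l < n" "k \<noteq> l" for k l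
    using arg_cong[OF comm[of l k \<one>], of "\<lambda>A. A $$ (k, k)"] that z by simp
  show "z $$ (i, i) \<otimes> x = x \<otimes> z $$ (j, j)" if "i < n" "j < n" "i \<noteq> j" "x \<in> carrier R" for i j x
    using arg_cong[OF comm[OF that], of "\<lambda>A. A $$ (i, j)"] that z by simp
qed

lemma center_inv:
  assumes "z \<in> group_center (GL n R)"
  shows "inv\<^bsub>M\<^esub> z \<in> group_center (GL n R)"
proof -
  have z: "z \<in> Units M" "z \<in> carrier M" "inv\<^bsub>M\<^esub> z \<in> carrier M"
    using center_entries(1)[OF assms] M.Units_closed by auto
  have "inv\<^bsub>M\<^esub> z \<otimes>\<^bsub>M\<^esub> g = g \<otimes>\<^bsub>M\<^esub> inv\<^bsub>M\<^esub> z" if g: "g \<in> Units M" for g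
  proof -
    have g': "g \<in> carrier M"
      using g by (rule M.Units_closed)
    have zg: "z \<otimes>\<^bsub>M\<^esub> g = g \<otimes>\<^bsub>M\<^esub> z"
      using assms g by (simp add: group_center_def)
    have "inv\<^bsub>M\<^esub> z \<otimes>\<^bsub>M\<^esub> g = inv\<^bsub>M\<^esub> z \<otimes>\<^bsub>M\<^esub> (g \<otimes>\<^bsub>M\<^esub> z) \<otimes>\<^bsub>M\<^esub> inv\<^bsub>M\<^esub> z"
      using z g' by (simp add: M.m_assoc)
    also have "\<dots> = (inv\<^bsub>M\<^esub> z \<otimes>\<^bsub>M\<^esub> z) \<otimes>\<^bsub>M\<^esub> g \<otimes>\<^bsub>M\<^esub> inv\<^bsub>M\<^esub> z"
      unfolding zg[symmetric] using z(2,3) g' by (simp add: M.m_assoc)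
    finally show ?thesis
      using z g' by simp
  qed
  then show ?thesis
    using z by (simp add: group_center_def)
qed

text \<open>Provides the entrywise hypotheses of \<open>congruence_commutator_mem\<close>. For the
  last one, modulo \<open>I\<close> the diagonal entry can be moved across \<open>y\<close>, where
  it meets its inverse.\<close>

lemma full_congruence_entries:
  assumes "ideal I R" "\<sigma> \<in> full_congruence n R I"
  shows "\<sigma> \<in> Units M"
    and "\<And>k l. k < n \<Longrightarrow> l < n \<Longrightarrow> k \<noteq> l \<Longrightarrow> \<sigma> $$ (k, l) \<in> I"
    and "\<And>k l. k < n \<Longrightarrow> l < n \<Longrightarrow> k \<noteq> l \<Longrightarrow> (inv\<^bsub>M\<^esub> \<sigma>) $$ (k, l) \<in> I"
    and "\<And>i j y. i < n \<Longrightarrow> j < n \<Longrightarrow> i \<noteq> j \<Longrightarrow> y \<in> carrier R \<Longrightarrow>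
      \<sigma> $$ (i, i) \<otimes> y \<otimes> (inv\<^bsub>M\<^esub> \<sigma>) $$ (j, j) \<ominus> y \<in> I"
proof -
  interpret ideal I R by fact
  interpret h: ring_hom_ring R "R Quot I" "(+>) I"
    by (rule rcos_ring_hom_ring)
  interpret h: matrix_hom R "R Quot I" "(+>) I" n ..
  show \<sigma>: "\<sigma> \<in> Units M"
    using assms(2) by (simp add: full_congruence_def)
  have \<sigma>c: "\<sigma> \<in> carrier M" "inv\<^bsub>M\<^esub> \<sigma> \<in> carrier M"
    using \<sigma> M.Units_closed by auto
  let ?z = "map_mat ((+>) I) \<sigma>" and ?w = "map_mat ((+>) I) (inv\<^bsub>M\<^esub> \<sigma>)"
  have z: "?z \<in> group_center (GL n (R Quot I))"
    using assms(2) by (simp add: full_congruence_def)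
  have w: "?w \<in> group_center (GL n (R Quot I))"
    using h.C.center_inv[OF z] by (simp add: h.map_mat_Units[OF \<sigma>])
  have zero: "x \<in> I" if "x \<in> carrier R" "I +> x = \<zero>\<^bsub>R Quot I\<^esub>" for x
    using that by (intro rcos_const_imp_mem) (simp_all add: quotient_zero)
  show "\<sigma> $$ (k, l) \<in> I" if "k < n" "l < n" "k \<noteq> l" for k l
    using h.C.center_entries(2)[OF z that] that \<sigma>c by (intro zero) (auto simp: h.map_mat_entry)
  show "(inv\<^bsub>M\<^esub> \<sigma>) $$ (k, l) \<in> I" if "k < n" "l < n" "k \<noteq> l" for k l
    using h.C.center_entries(2)[OF w that] that \<sigma>c by (intro zero) (auto simp: h.map_mat_entry)
  fix i j y assume ij: "i < n" "j < n" "i \<noteq> j" "y \<in> carrier R"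
  have zw: "?z \<in> carrier h.C.M" "?w \<in> carrier h.C.M"
    using \<sigma>c h.map_mat_closed by auto
  \<comment> \<open>Row \<open>j\<close> of \<open>?z\<close> has only its diagonal entry, so
    multiplying by \<open>?w\<close> shows that the \<open>j\<close>-th diagonal entries of
    \<open>?z\<close> and \<open>?w\<close> multiply to one.\<close>
  have "h.C.E j j \<one>\<^bsub>R Quot I\<^esub> \<otimes>\<^bsub>h.C.M\<^esub> ?z = h.C.E j j (?z $$ (j, j))"
    using ij zw h.C.center_entries(2)[OF z, of j] by (intro h.C.mat_eqI) auto
  then have "h.C.E j j \<one>\<^bsub>R Quot I\<^esub> \<otimes>\<^bsub>h.C.M\<^esub> (?z \<otimes>\<^bsub>h.C.M\<^esub> ?w) = h.C.E j j (?z $$ (j, j)) \<otimes>\<^bsub>h.C.M\<^esub> ?w"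
    using ij zw by (simp add: h.C.M.m_assoc[symmetric])
  moreover have "?z \<otimes>\<^bsub>h.C.M\<^esub> ?w = \<one>\<^bsub>h.C.M\<^esub>"
    using \<sigma> \<sigma>c by (simp add: h.map_mat_mult[symmetric] h.map_mat_one)
  ultimately have "h.C.E j j \<one>\<^bsub>R Quot I\<^esub> = h.C.E j j (?z $$ (j, j)) \<otimes>\<^bsub>h.C.M\<^esub> ?w"
    by simp
  then have "h.C.E j j \<one>\<^bsub>R Quot I\<^esub> $$ (j, j) = (h.C.E j j (?z $$ (j, j)) \<otimes>\<^bsub>h.C.M\<^esub> ?w) $$ (j, j)"
    by simp
  then have one: "?z $$ (j, j) \<otimes>\<^bsub>R Quot I\<^esub> ?w $$ (j, j) = \<one>\<^bsub>R Quot I\<^esub>"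
    using ij zw by simp
  have "I +> (\<sigma> $$ (i, i) \<otimes> y \<otimes> (inv\<^bsub>M\<^esub> \<sigma>) $$ (j, j)) =
      ?z $$ (i, i) \<otimes>\<^bsub>R Quot I\<^esub> (I +> y) \<otimes>\<^bsub>R Quot I\<^esub> ?w $$ (j, j)"
    using ij \<sigma>c by (simp add: h.map_mat_entry)
  also have "\<dots> = (I +> y) \<otimes>\<^bsub>R Quot I\<^esub> (?z $$ (j, j) \<otimes>\<^bsub>R Quot I\<^esub> ?w $$ (j, j))"
    using ij zw h.C.center_entries(3)[OF z ij(1-3), of "I +> y"] by (simp add: h.S.m_assoc)
  also have "\<dots> = I +> y"
    unfolding one using ij by simp
  finally have "I +> (\<sigma> $$ (i, i) \<otimes> y \<otimes> (inv\<^bsub>M\<^esub> \<sigma>) $$ (j, j) \<ominus> y) = \<zero>\<^bsub>R Quot I\<^esub>"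
    using ij \<sigma>c by (simp add: a_minus_def h.S.r_neg)
  then show "\<sigma> $$ (i, i) \<otimes> y \<otimes> (inv\<^bsub>M\<^esub> \<sigma>) $$ (j, j) \<ominus> y \<in> I"
    using ij \<sigma>c by (intro zero) auto
qed

lemma relative_elementary_level:
  assumes "ideal I R" "n \<ge> 3"
  shows "level_subgroup R n I (relative_elementary n R I)"
proof -
  interpret ideal I R by fact
  interpret GL: group "GL n R"
    by (rule GL_group)
  let ?EL = "elementary_subgroup n R"
  let ?G = "(GL n R)\<lparr>carrier := ?EL\<rparr>" and ?S = "elementary_on n R I"
  interpret GE: group ?G
    by (rule GL.subgroup_imp_group[OF elementary_subgroup_subgroup])
  let ?F = "{N. N \<lhd> ?G \<and> ?S \<subseteq> N}"
  have rel: "relative_elementary n R I = \<Inter> ?F"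
    by (simp add: relative_elementary_def normal_closure_def)
  have S_EL: "?S \<subseteq> ?EL"
    unfolding elementary_subgroup_def elementary_on_def using a_subset by (intro GL.mono_generate) auto
  \<comment> \<open>An intersection over an empty family would be the whole type; the elementary
    subgroup is itself a member and bounds it.\<close>
  have "?EL \<in> ?F"
    using GE.normal_self S_EL by simp
  then have sub: "relative_elementary n R I \<subseteq> ?EL"
    unfolding rel by blast
  have normal: "g \<otimes>\<^bsub>M\<^esub> h \<in> N" "k \<in> ?EL \<Longrightarrow> k \<otimes>\<^bsub>M\<^esub> g \<otimes>\<^bsub>M\<^esub> inv\<^bsub>M\<^esub> k \<in> N"
    if N: "N \<in> ?F" and gh: "g \<in> N" "h \<in> N" for N g h k
  proof -
    have sg: "subgroup N ?G" and *: "\<And>x h. x \<in> ?EL \<Longrightarrow> h \<in> N \<Longrightarrow> x \<otimes>\<^bsub>?G\<^esub> h \<otimes>\<^bsub>?G\<^esub> inv\<^bsub>?G\<^esub> x \<in> N"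
      using N GE.normal_invE[of N] by simp_all
    show "g \<otimes>\<^bsub>M\<^esub> h \<in> N"
      using subgroup.m_closed[OF sg gh] by simp
    show "k \<otimes>\<^bsub>M\<^esub> g \<otimes>\<^bsub>M\<^esub> inv\<^bsub>M\<^esub> k \<in> N" if k: "k \<in> ?EL"
      using *[OF k gh(1)] GL.m_inv_consistent[OF elementary_subgroup_subgroup k] elementary_Units[OF k] by simp
  qed
  show ?thesis
  proof unfold_locales
    show "relative_elementary n R I \<subseteq> Units M"
      using sub elementary_Units by blast
    show "g \<otimes>\<^bsub>M\<^esub> h \<in> relative_elementary n R I"
      if "g \<in> relative_elementary n R I" "h \<in> relative_elementary n R I" for g h
    proof -
      have "g \<otimes>\<^bsub>M\<^esub> h \<in> N" if "N \<in> ?F" for N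
        using normal(1)[OF that, of g h] that \<open>g \<in> _\<close> \<open>h \<in> _\<close> unfolding rel by blast
      then show ?thesis
        unfolding rel by blast
    qed
    show "g \<otimes>\<^bsub>M\<^esub> h \<otimes>\<^bsub>M\<^esub> inv\<^bsub>M\<^esub> g \<in> relative_elementary n R I"
      if "g \<in> ?EL" "h \<in> relative_elementary n R I" for g h
    proof -
      have "g \<otimes>\<^bsub>M\<^esub> h \<otimes>\<^bsub>M\<^esub> inv\<^bsub>M\<^esub> g \<in> N" if "N \<in> ?F" for N
        using normal(2)[OF that, of h h g] that \<open>g \<in> _\<close> \<open>h \<in> _\<close> unfolding rel by blast
      then show ?thesis
        unfolding rel by blast
    qed
    show "transvection n R i j x \<in> relative_elementary n R I" if "i < n" "j < n" "i \<noteq> j" "x \<in> I" for i j x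
    proof -
      have "transvection n R i j x \<in> ?S"
        unfolding elementary_on_def using that by (intro generate.incl) auto
      then show ?thesis
        unfolding rel by blast
    qed
  qed (rule assms(2))
qed

text \<open>Conjugation by a product is iterated conjugation, and transvections are closed under
  inversion, so testing the generators is enough. The sign of \<open>x\<close> absorbs the
  difference between the two sides on which the inverse stands.\<close>

lemma normalised_by_elementary_iff:
  assumes "subgroup H (GL n R)"
  shows "normalised_by (GL n R) H (elementary_subgroup n R) \<longleftrightarrow>
    (\<forall>i j x h. i < n \<longrightarrow> j < n \<longrightarrow> i \<noteq> j \<longrightarrow> x \<in> carrier R \<longrightarrow> h \<in> H \<longrightarrow>
      transvection n R i j x \<otimes>\<^bsub>M\<^esub> h \<otimes>\<^bsub>M\<^esub> transvection n R i j (\<ominus> x) \<in> H)" (is "?L \<longleftrightarrow> ?C")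
proof
  assume L: ?L
  show ?C
  proof (intro allI impI)
    fix i j x h assume *: "i < n" "j < n" "i \<noteq> j" "x \<in> carrier R" "h \<in> H"
    then have t: "transvection n R i j (\<ominus> x) \<in> elementary_subgroup n R"
      by (intro transvection_elementary) auto
    then show "transvection n R i j x \<otimes>\<^bsub>M\<^esub> h \<otimes>\<^bsub>M\<^esub> transvection n R i j (\<ominus> x) \<in> H"
      using L[unfolded normalised_by_def, rule_format, OF *(5) t] *(1-4) elementary_Units[OF t]
      by (simp add: transvection_inv)
  qed
next
  assume C: ?C
  have HU: "H \<subseteq> Units M"
    using subgroup.subset[OF assms] by simp
  have "\<forall>h\<in>H. inv\<^bsub>M\<^esub> g \<otimes>\<^bsub>M\<^esub> h \<otimes>\<^bsub>M\<^esub> g \<in> H" if "g \<in> elementary_subgroup n R" for g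
    using that unfolding elementary_subgroup_def elementary_on_def
  proof (induction g rule: generate.induct)
    case one
    then show ?case
    proof
      fix h assume "h \<in> H"
      then have "h \<in> carrier M"
        using HU M.Units_closed by blast
      then show "inv\<^bsub>M\<^esub> \<one>\<^bsub>GL n R\<^esub> \<otimes>\<^bsub>M\<^esub> h \<otimes>\<^bsub>M\<^esub> \<one>\<^bsub>GL n R\<^esub> \<in> H"
        using \<open>h \<in> H\<close> by simp
    qed
  next
    case (incl g)
    then obtain i j x where g: "g = transvection n R i j x" "i < n" "j < n" "i \<noteq> j" "x \<in> carrier R"
      by auto
    then show ?case
      using C[rule_format, of i j "\<ominus> x"] by (simp add: transvection_inv)
  next
    case (inv g)
    then obtain i j x where g: "g = transvection n R i j x" "i < n" "j < n" "i \<noteq> j" "x \<in> carrier R"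
      by auto
    then show ?case
      using C[rule_format, of i j x] transvection_Units[of i j x] by (simp add: transvection_inv)
  next
    case (eng g1 g2)
    have g: "g1 \<in> Units M" "g2 \<in> Units M"
      using eng.hyps elementary_Units unfolding elementary_subgroup_def elementary_on_def by auto
    show ?case
    proof
      fix h assume h: "h \<in> H"
      then have "inv\<^bsub>M\<^esub> g2 \<otimes>\<^bsub>M\<^esub> (inv\<^bsub>M\<^esub> g1 \<otimes>\<^bsub>M\<^esub> h \<otimes>\<^bsub>M\<^esub> g1) \<otimes>\<^bsub>M\<^esub> g2 \<in> H"
        using eng.IH by blast
      moreover have "h \<in> carrier M" "g1 \<in> carrier M" "g2 \<in> carrier M"
        using h HU g M.Units_closed by auto
      moreover have "inv\<^bsub>M\<^esub> (g1 \<otimes>\<^bsub>M\<^esub> g2) = inv\<^bsub>M\<^esub> g2 \<otimes>\<^bsub>M\<^esub> inv\<^bsub>M\<^esub> g1"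
        using group.inv_mult_group[OF GL_group, of g1 g2] g by simp
      ultimately show "inv\<^bsub>M\<^esub> (g1 \<otimes>\<^bsub>GL n R\<^esub> g2) \<otimes>\<^bsub>M\<^esub> h \<otimes>\<^bsub>M\<^esub> (g1 \<otimes>\<^bsub>GL n R\<^esub> g2) \<in> H"
        using g by (simp add: M.m_assoc)
    qed
  qed
  then show ?L
    unfolding normalised_by_def using elementary_Units by simp
qed

end

section \<open>The level of a normalised subgroup\<close>

text \<open>The level of \<open>H\<close> is read off from the transvections in \<open>H\<close>. Transvections in the image
  of \<open>H\<close> modulo the level lift to \<open>H\<close> by \<open>congruence_commutator_mem\<close>, so this image contains none.\<close>

locale elementary_normalised = matrix_ring_over R n for R (structure) and n +
  fixes H
  assumes n3: "n \<ge> 3"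
    and exch: "right_exchange R"
    and H: "subgroup H (GL n R)"
    and H_conj: "\<And>i j x h. i < n \<Longrightarrow> j < n \<Longrightarrow> i \<noteq> j \<Longrightarrow> x \<in> carrier R \<Longrightarrow> h \<in> H \<Longrightarrow>
      transvection n R i j x \<otimes>\<^bsub>M\<^esub> h \<otimes>\<^bsub>M\<^esub> transvection n R i j (\<ominus> x) \<in> H"
begin

definition level :: "'a set" where
  "level = {x \<in> carrier R. \<forall>i j. i < n \<longrightarrow> j < n \<longrightarrow> i \<noteq> j \<longrightarrow> transvection n R i j x \<in> H}"

lemma H_Units: "H \<subseteq> Units M"
  using subgroup.subset[OF H] by simp

lemma H_mult: "g \<in> H \<Longrightarrow> h \<in> H \<Longrightarrow> g \<otimes>\<^bsub>M\<^esub> h \<in> H"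
  using subgroup.m_closed[OF H, of g h] by simp

lemma H_inv: "g \<in> H \<Longrightarrow> inv\<^bsub>M\<^esub> g \<in> H"
  using subgroup.m_inv_closed[OF H, of g] H_Units by auto

lemma H_one: "\<one>\<^bsub>M\<^esub> \<in> H"
  using subgroup.one_closed[OF H] by simp

section \<open>The ideal of transvection coefficients\<close>

lemma transvection_mult_right:
  assumes "i < n" "k < n" "l < n" "i \<noteq> k" "k \<noteq> l" "i \<noteq> l" "x \<in> carrier R" "r \<in> carrier R"
    and "transvection n R i k x \<in> H"
  shows "transvection n R i l (x \<otimes> r) \<in> H"
proof -
  have "transvection n R i k (\<ominus> x) \<in> H"
    using H_inv[OF assms(9)] assms by (simp add: transvection_inv)
  then have "transvection n R k l r \<otimes>\<^bsub>M\<^esub> transvection n R i k (\<ominus> x) \<otimes>\<^bsub>M\<^esub> transvection n R k l (\<ominus> r) \<in> H"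
    using assms by (intro H_conj) auto
  then have "transvection n R i k x \<otimes>\<^bsub>M\<^esub> (transvection n R k l r \<otimes>\<^bsub>M\<^esub> transvection n R i k (\<ominus> x) \<otimes>\<^bsub>M\<^esub>
      transvection n R k l (\<ominus> r)) \<in> H"
    by (rule H_mult[OF assms(9)])
  then show ?thesis
    using transvection_commutator[of i k l x r] assms by (simp add: M.m_assoc)
qed

lemma transvection_mult_left:
  assumes "i < n" "k < n" "l < n" "i \<noteq> k" "k \<noteq> l" "i \<noteq> l" "x \<in> carrier R" "r \<in> carrier R"
    and "transvection n R i k x \<in> H"
  shows "transvection n R l k (r \<otimes> x) \<in> H"
proof -
  have "transvection n R i k (\<ominus> x) \<in> H"
    using H_inv[OF assms(9)] assms by (simp add: transvection_inv)
  moreover have "transvection n R l i r \<otimes>\<^bsub>M\<^esub> transvection n R i k x \<otimes>\<^bsub>M\<^esub> transvection n R l i (\<ominus> r) \<in> H"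
    using assms by (intro H_conj) auto
  ultimately have "transvection n R l i r \<otimes>\<^bsub>M\<^esub> transvection n R i k x \<otimes>\<^bsub>M\<^esub> transvection n R l i (\<ominus> r) \<otimes>\<^bsub>M\<^esub>
      transvection n R i k (\<ominus> x) \<in> H"
    by - (rule H_mult)
  then show ?thesis
    using transvection_commutator[of l i k r x] assms by simp
qed

text \<open>Commutators with \<open>transvection n R k l \<one>\<close> and its transposed analogue
  move a transvection along its row and its column. If the target column is the source row, the
  direct route would pass through a diagonal position, and a third column is used as a
  detour.\<close>

lemma mem_level:
  assumes "i < n" "k < n" "i \<noteq> k" "x \<in> carrier R" "transvection n R i k x \<in> H"
  shows "x \<in> level"
proof -
  have col: "transvection n R i l x \<in> H" if "i < n" "k < n" "l < n" "i \<noteq> k" "i \<noteq> l" "transvection n R i k x \<in> H" for i k l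
    using that transvection_mult_right[of i k l x \<one>] assms(4) by (cases "l = k") auto
  have row: "transvection n R l k x \<in> H" if "i < n" "k < n" "l < n" "i \<noteq> k" "l \<noteq> k" "transvection n R i k x \<in> H" for i k l
    using that transvection_mult_left[of i k l x \<one>] assms(4) by (cases "l = i") auto
  have "transvection n R p q x \<in> H" if pq: "p < n" "q < n" "p \<noteq> q" for p q
  proof (cases "q = i")
    case False
    then show ?thesis
      using col[of i k q] row[of i q p] pq assms by auto
  next
    case True
    obtain l where l: "l < n" "l \<noteq> i" "l \<noteq> p"
      using ex_third_index[OF n3] by blast
    have "transvection n R i l x \<in> H"
      using col[of i k l] l assms by auto
    then have "transvection n R p l x \<in> H"
      using row[of i l p] l pq assms by auto
    then show ?thesis
      using col[of p l q] l pq by auto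
  qed
  then show ?thesis
    using assms(4) by (simp add: level_def)
qed

lemma level_ideal: "ideal level R"
proof (rule idealI)
  show "ring R"
    by (rule ring_axioms)
  show "subgroup level (add_monoid R)"
  proof (rule add.subgroupI)
    show "level \<noteq> {}"
      using H_one by (auto simp: level_def)
    show "\<ominus> x \<in> level" if x: "x \<in> level" for x
    proof -
      have "transvection n R i j (\<ominus> x) \<in> H" if "i < n" "j < n" "i \<noteq> j" for i j
        using x that H_inv[of "transvection n R i j x"] by (simp add: level_def transvection_inv)
      then show ?thesis
        using x by (simp add: level_def)
    qed
    show "x \<oplus> y \<in> level" if xy: "x \<in> level" "y \<in> level" for x y
    proof -
      have "transvection n R i j (x \<oplus> y) \<in> H" if "i < n" "j < n" "i \<noteq> j" for i j
        using xy that H_mult[of "transvection n R i j x" "transvection n R i j y"]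
        by (simp add: level_def transvection_add)
      then show ?thesis
        using xy by (simp add: level_def)
    qed
  qed (auto simp: level_def)
  fix x r assume x: "x \<in> level" and r: "r \<in> carrier R"
  have t: "transvection n R i j x \<in> H" if "i < n" "j < n" "i \<noteq> j" for i j
    using x that by (simp add: level_def)
  have xc: "x \<in> carrier R"
    using x by (simp add: level_def)
  \<comment> \<open>By \<open>mem_level\<close> one position is enough; starting from
    \<open>(0, 1)\<close>, the left multiple appears at \<open>(2, 1)\<close> and the right multiple
    at \<open>(0, 2)\<close>.\<close>
  show "r \<otimes> x \<in> level" "x \<otimes> r \<in> level"
    using t[of 0 1] transvection_mult_left[of 0 1 2 x r] transvection_mult_right[of 0 1 2 x r]
      mem_level[of 2 1 "r \<otimes> x"] mem_level[of 0 2 "x \<otimes> r"] n3 xc r by simp_all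
qed

text \<open>The normal closure is formed inside the elementary subgroup, so the candidate that
  competes in the intersection is \<open>H \<inter> ?EL\<close> and not \<open>H\<close>.\<close>

lemma relative_elementary_subset: "relative_elementary n R level \<subseteq> H"
proof -
  interpret GL: group "GL n R"
    by (rule GL_group)
  let ?EL = "elementary_subgroup n R"
  let ?G = "(GL n R)\<lparr>carrier := ?EL\<rparr>"
  interpret GE: group ?G
    by (rule GL.subgroup_imp_group[OF elementary_subgroup_subgroup])
  have norm: "normalised_by (GL n R) H ?EL"
    using H_conj by (simp add: normalised_by_elementary_iff[OF H])
  have HE: "subgroup (H \<inter> ?EL) (GL n R)"
    using H elementary_subgroup_subgroup by (rule GL.subgroups_Inter_pair)
  have "H \<inter> ?EL \<lhd> ?G"
  proof (rule GE.normal_invI)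
    show "subgroup (H \<inter> ?EL) ?G"
      using HE elementary_subgroup_subgroup by (rule GL.subgroup_incl) simp
    fix g h assume "g \<in> carrier ?G" "h \<in> H \<inter> ?EL"
    then have g: "g \<in> ?EL" and h: "h \<in> H" "h \<in> ?EL"
      by simp_all
    have gi: "inv\<^bsub>?G\<^esub> g = inv\<^bsub>M\<^esub> g"
      using GL.m_inv_consistent[OF elementary_subgroup_subgroup g] elementary_Units[OF g] by simp
    have "g \<otimes>\<^bsub>M\<^esub> h \<otimes>\<^bsub>M\<^esub> inv\<^bsub>M\<^esub> g \<in> H"
      using norm[unfolded normalised_by_def, rule_format, OF h(1) elementary_inv[OF g]]
        elementary_Units[OF g] by simp
    then show "g \<otimes>\<^bsub>?G\<^esub> h \<otimes>\<^bsub>?G\<^esub> inv\<^bsub>?G\<^esub> g \<in> H \<inter> ?EL"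
      unfolding gi using g h by (simp add: elementary_mult elementary_inv)
  qed
  moreover have "elementary_on n R level \<subseteq> H \<inter> ?EL"
    unfolding elementary_on_def
  proof (rule GL.generate_subgroup_incl[OF _ HE])
    show "{transvection n R i j x | i j x. i < n \<and> j < n \<and> i \<noteq> j \<and> x \<in> level} \<subseteq> H \<inter> ?EL"
      using transvection_elementary by (auto simp: level_def)
  qed
  ultimately show ?thesis
    unfolding relative_elementary_def normal_closure_def by blast
qed

text \<open>The work lies in showing that the image of \<open>H\<close> contains no nontrivial
  transvection. A preimage \<open>A\<close> of one equals \<open>?t \<otimes> ?c\<close> with
  \<open>?c\<close> congruent to the identity, and commutators with \<open>?s\<close> make the
  contribution of \<open>?c\<close> visible inside \<open>H\<close>.\<close>

lemma subset_full_congruence: "H \<subseteq> full_congruence n R level"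
proof -
  interpret I: ideal level R
    by (rule level_ideal)
  let ?Q = "R Quot level"
  interpret h: ring_hom_ring R ?Q "(+>) level"
    by (rule I.rcos_ring_hom_ring)
  interpret h: matrix_hom R ?Q "(+>) level" n ..
  let ?h = "map_mat ((+>) level)"
  interpret N: level_subgroup R n level "relative_elementary n R level"
    by (rule relative_elementary_level[OF level_ideal n3])
  have lift: "\<exists>x\<in>carrier R. X = level +> x" if "X \<in> carrier ?Q" for X
    using that by (rule quotient_carrierE) auto
  interpret K: transvection_free_subgroup ?Q n "?h ` H"
  proof unfold_locales
    show "n \<ge> 3"
      by (rule n3)
    show "right_exchange ?Q"
      using level_ideal exch by (rule right_exchange_quotient)
    show "?h ` H \<subseteq> Units h.C.M"
      using H_Units h.map_mat_Units(1) by blast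
    have H_carrier: "A \<in> carrier M" if "A \<in> H" for A
      using that H_Units M.Units_closed by blast
    fix g assume "g \<in> ?h ` H"
    then obtain A where A: "A \<in> H" "g = ?h A"
      by blast
    show "inv\<^bsub>h.C.M\<^esub> g \<in> ?h ` H"
      using A H_inv[of A] H_Units h.map_mat_Units(2)[of A] by (metis imageI subsetD)
    show "g \<otimes>\<^bsub>h.C.M\<^esub> g' \<in> ?h ` H" if g': "g' \<in> ?h ` H" for g'
    proof -
      obtain B where "B \<in> H" "g' = ?h B"
        using g' by blast
      then show ?thesis
        using A H_mult[of A B] H_carrier h.map_mat_mult[of A B] by (metis imageI)
    qed
    show "transvection n ?Q i j X \<otimes>\<^bsub>h.C.M\<^esub> g \<otimes>\<^bsub>h.C.M\<^esub> transvection n ?Q i j (\<ominus>\<^bsub>?Q\<^esub> X) \<in> ?h ` H"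
      if ij: "i < n" "j < n" "i \<noteq> j" "X \<in> carrier ?Q" for i j X
    proof -
      obtain x where x: "x \<in> carrier R" "X = level +> x"
        using lift ij by blast
      have "?h (transvection n R i j x \<otimes>\<^bsub>M\<^esub> A \<otimes>\<^bsub>M\<^esub> transvection n R i j (\<ominus> x)) =
          transvection n ?Q i j X \<otimes>\<^bsub>h.C.M\<^esub> g \<otimes>\<^bsub>h.C.M\<^esub> transvection n ?Q i j (\<ominus>\<^bsub>?Q\<^esub> X)"
        using x A H_carrier by (simp add: h.map_mat_mult h.map_mat_transvection)
      then show ?thesis
        using H_conj[OF ij(1-3) x(1) A(1)] by (metis imageI)
    qed
  next
    fix i j X assume ij: "i < n" "j < n" "i \<noteq> j" "X \<in> carrier ?Q" and "transvection n ?Q i j X \<in> ?h ` H"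
    then obtain A where A: "A \<in> H" "?h A = transvection n ?Q i j X"
      by force
    obtain x where x: "x \<in> carrier R" "X = level +> x"
      using lift ij by blast
    obtain k where k: "k < n" "k \<noteq> i" "k \<noteq> j"
      using ex_third_index[OF n3] by blast
    let ?t = "transvection n R i j x" and ?t' = "transvection n R i j (\<ominus> x)"
      and ?s = "transvection n R j k \<one>" and ?s' = "transvection n R j k (\<ominus> \<one>)"
    have A': "A \<in> Units M" "A \<in> carrier M" "inv\<^bsub>M\<^esub> A \<in> carrier M"
      using A H_Units M.Units_closed by auto
    have t: "?t \<in> Units M" "?t' \<in> Units M" "?t \<in> carrier M" "?t' \<in> carrier M" "inv\<^bsub>M\<^esub> ?t' = ?t"
      "?t \<otimes>\<^bsub>M\<^esub> ?t' = \<one>\<^bsub>M\<^esub>"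
      using ij x by (simp_all add: transvection_Units transvection_inv transvection_add r_neg)
    let ?c = "?t' \<otimes>\<^bsub>M\<^esub> A"
    have c: "?c \<in> Units M"
      using A' t by simp
    have "?h ?c = transvection n ?Q i j (\<ominus>\<^bsub>?Q\<^esub> X) \<otimes>\<^bsub>h.C.M\<^esub> transvection n ?Q i j X"
      using A A' x by (simp add: h.map_mat_mult h.map_mat_transvection)
    also have "\<dots> = \<one>\<^bsub>h.C.M\<^esub>"
      using ij by (simp add: h.C.transvection_add h.S.l_neg)
    finally have "?c \<in> full_congruence n R level"
      using c by (simp add: full_congruence_def group_center_def h.C.M.Units_closed)
    note ce = full_congruence_entries[OF level_ideal this]
    have "?c \<otimes>\<^bsub>M\<^esub> ?s \<otimes>\<^bsub>M\<^esub> inv\<^bsub>M\<^esub> ?c \<otimes>\<^bsub>M\<^esub> ?s' \<in> relative_elementary n R level"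
      using ce k ij by (intro N.congruence_commutator_mem[OF exch ce(1)]) auto
    then have "?c \<otimes>\<^bsub>M\<^esub> ?s \<otimes>\<^bsub>M\<^esub> inv\<^bsub>M\<^esub> ?c \<otimes>\<^bsub>M\<^esub> ?s' \<in> H"
      using relative_elementary_subset by blast
    \<comment> \<open>Conjugating by \<open>?t\<close> uses \<open>t c = A\<close> to turn the
      commutator of \<open>?c\<close> with \<open>?s\<close> into \<open>A s A\<^sup>-\<^sup>1 (t
      s\<^sup>-\<^sup>1 t\<^sup>-\<^sup>1)\<close>.\<close>
    then have 1: "?t \<otimes>\<^bsub>M\<^esub> (?c \<otimes>\<^bsub>M\<^esub> ?s \<otimes>\<^bsub>M\<^esub> inv\<^bsub>M\<^esub> ?c \<otimes>\<^bsub>M\<^esub> ?s') \<otimes>\<^bsub>M\<^esub> ?t' \<in> H"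
      using ij x by (intro H_conj) auto
    have ci: "inv\<^bsub>M\<^esub> ?c = inv\<^bsub>M\<^esub> A \<otimes>\<^bsub>M\<^esub> ?t"
      using group.inv_mult_group[OF GL_group, of ?t' A] A' t c by simp
    have tc: "?t \<otimes>\<^bsub>M\<^esub> (?t' \<otimes>\<^bsub>M\<^esub> W) = W" if "W \<in> carrier M" for W
      using that t by (simp add: M.m_assoc[symmetric])
    have 2: "A \<otimes>\<^bsub>M\<^esub> ?s \<otimes>\<^bsub>M\<^esub> inv\<^bsub>M\<^esub> A \<otimes>\<^bsub>M\<^esub> (?t \<otimes>\<^bsub>M\<^esub> ?s' \<otimes>\<^bsub>M\<^esub> ?t') \<in> H"
      using 1 A' t by (simp add: ci M.m_assoc tc)
    have s: "?s \<in> carrier M" "?s' \<in> carrier M" "?s \<otimes>\<^bsub>M\<^esub> ?s' = \<one>\<^bsub>M\<^esub>" "?s' \<otimes>\<^bsub>M\<^esub> ?s = \<one>\<^bsub>M\<^esub>"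
      using k ij by (simp_all add: transvection_add r_neg l_neg)
    have "?s \<otimes>\<^bsub>M\<^esub> inv\<^bsub>M\<^esub> A \<otimes>\<^bsub>M\<^esub> ?s' \<in> H"
      using H_conj[of j k \<one>] H_inv[OF A(1)] k ij by auto
    then have 3: "A \<otimes>\<^bsub>M\<^esub> (?s \<otimes>\<^bsub>M\<^esub> inv\<^bsub>M\<^esub> A \<otimes>\<^bsub>M\<^esub> ?s') \<in> H"
      by (rule H_mult[OF A(1)])
    \<comment> \<open>The commutator of \<open>A\<close> with \<open>?s\<close> is also in
      \<open>H\<close> and shares the factor \<open>A s A\<^sup>-\<^sup>1\<close>. The quotient of
      the two elements is the commutator \<open>?Z\<close> of \<open>?t\<close> and
      \<open>?s\<close>, a genuine transvection over \<open>R\<close> with coefficient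
      \<open>x\<close>.\<close>
    let ?X = "A \<otimes>\<^bsub>M\<^esub> ?s \<otimes>\<^bsub>M\<^esub> inv\<^bsub>M\<^esub> A \<otimes>\<^bsub>M\<^esub> (?t \<otimes>\<^bsub>M\<^esub> ?s' \<otimes>\<^bsub>M\<^esub> ?t')" and ?Z = "?t \<otimes>\<^bsub>M\<^esub> ?s \<otimes>\<^bsub>M\<^esub> ?t' \<otimes>\<^bsub>M\<^esub> ?s'"
    have t't: "?t' \<otimes>\<^bsub>M\<^esub> (?t \<otimes>\<^bsub>M\<^esub> W) = W" and s's: "?s' \<otimes>\<^bsub>M\<^esub> (?s \<otimes>\<^bsub>M\<^esub> W) = W" if "W \<in> carrier M" for W
      using that t s ij x by (simp_all add: M.m_assoc[symmetric] transvection_add l_neg)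
    have "A \<otimes>\<^bsub>M\<^esub> (?s \<otimes>\<^bsub>M\<^esub> inv\<^bsub>M\<^esub> A \<otimes>\<^bsub>M\<^esub> ?s') = ?X \<otimes>\<^bsub>M\<^esub> ?Z"
      using A' t(3,4) s(1,2) by (simp add: M.m_assoc t't s's tc)
    moreover have "?X \<in> Units M" "?Z \<in> carrier M"
      using 2 H_Units t s by auto
    ultimately have "inv\<^bsub>M\<^esub> ?X \<otimes>\<^bsub>M\<^esub> (A \<otimes>\<^bsub>M\<^esub> (?s \<otimes>\<^bsub>M\<^esub> inv\<^bsub>M\<^esub> A \<otimes>\<^bsub>M\<^esub> ?s')) = ?Z"
      using Units_cancel[of ?X ?Z] by (simp only:)
    then have "?Z \<in> H"
      using H_mult[OF H_inv[OF 2] 3] by simp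
    then have "transvection n R i k (x \<otimes> \<one>) \<in> H"
      using transvection_commutator[of i j k x \<one>] k ij x by simp
    then have "x \<in> level"
      using mem_level[of i k x] k ij x by simp
    then show "X = \<zero>\<^bsub>?Q\<^esub>"
      using x by (simp add: quotient_zero I.a_rcos_const)
  qed
  show ?thesis
    using K.subset_center H_Units unfolding full_congruence_def by auto
qed

end

theorem theorem3:
  fixes R :: "('a, 'r) ring_scheme" and n :: nat and H :: "'a mat set"
  assumes "exchange_ring R" and "n \<ge> 3" and "subgroup H (GL n R)"
  shows "(normalised_by (GL n R) H (elementary_subgroup n R) \<longleftrightarrow>
      (\<exists>I. ideal I R \<and> relative_elementary n R I \<subseteq> H \<and> H \<subseteq> full_congruence n R I)) \<and>
    (\<forall>I J. ideal I R \<and> relative_elementary n R I \<subseteq> H \<and> H \<subseteq> full_congruence n R I \<and>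
      ideal J R \<and> relative_elementary n R J \<subseteq> H \<and> H \<subseteq> full_congruence n R J \<longrightarrow> I = J)"
proof -
  interpret ring R
    using assms(1) by (simp add: exchange_ring_def)
  interpret matrix_ring_over R n ..
  have exch: "right_exchange R"
    using assms(1) by (rule exchange_ring_right_exchange)
  have HU: "H \<subseteq> Units M"
    using subgroup.subset[OF assms(3)] by simp
  have "\<exists>I. ideal I R \<and> relative_elementary n R I \<subseteq> H \<and> H \<subseteq> full_congruence n R I"
    if norm: "normalised_by (GL n R) H (elementary_subgroup n R)"
  proof -
    interpret elementary_normalised R n H
    proof (intro elementary_normalised.intro elementary_normalised_axioms.intro matrix_ring_over_axioms)
      show "transvection n R i j x \<otimes>\<^bsub>M\<^esub> h \<otimes>\<^bsub>M\<^esub> transvection n R i j (\<ominus>\<^bsub>R\<^esub> x) \<in> H"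
        if "i < n" "j < n" "i \<noteq> j" "x \<in> carrier R" "h \<in> H" for i j x h
        using norm that unfolding normalised_by_elementary_iff[OF assms(3)] by simp
    qed (rule assms(2,3) exch)+
    show ?thesis
      using level_ideal relative_elementary_subset subset_full_congruence by blast
  qed
  moreover have "normalised_by (GL n R) H (elementary_subgroup n R)"
    if I: "ideal I R" "relative_elementary n R I \<subseteq> H" "H \<subseteq> full_congruence n R I" for I
  proof -
    interpret N: level_subgroup R n I "relative_elementary n R I"
      using I(1) assms(2) by (rule relative_elementary_level)
    show ?thesis
      unfolding normalised_by_elementary_iff[OF assms(3)]
    proof (intro allI impI)
      fix i j x h assume ij: "i < n" "j < n" "i \<noteq> j" "x \<in> carrier R" and h: "h \<in> H"
      let ?t = "transvection n R i j x" and ?t' = "transvection n R i j (\<ominus>\<^bsub>R\<^esub> x)"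
      have hU: "h \<in> Units M" "h \<in> carrier M" "inv\<^bsub>M\<^esub> h \<in> carrier M"
        using h HU M.Units_closed by auto
      \<comment> \<open>The commutator is taken with the inverse of \<open>h\<close>, so that
        multiplying it by \<open>h\<close> on the left yields exactly the conjugate of
        \<open>h\<close> by \<open>?t\<close>.\<close>
      have "inv\<^bsub>M\<^esub> h \<in> H"
        using subgroup.m_inv_closed[OF assms(3) h] hU by simp
      then have "inv\<^bsub>M\<^esub> h \<in> full_congruence n R I"
        using I(3) by blast
      note ce = full_congruence_entries[OF I(1) this]
      have "inv\<^bsub>M\<^esub> h \<otimes>\<^bsub>M\<^esub> ?t \<otimes>\<^bsub>M\<^esub> inv\<^bsub>M\<^esub> (inv\<^bsub>M\<^esub> h) \<otimes>\<^bsub>M\<^esub> ?t' \<in> relative_elementary n R I"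
        using ce ij by (intro N.congruence_commutator_mem[OF exch ce(1)]) auto
      then have "inv\<^bsub>M\<^esub> h \<otimes>\<^bsub>M\<^esub> ?t \<otimes>\<^bsub>M\<^esub> h \<otimes>\<^bsub>M\<^esub> ?t' \<in> H"
        using I(2) hU by auto
      then have "h \<otimes>\<^bsub>M\<^esub> (inv\<^bsub>M\<^esub> h \<otimes>\<^bsub>M\<^esub> ?t \<otimes>\<^bsub>M\<^esub> h \<otimes>\<^bsub>M\<^esub> ?t') \<in> H"
        using subgroup.m_closed[OF assms(3) h] by simp
      also have "h \<otimes>\<^bsub>M\<^esub> (inv\<^bsub>M\<^esub> h \<otimes>\<^bsub>M\<^esub> ?t \<otimes>\<^bsub>M\<^esub> h \<otimes>\<^bsub>M\<^esub> ?t') = (h \<otimes>\<^bsub>M\<^esub> inv\<^bsub>M\<^esub> h) \<otimes>\<^bsub>M\<^esub> (?t \<otimes>\<^bsub>M\<^esub> h \<otimes>\<^bsub>M\<^esub> ?t')"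
        using hU(2,3) ij by (simp add: M.m_assoc)
      finally show "?t \<otimes>\<^bsub>M\<^esub> h \<otimes>\<^bsub>M\<^esub> ?t' \<in> H"
        using hU ij by simp
    qed
  qed
  \<comment> \<open>The lower bound belonging to \<open>I\<close> is played against the upper bound
    belonging to \<open>J\<close>: a transvection in the congruence subgroup of level
    \<open>J\<close> has its off-diagonal entry in \<open>J\<close>. Exchanging the roles gives
    equality.\<close>
  moreover have "I \<subseteq> J"
    if I: "ideal I R" "relative_elementary n R I \<subseteq> H" and J: "ideal J R" "H \<subseteq> full_congruence n R J" for I J
  proof
    fix x assume x: "x \<in> I"
    interpret N: level_subgroup R n I "relative_elementary n R I"
      using I(1) assms(2) by (rule relative_elementary_level)
    have "transvection n R 0 1 x \<in> full_congruence n R J"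
      using N.N_trans[of 0 1 x] x assms(2) I(2) J(2) by auto
    from full_congruence_entries(2)[OF J(1) this, of 0 1]
    show "x \<in> J"
      using assms(2) N.a_Hcarr[OF x] by (simp add: transvection_eq)
  qed
  ultimately show ?thesis
    by blast
qed

end
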